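(* Let $\Gamma$ be a limit cycle of $\dot u=F(u)$ at a strong resonance 1:2 (R2) bifurcation, with the critical center manifold near $\Gamma$ parametrized by $(\tau,\xi_1,\xi_2)$ as in the context, so that the restricted dynamics has the R2 periodic normal form with coefficients $\alpha,a,b$. Let $v_1,v_2,\varphi^*,v_1^*,v_2^*$ be as in the context. Then $$\alpha=\frac12\int_0^T\langle\varphi^*,B(\tau;v_1,v_1)\rangle d\tau,$$ $h_{20}$ is the unique solution on $[0,T]$ of $$\dot h_{20}-Ah_{20}-B(\tau;v_1,v_1)+2\alpha F(u_0)=0,\quad h_{20}(T)-h_{20}(0)=0,\quad\int_0^T\langle\varphi^*,h_{20}\rangle d\tau=\int_0^T\langle\varphi^*,B(\tau;v_1,v_2)\rangle d\tau,$$ $h_{11}$ is the unique solution on $[0,T]$ of $$\dot h_{11}-Ah_{11}-B(\tau;v_1,v_2)+h_{20}=0,\quad h_{11}(T)-h_{11}(0)=0,\quad\int_0^T\langle\varphi^*,h_{11}\rangle d\tau=\frac12\int_0^T\langle\varphi^*,B(\tau;v_2,v_2)\rangle d\tau,$$ and $$a=\frac16\int_0^T\langle v_1^*,C(\tau;v_1,v_1,v_1)+3B(\tau;v_1,h_{20})-6\alpha Av_1\rangle d\tau,$$ $$\begin{aligned}b={}&\frac12\int_0^T\langle v_1^*,-2\alpha Av_2+C(\tau;v_1,v_1,v_2)+B(\tau;h_{20},v_2)+2B(\tau;h_{11},v_1)\rangle d\tau\\&+\frac12\int_0^T\langle v_2^*,C(\tau;v_1,v_1,v_1)+3B(\tau;v_1,h_{20})-6\alpha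 Av_1\rangle d\tau .\end{aligned}$$
   Context: Setting. $F:\mathbb R^n\to\mathbb R^n$ is sufficiently smooth and $u_0$ is a nonconstant periodic solution of $\dot u=F(u)$ with minimal period $T>0$; $\Gamma$ is its orbit. $A(\tau)=F_u(u_0(\tau))$, and $B(\tau;\cdot,\cdot)$, $C(\tau;\cdot,\cdot,\cdot)$ are the symmetric multilinear forms of second and third derivatives of $F$ at $u_0(\tau)$. Dots over functions of $\tau$ denote $d/d\tau$; $\langle a,b\rangle=a^{\rm T}b$. Let $Y$ solve $\dot Y=A(\tau)Y$, $Y(0)=I_n$; the eigenvalues of $Y(T)$ are the multipliers, critical if of modulus 1. R2 bifurcation: the multiplier $1$ is simple and the only other critical multiplier is $-1$, with algebraic multiplicity two and a two-dimensional Jordan block. The three-dimensional critical center manifold near $\Gamma$ is parametrized as $u(\tau,\xi)=u_0(\tau)+\xi_1v_1(\tau)+\xi_2v_2(\tau)+H(\tau,\xi)$, $\xi=(\xi_1,\xi_2)\in\mathbb R^2$ small, $H$ smooth and $2T$-periodic in $\tau$, $$H=\sum_{2\le i+j\le3}\frac1{i!\,j!}h_{ij}(\tau)\xi_1^i\xi_2^j+O(\|\xi\|^4),$$ with $u(\tau,\xi_1,\xi_2)=u(\tau+T,-\xi_1,-\xi_2)$ (so $h_{ij}(\tau+T)=(-1)^{i+j}h_{ij}(\tau)$). The dynamics restricted to it is $$\frac{d\tau}{dt}=1+\alpha\xi_1^2+\dots,\quad\frac{d\xi_1}{dt}=\xi_2+\alpha\xi_1^2\xi_2+\dots,\quad\frac{d\xi_2}{dt}=a\xi_1^3+b\xi_1^2\xi_2+\dots,$$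 with real $\alpha,a,b$ and dots denoting $O(\|\xi\|^4)$ terms $2T$-periodic in $\tau$; that is, if $(\tau(t),\xi(t))$ solves this system then $u(\tau(t),\xi(t))$ solves $\dot u=F(u)$. The following are on $[0,T]$: $\dot v_1-Av_1=0$, $v_1(T)=-v_1(0)$, $\int_0^T\langle v_1,v_1\rangle d\tau=1$; $\dot v_2-Av_2+v_1=0$, $v_2(T)=-v_2(0)$, $\int_0^T\langle v_2,v_1\rangle d\tau=0$ (both extended by $v_i(\tau+T)=-v_i(\tau)$); $\dot\varphi^*+A^{\rm T}\varphi^*=0$, $\varphi^*(T)=\varphi^*(0)$, $\int_0^T\langle\varphi^*,F(u_0)\rangle d\tau=1$; $\dot v_1^*+A^{\rm T}v_1^*=0$, $v_1^*(T)=-v_1^*(0)$, $\int_0^T\langle v_1^*,v_2\rangle d\tau=1$; $\dot v_2^*+A^{\rm T}v_2^*-v_1^*=0$, $v_2^*(T)=-v_2^*(0)$, $\int_0^T\langle v_2^*,v_2\rangle d\tau=0$. *)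

theory Defs
  imports
    "HOL-Analysis.Analysis"
    "HOL-Computational_Algebra.Polynomial"
    "HOL-Library.Landau_Symbols"
begin

text \<open>
  \<open>f\<close> is \<open>k\<close> times continuously differentiable on \<open>S\<close>, meant for open \<open>S\<close> in a
  finite-dimensional space (continuity is asked of each directional derivative separately): all iterated
  directional derivatives up to order \<open>k\<close> exist as Frechet derivatives and are continuous.
\<close>

primrec Ck_on ::
  "nat \<Rightarrow> ('a::real_normed_vector \<Rightarrow> 'b::real_normed_vector) \<Rightarrow> 'a set \<Rightarrow> bool" where
  "Ck_on 0 f S \<longleftrightarrow> continuous_on S f"
| "Ck_on (Suc k) f S \<longleftrightarrow>
     (\<forall>x\<in>S. f differentiable (at x)) \<and>
     (\<forall>v. Ck_on k (\<lambda>x. frechet_derivative f (at x) v) S)"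

text \<open>Second and third derivatives at \<open>x\<close> as multilinear forms.\<close>

definition deriv2 ::
  "('a::real_normed_vector \<Rightarrow> 'b::real_normed_vector) \<Rightarrow> 'a \<Rightarrow> 'a \<Rightarrow> 'a \<Rightarrow> 'b" where
  "deriv2 f x p q = frechet_derivative (\<lambda>y. frechet_derivative f (at y) p) (at x) q"

definition deriv3 ::
  "('a::real_normed_vector \<Rightarrow> 'b::real_normed_vector) \<Rightarrow> 'a \<Rightarrow> 'a \<Rightarrow> 'a \<Rightarrow> 'a \<Rightarrow> 'b" where
  "deriv3 f x p q r = frechet_derivative (\<lambda>y. deriv2 f y p q) (at x) r"

definition complexify :: "real^'n^'n \<Rightarrow> complex^'n^'n" where
  "complexify M = (\<chi> i j. complex_of_real (M $ i $ j))"

definition charpoly :: "'a::comm_ring_1^'n^'n \<Rightarrow> 'a poly" where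
  "charpoly M = det ((\<chi> i j. (if i = j then [:0, 1:] else 0) - [:M $ i $ j:]) :: 'a poly^'n^'n)"

definition eigenvalue :: "'a::field^'n^'n \<Rightarrow> 'a \<Rightarrow> bool" where
  "eigenvalue M \<mu> \<longleftrightarrow> (\<exists>w. w \<noteq> 0 \<and> M *v w = \<mu> *s w)"

definition algebraic_multiplicity :: "complex^'n^'n \<Rightarrow> complex \<Rightarrow> nat" where
  "algebraic_multiplicity M \<mu> = order \<mu> (charpoly M)"

text \<open>
  \<open>M\<close> acts on the span of \<open>p\<close>, \<open>q\<close> by the Jordan block of size two with eigenvalue \<open>\<mu>\<close>
  (\<open>p \<noteq> 0\<close> already forces \<open>p\<close>, \<open>q\<close> to be linearly independent).
\<close>

definition two_dim_Jordan_block :: "'a::field^'n^'n \<Rightarrow> 'a \<Rightarrow> bool" where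
  "two_dim_Jordan_block M \<mu> \<longleftrightarrow>
     (\<exists>p q. p \<noteq> 0 \<and> M *v p = \<mu> *s p \<and> M *v q = \<mu> *s q + p)"

text \<open>The argument is the monodromy matrix of the cycle; its eigenvalues are the multipliers.\<close>

definition R2_multipliers :: "real^'n^'n \<Rightarrow> bool" where
  "R2_multipliers M \<longleftrightarrow>
     algebraic_multiplicity (complexify M) 1 = 1 \<and>
     eigenvalue (complexify M) (-1) \<and>
     algebraic_multiplicity (complexify M) (-1) = 2 \<and>
     two_dim_Jordan_block (complexify M) (-1) \<and>
     (\<forall>\<mu>. eigenvalue (complexify M) \<mu> \<and> cmod \<mu> = 1 \<longrightarrow> \<mu> = 1 \<or> \<mu> = -1)"

definition periodic_orbit ::
  "('a::real_normed_vector \<Rightarrow> 'a) \<Rightarrow> (real \<Rightarrow> 'a) \<Rightarrow> real \<Rightarrow> bool" where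
  "periodic_orbit F u0 T \<longleftrightarrow>
     T > 0 \<and>
     (\<forall>t. (u0 has_vector_derivative F (u0 t)) (at t)) \<and>
     (\<nexists>c. \<forall>t. u0 t = c) \<and>
     (\<forall>t. u0 (t + T) = u0 t) \<and>
     (\<forall>S. 0 < S \<and> S < T \<longrightarrow> (\<exists>t. u0 (t + S) \<noteq> u0 t))"

definition cm_param ::
  "(real \<Rightarrow> real^'n) \<Rightarrow> (real \<Rightarrow> real^'n) \<Rightarrow> (real \<Rightarrow> real^'n) \<Rightarrow> (real \<Rightarrow> real^2 \<Rightarrow> real^'n)
     \<Rightarrow> real \<Rightarrow> real^2 \<Rightarrow> real^'n" where
  "cm_param u0 v1 v2 H \<tau> \<xi> = u0 \<tau> + (\<xi> $ 1) *\<^sub>R v1 \<tau> + (\<xi> $ 2) *\<^sub>R v2 \<tau> + H \<tau> \<xi>"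

text \<open>
  \<open>(\<tau>, \<xi>)\<close> solves, for all times in \<open>J\<close>, the R2 periodic normal form with coefficients
  \<open>\<alpha>\<close>, \<open>a\<close>, \<open>b\<close> and higher-order terms \<open>R0\<close>, \<open>R1\<close>, \<open>R2\<close>.
\<close>

definition solves_R2_normal_form ::
  "real \<Rightarrow> real \<Rightarrow> real \<Rightarrow> (real \<Rightarrow> real^2 \<Rightarrow> real) \<Rightarrow> (real \<Rightarrow> real^2 \<Rightarrow> real) \<Rightarrow> (real \<Rightarrow> real^2 \<Rightarrow> real)
     \<Rightarrow> (real \<Rightarrow> real) \<Rightarrow> (real \<Rightarrow> real^2) \<Rightarrow> real set \<Rightarrow> bool" where
  "solves_R2_normal_form \<alpha> a b R0 R1 R2 \<tau> \<xi> J \<longleftrightarrow>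
     (\<forall>t\<in>J.
        (\<tau> has_real_derivative 1 + \<alpha> * (\<xi> t $ 1)^2 + R0 (\<tau> t) (\<xi> t)) (at t) \<and>
        ((\<lambda>s. \<xi> s $ 1) has_real_derivative
           \<xi> t $ 2 + \<alpha> * (\<xi> t $ 1)^2 * (\<xi> t $ 2) + R1 (\<tau> t) (\<xi> t)) (at t) \<and>
        ((\<lambda>s. \<xi> s $ 2) has_real_derivative
           a * (\<xi> t $ 1)^3 + b * (\<xi> t $ 1)^2 * (\<xi> t $ 2) + R2 (\<tau> t) (\<xi> t)) (at t))"

text \<open>
  The higher-order terms of the normal form: \<open>C\<^sup>1\<close>, so that the restricted system is well posed,
  \<open>2T\<close>-periodic in \<open>\<tau>\<close>, and of fourth order in \<open>\<xi>\<close>.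
\<close>

definition higher_order_term :: "real \<Rightarrow> real \<Rightarrow> (real \<Rightarrow> real^2 \<Rightarrow> real) \<Rightarrow> bool" where
  "higher_order_term T \<delta> R \<longleftrightarrow>
     Ck_on 1 (\<lambda>(\<tau>, \<xi>). R \<tau> \<xi>) (UNIV \<times> ball 0 \<delta>) \<and>
     (\<forall>\<tau>. \<forall>\<xi>\<in>ball 0 \<delta>. R (\<tau> + 2 * T) \<xi> = R \<tau> \<xi>) \<and>
     (\<forall>\<tau>. R \<tau> \<in> O[at 0](\<lambda>\<xi>. norm \<xi> ^ 4))"

text \<open>
  Parametrization of a three-dimensional critical center manifold near the cycle. Its image
  contains the cycle (\<open>\<xi> = 0\<close>), is tangent there to the directions \<open>F \<circ> u0\<close>, \<open>v1\<close>, \<open>v2\<close>, and is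
  locally invariant by the last clause. Only \<open>h i j\<close> with \<open>2 \<le> i + j \<le> 3\<close> occur.
\<close>

definition R2_center_manifold ::
  "(real^'n \<Rightarrow> real^'n) \<Rightarrow> (real \<Rightarrow> real^'n) \<Rightarrow> real \<Rightarrow> (real \<Rightarrow> real^'n) \<Rightarrow> (real \<Rightarrow> real^'n)
     \<Rightarrow> (real \<Rightarrow> real^2 \<Rightarrow> real^'n) \<Rightarrow> (nat \<Rightarrow> nat \<Rightarrow> real \<Rightarrow> real^'n)
     \<Rightarrow> real \<Rightarrow> real \<Rightarrow> real \<Rightarrow> bool" where
  "R2_center_manifold F u0 T v1 v2 H h \<alpha> a b \<longleftrightarrow>
     (\<exists>\<delta>>0. \<exists>R0 R1 R2.
        Ck_on 4 (\<lambda>(\<tau>, \<xi>). H \<tau> \<xi>) (UNIV \<times> ball 0 \<delta>) \<and>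
        (\<forall>\<tau>. \<forall>\<xi>\<in>ball 0 \<delta>. H (\<tau> + 2 * T) \<xi> = H \<tau> \<xi>) \<and>
        (\<forall>\<tau>. (\<lambda>\<xi>. norm (H \<tau> \<xi> -
               (\<Sum>(i, j) \<in> {(i, j). 2 \<le> i + j \<and> i + j \<le> 3}.
                  (1 / (fact i * fact j) * (\<xi> $ 1)^i * (\<xi> $ 2)^j) *\<^sub>R h i j \<tau>)))
             \<in> O[at 0](\<lambda>\<xi>. norm \<xi> ^ 4)) \<and>
        (\<forall>\<tau>. \<forall>\<xi>\<in>ball 0 \<delta>. cm_param u0 v1 v2 H \<tau> \<xi> = cm_param u0 v1 v2 H (\<tau> + T) (- \<xi>)) \<and>
        higher_order_term T \<delta> R0 \<and> higher_order_term T \<delta> R1 \<and> higher_order_term T \<delta> R2 \<and>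
        (\<forall>\<tau> \<xi> r s.
           (\<forall>t\<in>{r<..<s}. \<xi> t \<in> ball 0 \<delta>) \<and>
           solves_R2_normal_form \<alpha> a b R0 R1 R2 \<tau> \<xi> {r<..<s} \<longrightarrow>
           (\<forall>t\<in>{r<..<s}.
              ((\<lambda>t. cm_param u0 v1 v2 H (\<tau> t) (\<xi> t)) has_vector_derivative
                 F (cm_param u0 v1 v2 H (\<tau> t) (\<xi> t))) (at t))))"

definition unique_solution_on ::
  "real set \<Rightarrow> ((real \<Rightarrow> 'a) \<Rightarrow> bool) \<Rightarrow> (real \<Rightarrow> 'a) \<Rightarrow> bool" where
  "unique_solution_on S P g \<longleftrightarrow> P g \<and> (\<forall>k. P k \<longrightarrow> (\<forall>\<tau>\<in>S. k \<tau> = g \<tau>))"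

end

theory Submission
  imports Defs
begin

text \<open>
  Through every point \<open>(\<tau>, \<xi>)\<close> with \<open>\<xi>\<close> small there passes a solution of the restricted system (its right-hand
  side is locally Lipschitz), and differentiating the parametrization along it turns invariance into the
  homological equation \<open>\<partial>\<^sub>\<tau>u \<tau>' + \<partial>\<^sub>1u \<xi>\<^sub>1' + \<partial>\<^sub>2u \<xi>\<^sub>2' = F(u)\<close>. Restricted to a ray \<open>\<xi> = s\<eta>\<close> both sides have
  third-order expansions in \<open>s\<close>; comparing them for all \<open>\<eta>\<close> gives linear differential equations for the
  \<open>h\<^sub>i\<^sub>j\<close> with \<open>i + j \<le> 3\<close>. Pairing these with the adjoint functions makes the terms in \<open>h\<^sub>i\<^sub>j' - Ah\<^sub>i\<^sub>j\<close>
  integrate to boundary terms, which cancel by the (anti)periodicity of \<open>h\<^sub>i\<^sub>j\<close>: this is the Fredholm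
  solvability condition, and it yields \<open>\<alpha>\<close> (from \<open>\<xi>\<^sub>1\<^sup>2\<close>), the normalizations of \<open>h\<^sub>2\<^sub>0\<close> (from \<open>\<xi>\<^sub>1\<xi>\<^sub>2\<close>) and \<open>h\<^sub>1\<^sub>1\<close>
  (from \<open>\<xi>\<^sub>2\<^sup>2\<close>), \<open>a\<close> (from \<open>\<xi>\<^sub>1\<^sup>3\<close>) and \<open>b\<close> (from \<open>\<xi>\<^sub>1\<^sup>2\<xi>\<^sub>2\<close>). Uniqueness holds because the multiplier \<open>1\<close> is
  simple, so that \<open>T\<close>-periodic solutions of the variational equation are multiples of \<open>F(u\<^sub>0)\<close>.
\<close>

section \<open>Third-order expansions in one variable\<close>

text \<open>The fourth-order bound on the remainder of \<open>H\<close> is given for each \<tau>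
  separately, with no uniformity in \<tau>, and says nothing about derivatives, so the expansion
  cannot be differentiated term by term. Instead the \<open>h i j\<close> are identified with
  directional derivatives of \<open>H\<close> at \<xi> = 0; differentiation in \<tau> is then
  exchanged with up to three derivatives in \<xi>, which is where four derivatives of
  \<open>H\<close> are used. Rays reduce the comparisons to functions of one real variable, whose
  third-order coefficients are unique, and mixed coefficients are recovered by polarization. The
  equation for \<open>h 2 1\<close> contains the unknown \<open>h 3 0\<close>. Pairing the equation
  for \<open>h 3 0\<close> with \<open>v2s\<close>, whose adjoint equation has the source
  \<open>v1s\<close>, expresses the integral of \<open>v1s \<tau> \<bullet> h 3 0 \<tau>\<close> by
  known data. This is the origin of the integral with \<open>v2s\<close> in the formula for
  \<open>b\<close>.\<close>

definition jet3 :: "(real \<Rightarrow> 'a::real_normed_vector) \<Rightarrow> 'a \<Rightarrow> 'a \<Rightarrow> 'a \<Rightarrow> 'a \<Rightarrow> bool" where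
  "jet3 f c0 c1 c2 c3 \<longleftrightarrow>
     ((\<lambda>s. (f s - (c0 + s *\<^sub>R c1 + s^2 *\<^sub>R c2 + s^3 *\<^sub>R c3)) /\<^sub>R s^3) \<longlongrightarrow> 0) (at 0)"

lemma jet3_add:
  assumes "jet3 f a0 a1 a2 a3" "jet3 g b0 b1 b2 b3"
  shows "jet3 (\<lambda>s. f s + g s) (a0 + b0) (a1 + b1) (a2 + b2) (a3 + b3)"
  using tendsto_add[OF assms[unfolded jet3_def]]
  by (simp add: jet3_def scaleR_add_right [symmetric] del: scaleR_add_right)
    (simp add: algebra_simps)

lemma jet3_linear:
  assumes "bounded_linear L" "jet3 f a0 a1 a2 a3"
  shows "jet3 (\<lambda>s. L (f s)) (L a0) (L a1) (L a2) (L a3)"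
proof -
  interpret bounded_linear L by fact
  from tendsto[OF assms(2)[unfolded jet3_def]] show ?thesis
    by (simp add: jet3_def scaleR add diff zero)
qed

lemma jet3_diff:
  assumes "jet3 f a0 a1 a2 a3" "jet3 g b0 b1 b2 b3"
  shows "jet3 (\<lambda>s. f s - g s) (a0 - b0) (a1 - b1) (a2 - b2) (a3 - b3)"
  using jet3_add[OF assms(1) jet3_linear[OF bounded_linear_minus[OF bounded_linear_ident] assms(2)]]
  by simp

text \<open>The coefficient \<open>a3\<close> moves to order four and is absorbed by the new
  remainder, as the summand \<open>s *\<^sub>R a3\<close> in the limit below.\<close>

lemma jet3_times_s:
  assumes "jet3 f a0 a1 a2 a3"
  shows "jet3 (\<lambda>s. s *\<^sub>R f s) 0 a0 a1 a2"
proof -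
  have "((\<lambda>s. s *\<^sub>R ((f s - (a0 + s *\<^sub>R a1 + s^2 *\<^sub>R a2 + s^3 *\<^sub>R a3)) /\<^sub>R s^3) + s *\<^sub>R a3)
      \<longlongrightarrow> 0 *\<^sub>R 0 + 0 *\<^sub>R a3) (at 0)"
    using assms unfolding jet3_def by (intro tendsto_intros)
  then have "((\<lambda>s. s *\<^sub>R ((f s - (a0 + s *\<^sub>R a1 + s^2 *\<^sub>R a2 + s^3 *\<^sub>R a3)) /\<^sub>R s^3) + s *\<^sub>R a3)
      \<longlongrightarrow> 0) (at 0)"
    by simp
  then show ?thesis
    unfolding jet3_def
  proof (rule Lim_transform_eventually)
    have "s *\<^sub>R ((f s - (a0 + s *\<^sub>R a1 + s^2 *\<^sub>R a2 + s^3 *\<^sub>R a3)) /\<^sub>R s^3) + s *\<^sub>R a3 =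
        (s *\<^sub>R f s - (0 + s *\<^sub>R a0 + s\<^sup>2 *\<^sub>R a1 + s ^ 3 *\<^sub>R a2)) /\<^sub>R s ^ 3" if "s \<noteq> 0" for s :: real
      using that by (simp add: scaleR_diff_right scaleR_add_right divide_simps power2_eq_square power3_eq_cube)
    then show "\<forall>\<^sub>F s in at 0. s *\<^sub>R ((f s - (a0 + s *\<^sub>R a1 + s^2 *\<^sub>R a2 + s^3 *\<^sub>R a3)) /\<^sub>R s^3) + s *\<^sub>R a3 =
        (s *\<^sub>R f s - (0 + s *\<^sub>R a0 + s\<^sup>2 *\<^sub>R a1 + s ^ 3 *\<^sub>R a2)) /\<^sub>R s ^ 3"
      by (auto simp: eventually_at_filter)
  qed
qed

lemma jet3_cong:
  assumes "jet3 f a0 a1 a2 a3" "\<forall>\<^sub>F s in at 0. f s = g s"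
  shows "jet3 g a0 a1 a2 a3"
  using assms(1) unfolding jet3_def
  by (rule Lim_transform_eventually) (use assms(2) in \<open>eventually_elim, simp\<close>)

lemma tendsto_transform_at_0:
  fixes f :: "real \<Rightarrow> 'a::topological_space"
  assumes "(f \<longlongrightarrow> l) (at 0)" "\<And>s. s \<noteq> 0 \<Longrightarrow> f s = g s" "l = m"
  shows "(g \<longlongrightarrow> m) (at 0)"
  using Lim_transform_eventually[OF assms(1), of g] assms(2,3)
  by (auto simp: eventually_at_filter)

text \<open>Multiplying the remainder by \<open>s^3\<close>, \<open>s^2\<close>, \<open>s\<close>
  and \<open>1\<close> and letting \<open>s\<close> tend to 0 isolates the coefficients in turn,
  each step using that the earlier ones vanish.\<close>

lemma jet3_zero_unique:
  assumes "jet3 (\<lambda>s. 0) a0 a1 a2 a3"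
  shows "a0 = 0" "a1 = 0" "a2 = 0" "a3 = 0"
proof -
  let ?r = "\<lambda>s. (0 - (a0 + s *\<^sub>R a1 + s^2 *\<^sub>R a2 + s^3 *\<^sub>R a3)) /\<^sub>R s^3"
  have lim: "(?r \<longlongrightarrow> 0) (at 0)"
    using assms by (simp add: jet3_def)
  have "((\<lambda>s. - (s^3 *\<^sub>R ?r s) - s *\<^sub>R a1 - s^2 *\<^sub>R a2 - s^3 *\<^sub>R a3) \<longlongrightarrow> - (0^3 *\<^sub>R 0) - 0 *\<^sub>R a1 - 0^2 *\<^sub>R a2 - 0^3 *\<^sub>R a3) (at 0)"
    by (intro tendsto_intros lim)
  then have "((\<lambda>s. a0) \<longlongrightarrow> 0) (at (0::real))"
    by (rule tendsto_transform_at_0) (auto simp: algebra_simps)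
  then show a0: "a0 = 0"
    by (simp add: tendsto_const_iff)
  have "((\<lambda>s. - (s^2 *\<^sub>R ?r s) - s *\<^sub>R a2 - s^2 *\<^sub>R a3) \<longlongrightarrow> - (0^2 *\<^sub>R 0) - 0 *\<^sub>R a2 - 0^2 *\<^sub>R a3) (at 0)"
    by (intro tendsto_intros lim)
  then have "((\<lambda>s. a1) \<longlongrightarrow> 0) (at (0::real))"
    by (rule tendsto_transform_at_0) (auto simp: algebra_simps a0 power2_eq_square power3_eq_cube)
  then show a1: "a1 = 0"
    by (simp add: tendsto_const_iff)
  have "((\<lambda>s. - (s *\<^sub>R ?r s) - s *\<^sub>R a3) \<longlongrightarrow> - (0 *\<^sub>R 0) - 0 *\<^sub>R a3) (at 0)"
    by (intro tendsto_intros lim)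
  then have "((\<lambda>s. a2) \<longlongrightarrow> 0) (at (0::real))"
    by (rule tendsto_transform_at_0) (auto simp: algebra_simps a0 a1 power2_eq_square power3_eq_cube)
  then show a2: "a2 = 0"
    by (simp add: tendsto_const_iff)
  have "((\<lambda>s. - ?r s) \<longlongrightarrow> - 0) (at 0)"
    by (intro tendsto_intros lim)
  then have "((\<lambda>s. a3) \<longlongrightarrow> 0) (at (0::real))"
    by (rule tendsto_transform_at_0) (auto simp: a0 a1 a2)
  then show "a3 = 0"
    by (simp add: tendsto_const_iff)
qed

lemma jet3_unique:
  assumes "jet3 f a0 a1 a2 a3" "jet3 f b0 b1 b2 b3"
  shows "a0 = b0" "a1 = b1" "a2 = b2" "a3 = b3"
  using jet3_zero_unique[of "a0 - b0" "a1 - b1" "a2 - b2" "a3 - b3"] jet3_diff[OF assms]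
  by auto

lemma jet3_const: "jet3 (\<lambda>s. c) c 0 0 0"
  by (simp add: jet3_def)

text \<open>Serves the fourth-order terms of the normal form: multiplied by a factor with a limit,
  they stay invisible at third order.\<close>

lemma jet3_negligible_mult:
  assumes "jet3 r 0 0 0 0" "(f \<longlongrightarrow> l) (at 0)"
  shows "jet3 (\<lambda>s. r s *\<^sub>R f s) 0 0 0 0"
  using tendsto_scaleR[OF assms(1)[unfolded jet3_def] assms(2)]
  by (simp add: jet3_def)

lemma jet3_of_bound:
  assumes "\<forall>\<^sub>F s in at 0. norm (f s - (c0 + s *\<^sub>R c1 + s^2 *\<^sub>R c2 + s^3 *\<^sub>R c3)) \<le> M * s^4"
  shows "jet3 f c0 c1 c2 c3"
  unfolding jet3_def
proof (rule Lim_null_comparison)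
  show "\<forall>\<^sub>F s in at 0. norm ((f s - (c0 + s *\<^sub>R c1 + s^2 *\<^sub>R c2 + s^3 *\<^sub>R c3)) /\<^sub>R s^3) \<le> M * \<bar>s\<bar>"
    using assms eventually_neq_at_within[of 0 0 UNIV]
  proof eventually_elim
    case (elim s)
    have "s^4 = \<bar>s\<bar>^3 * \<bar>s\<bar>"
      by (simp add: power4_eq_xxxx power3_eq_cube abs_mult_self_eq)
    with elim show ?case
      by (simp add: divide_simps power_abs [symmetric] mult_ac)
  qed
  have "((\<lambda>s::real. M * \<bar>s\<bar>) \<longlongrightarrow> M * \<bar>0\<bar>) (at 0)"
    by (intro tendsto_intros)
  then show "((\<lambda>s::real. M * \<bar>s\<bar>) \<longlongrightarrow> 0) (at 0)" by simp
qed

text \<open>The mean value inequality on the segment from 0 to \<open>s\<close> takes the place of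
  integration, so no integrability of \<open>f'\<close> enters; \<open>f' 0 = 0\<close> covers the
  point that the limit at 0 ignores.\<close>

lemma little_o_integrate:
  fixes f :: "real \<Rightarrow> 'a::real_normed_vector"
  assumes der: "\<forall>\<^sub>F s in nhds 0. (f has_vector_derivative f' s) (at s)"
    and lim: "((\<lambda>s. f' s /\<^sub>R s^k) \<longlongrightarrow> 0) (at 0)" and "f 0 = 0" "f' 0 = 0"
  shows "((\<lambda>s. f s /\<^sub>R s^Suc k) \<longlongrightarrow> 0) (at 0)"
proof (rule tendstoI)
  fix e :: real assume "e > 0"
  then have "\<forall>\<^sub>F s in at 0. norm (f' s /\<^sub>R s^k) < e/2"
    using tendstoD[OF lim, of "e/2"] by simp
  then obtain d1 where d1: "d1 > 0" "\<And>s. s \<noteq> 0 \<Longrightarrow> \<bar>s\<bar> < d1 \<Longrightarrow> norm (f' s /\<^sub>R s^k) < e/2"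
    unfolding eventually_at by (auto simp: dist_real_def)
  obtain d2 where d2: "d2 > 0" "\<And>s. \<bar>s\<bar> < d2 \<Longrightarrow> (f has_vector_derivative f' s) (at s)"
    using der unfolding eventually_nhds_metric by (auto simp: dist_real_def)
  have b: "norm (f' t) \<le> e/2 * \<bar>s\<bar>^k" if "\<bar>t\<bar> \<le> \<bar>s\<bar>" "\<bar>s\<bar> < d1" for s t
  proof (cases "t = 0")
    case False
    with d1(2)[of t] that have "norm (f' t) \<le> e/2 * \<bar>t\<bar>^k"
      by (simp add: power_abs divide_simps mult_ac split: if_splits)
    also have "\<dots> \<le> e/2 * \<bar>s\<bar>^k"
      using that \<open>e > 0\<close> by (intro mult_left_mono power_mono) auto
    finally show ?thesis .
  qed (use \<open>f' 0 = 0\<close> \<open>e > 0\<close> in auto)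
  have nb: "norm (f s) \<le> e/2 * \<bar>s\<bar>^k * \<bar>s\<bar>" if "\<bar>s\<bar> < min d1 d2" for s
  proof -
    have "norm (f s - f 0) \<le> e/2 * \<bar>s\<bar>^k * norm (s - 0)"
    proof (rule differentiable_bound[where f' = "\<lambda>t x. x *\<^sub>R f' t" and S = "closed_segment 0 s"])
      fix t assume "t \<in> closed_segment 0 s"
      then have t: "\<bar>t\<bar> \<le> \<bar>s\<bar>"
        using segment_bound(1)[of t 0 s] by simp
      show "(f has_derivative (\<lambda>x. x *\<^sub>R f' t)) (at t within closed_segment 0 s)"
        using d2(2)[of t] t that
        by (auto simp: has_vector_derivative_def intro: has_derivative_at_withinI)
      show "onorm (\<lambda>x. x *\<^sub>R f' t) \<le> e/2 * \<bar>s\<bar>^k"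
        using mult_left_mono[OF b[OF t], of "\<bar>x\<bar>" for x] that by (intro onorm_le) (simp add: mult.commute)
    qed auto
    then show ?thesis using \<open>f 0 = 0\<close> by simp
  qed
  have "norm (f s /\<^sub>R s^Suc k) < e" if "s \<noteq> 0" "\<bar>s\<bar> < min d1 d2" for s
  proof -
    have "norm (f s /\<^sub>R s^Suc k) \<le> e/2"
      using nb[OF that(2)] that(1)
      by (simp add: power_abs divide_simps mult_ac abs_mult)
    with \<open>e > 0\<close> show ?thesis by simp
  qed
  then show "\<forall>\<^sub>F s in at 0. dist (f s /\<^sub>R s^Suc k) 0 < e"
    unfolding eventually_at using d1(1) d2(1)
    by (intro exI[of _ "min d1 d2"]) (auto simp: dist_real_def)
qed

text \<open>Taylor's formula with Peano remainder: differentiability of \<open>f2\<close> at the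
  single point 0 is an o(s) statement, and integrating it twice gives o(s^3).\<close>

lemma jet3_taylor:
  fixes f :: "real \<Rightarrow> 'a::real_normed_vector"
  assumes f: "\<forall>\<^sub>F s in nhds 0. (f has_vector_derivative f1 s) (at s)"
    and f1: "\<forall>\<^sub>F s in nhds 0. (f1 has_vector_derivative f2 s) (at s)"
    and f2: "(f2 has_vector_derivative c3) (at 0)"
  shows "jet3 f (f 0) (f1 0) ((1/2) *\<^sub>R f2 0) ((1/6) *\<^sub>R c3)"
proof -
  have "((\<lambda>s. (f2 s - f2 0 - s *\<^sub>R c3) /\<^sub>R s^1) \<longlongrightarrow> 0) (at 0)"
  proof -
    have "((\<lambda>y. (f2 y - f2 0 - y *\<^sub>R c3) /\<^sub>R norm y) \<longlongrightarrow> 0) (at 0)"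
      using f2 by (simp add: has_vector_derivative_def has_derivative_at2 diff_diff_eq divide_inverse)
    then have "((\<lambda>y. norm ((f2 y - f2 0 - y *\<^sub>R c3) /\<^sub>R norm y)) \<longlongrightarrow> 0) (at 0)"
      using tendsto_norm_zero by blast
    then have "((\<lambda>y. norm ((f2 y - f2 0 - y *\<^sub>R c3) /\<^sub>R y^1)) \<longlongrightarrow> 0) (at 0)"
      by simp
    then show ?thesis
      by (rule tendsto_norm_zero_cancel)
  qed
  then have "((\<lambda>s. (f1 s - f1 0 - s *\<^sub>R f2 0 - (s^2/2) *\<^sub>R c3) /\<^sub>R s^Suc 1) \<longlongrightarrow> 0) (at 0)"
  proof (rule little_o_integrate[rotated])
    show "\<forall>\<^sub>F s in nhds 0. ((\<lambda>s. f1 s - f1 0 - s *\<^sub>R f2 0 - (s^2/2) *\<^sub>R c3)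
        has_vector_derivative f2 s - f2 0 - s *\<^sub>R c3) (at s)"
      using f1 by eventually_elim (auto intro!: derivative_eq_intros)
  qed auto
  then have "((\<lambda>s. (f s - f 0 - s *\<^sub>R f1 0 - (s^2/2) *\<^sub>R f2 0 - (s^3/6) *\<^sub>R c3) /\<^sub>R s^Suc (Suc 1)) \<longlongrightarrow> 0) (at 0)"
  proof (rule little_o_integrate[rotated])
    show "\<forall>\<^sub>F s in nhds 0. ((\<lambda>s. f s - f 0 - s *\<^sub>R f1 0 - (s^2/2) *\<^sub>R f2 0 - (s^3/6) *\<^sub>R c3)
        has_vector_derivative f1 s - f1 0 - s *\<^sub>R f2 0 - (s^2/2) *\<^sub>R c3) (at s)"
      using f by eventually_elim (auto intro!: derivative_eq_intros simp: power2_eq_square)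
  qed auto
  then show ?thesis
    by (simp add: jet3_def numeral_3_eq_3 algebra_simps)
qed

section \<open>Directional derivatives\<close>

text \<open>With the direction as first argument, higher derivatives are nested applications, and
  \<open>Ck_on\<close> loses one order per application.\<close>

definition dderiv :: "'a::real_normed_vector \<Rightarrow> ('a \<Rightarrow> 'b::real_normed_vector) \<Rightarrow> 'a \<Rightarrow> 'b" where
  "dderiv v f x = frechet_derivative f (at x) v"

lemma deriv2_dderiv: "deriv2 f x p q = dderiv q (dderiv p f) x"
  by (simp add: deriv2_def dderiv_def [abs_def])

lemma deriv3_dderiv: "deriv3 f x p q r = dderiv r (dderiv q (dderiv p f)) x"
  by (simp add: deriv3_def deriv2_def dderiv_def [abs_def])

lemma Ck_on_dderiv: "Ck_on (Suc k) f S \<Longrightarrow> Ck_on k (dderiv v f) S"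
  by (simp add: dderiv_def [abs_def])

lemma Ck_on_differentiable: "Ck_on (Suc k) f S \<Longrightarrow> x \<in> S \<Longrightarrow> f differentiable (at x)"
  by simp

lemma Ck_on_imp_continuous_on: "Ck_on k f S \<Longrightarrow> continuous_on S f"
  by (cases k) (auto intro!: continuous_at_imp_continuous_on differentiable_imp_continuous_within)

lemma Ck_on_SucD: "Ck_on (Suc k) f S \<Longrightarrow> Ck_on k f S"
proof (induction k arbitrary: f)
  case 0
  then show ?case by (metis Ck_on.simps(1) Ck_on_imp_continuous_on)
next
  case (Suc k)
  then show ?case by (metis Ck_on.simps(2))
qed

lemma Ck_on_le: "Ck_on k f S \<Longrightarrow> j \<le> k \<Longrightarrow> Ck_on j f S"
proof (induction k)
  case (Suc k)
  then show ?case by (metis Ck_on_SucD le_Suc_eq)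
qed simp

lemma has_derivative_dderiv:
  "f differentiable (at x) \<Longrightarrow> (f has_derivative (\<lambda>v. dderiv v f x)) (at x)"
  by (simp add: dderiv_def frechet_derivative_works [symmetric])

lemma dderiv_eqI: "(f has_derivative f') (at x) \<Longrightarrow> dderiv v f x = f' v"
  by (simp add: dderiv_def frechet_derivative_at [symmetric])

lemma linear_dderiv: "f differentiable (at x) \<Longrightarrow> linear (\<lambda>v. dderiv v f x)"
  using has_derivative_dderiv has_derivative_linear by blast

lemma dderiv_cong:
  assumes "f differentiable (at x)" "open S" "x \<in> S" "\<And>y. y \<in> S \<Longrightarrow> f y = g y"
  shows "dderiv v f x = dderiv v g x"
  using frechet_derivative_transform_within_open[OF assms] by (simp add: dderiv_def)

lemma dderiv_along_curve:
  assumes "f differentiable (at (g s))" "(g has_vector_derivative g') (at s)"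
  shows "((\<lambda>s. f (g s)) has_vector_derivative dderiv g' f (g s)) (at s)"
proof -
  have "((\<lambda>s. f (g s)) has_derivative (\<lambda>t. dderiv (t *\<^sub>R g') f (g s))) (at s)"
    using has_derivative_compose[OF assms(2)[unfolded has_vector_derivative_def] has_derivative_dderiv[OF assms(1)]] .
  then show ?thesis
    by (simp add: has_vector_derivative_def linear_scale[OF linear_dderiv[OF assms(1)]])
qed

text \<open>The mean value theorem is used twice, first in the direction \<open>p\<close> for the
  increment of \<open>f\<close> over \<open>h *\<^sub>R q\<close>, then in the direction
  \<open>q\<close>. It holds as an equality only for real functions, hence the pairing with a fixed
  \<open>b\<close>. The distance bound lets \<open>z\<close> tend to \<open>x\<close> with
  \<open>h\<close>.\<close>

lemma second_difference_mean_value: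
  fixes f :: "'a::real_normed_vector \<Rightarrow> 'b::real_inner"
  assumes C: "Ck_on (Suc (Suc 0)) f S" and S: "ball x r \<subseteq> S"
    and h: "h > 0" "h * (norm p + norm q) < r"
  obtains z where "dist x z \<le> h * (norm p + norm q)"
    "(f (x + h *\<^sub>R p + h *\<^sub>R q) - f (x + h *\<^sub>R p) - f (x + h *\<^sub>R q) + f x) \<bullet> b = h^2 * (dderiv q (dderiv p f) z \<bullet> b)"
proof -
  have dist: "dist x (x + s *\<^sub>R p + t *\<^sub>R q) \<le> h * (norm p + norm q)"
    if "0 \<le> s" "s \<le> h" "0 \<le> t" "t \<le> h" for s t
  proof -
    have "norm (s *\<^sub>R p + t *\<^sub>R q) \<le> s * norm p + t * norm q"
      using norm_triangle_ineq[of "s *\<^sub>R p" "t *\<^sub>R q"] that by simp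
    also have "\<dots> \<le> h * norm p + h * norm q"
      using that by (intro add_mono mult_right_mono) auto
    finally show ?thesis
      by (simp add: dist_norm norm_minus_commute algebra_simps)
  qed
  have inS: "x + s *\<^sub>R p + t *\<^sub>R q \<in> S" if "0 \<le> s" "s \<le> h" "0 \<le> t" "t \<le> h" for s t
    using dist[OF that] h S by (force simp: mem_ball)
  have D1: "((\<lambda>s. f (x + s *\<^sub>R p + t *\<^sub>R q)) has_vector_derivative dderiv p f (x + s *\<^sub>R p + t *\<^sub>R q)) (at s)"
    if "0 \<le> s" "s \<le> h" "0 \<le> t" "t \<le> h" for s t
    by (rule dderiv_along_curve[where g = "\<lambda>s. x + s *\<^sub>R p + t *\<^sub>R q"])
      (use Ck_on_differentiable[OF C inS[OF that]] in \<open>auto intro!: derivative_eq_intros\<close>)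
  have D2: "((\<lambda>t. dderiv p f (x + s *\<^sub>R p + t *\<^sub>R q)) has_vector_derivative dderiv q (dderiv p f) (x + s *\<^sub>R p + t *\<^sub>R q)) (at t)"
    if "0 \<le> s" "s \<le> h" "0 \<le> t" "t \<le> h" for s t
    by (rule dderiv_along_curve[where g = "\<lambda>t. x + s *\<^sub>R p + t *\<^sub>R q"])
      (use Ck_on_differentiable[OF Ck_on_dderiv[OF C] inS[OF that]] in \<open>auto intro!: derivative_eq_intros\<close>)
  define \<psi> where "\<psi> s = (f (x + s *\<^sub>R p + h *\<^sub>R q) - f (x + s *\<^sub>R p + 0 *\<^sub>R q)) \<bullet> b" for s
  have "\<exists>s>0. s < h \<and> \<psi> h - \<psi> 0 = (h - 0) * ((dderiv p f (x + s *\<^sub>R p + h *\<^sub>R q) - dderiv p f (x + s *\<^sub>R p + 0 *\<^sub>R q)) \<bullet> b)"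
  proof (rule MVT2[OF h(1)])
    fix s assume s: "0 \<le> s" "s \<le> h"
    have "((\<lambda>s. f (x + s *\<^sub>R p + h *\<^sub>R q) - f (x + s *\<^sub>R p + 0 *\<^sub>R q)) has_vector_derivative
       dderiv p f (x + s *\<^sub>R p + h *\<^sub>R q) - dderiv p f (x + s *\<^sub>R p + 0 *\<^sub>R q)) (at s)"
      using D1[OF s, of h] D1[OF s, of 0] h by (intro derivative_intros) auto
    from bounded_linear.has_vector_derivative[OF bounded_linear_inner_left this, of b]
    show "(\<psi> has_real_derivative (dderiv p f (x + s *\<^sub>R p + h *\<^sub>R q) - dderiv p f (x + s *\<^sub>R p + 0 *\<^sub>R q)) \<bullet> b) (at s)"
      unfolding \<psi>_def by (simp add: has_real_derivative_iff_has_vector_derivative)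
  qed
  then obtain s where s: "0 < s" "s < h"
    "\<psi> h - \<psi> 0 = h * ((dderiv p f (x + s *\<^sub>R p + h *\<^sub>R q) - dderiv p f (x + s *\<^sub>R p + 0 *\<^sub>R q)) \<bullet> b)"
    by auto
  have "\<exists>t>0. t < h \<and> dderiv p f (x + s *\<^sub>R p + h *\<^sub>R q) \<bullet> b - dderiv p f (x + s *\<^sub>R p + 0 *\<^sub>R q) \<bullet> b =
     (h - 0) * (dderiv q (dderiv p f) (x + s *\<^sub>R p + t *\<^sub>R q) \<bullet> b)"
  proof (rule MVT2[OF h(1)])
    fix t assume t: "0 \<le> t" "t \<le> h"
    from bounded_linear.has_vector_derivative[OF bounded_linear_inner_left D2[OF _ _ t, of s], of b] s
    show "((\<lambda>t. dderiv p f (x + s *\<^sub>R p + t *\<^sub>R q) \<bullet> b) has_real_derivative (dderiv q (dderiv p f) (x + s *\<^sub>R p + t *\<^sub>R q) \<bullet> b)) (at t)"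
      by (simp add: has_real_derivative_iff_has_vector_derivative)
  qed
  then obtain t where t: "0 < t" "t < h"
    "(dderiv p f (x + s *\<^sub>R p + h *\<^sub>R q) - dderiv p f (x + s *\<^sub>R p + 0 *\<^sub>R q)) \<bullet> b =
     h * (dderiv q (dderiv p f) (x + s *\<^sub>R p + t *\<^sub>R q) \<bullet> b)"
    by (auto simp: inner_diff_left)
  show ?thesis
  proof (rule that)
    show "dist x (x + s *\<^sub>R p + t *\<^sub>R q) \<le> h * (norm p + norm q)"
      using dist s t by simp
    show "(f (x + h *\<^sub>R p + h *\<^sub>R q) - f (x + h *\<^sub>R p) - f (x + h *\<^sub>R q) + f x) \<bullet> b =
        h^2 * (dderiv q (dderiv p f) (x + s *\<^sub>R p + t *\<^sub>R q) \<bullet> b)"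
      using s(3) unfolding t(3) by (simp add: \<psi>_def power2_eq_square inner_diff_left inner_add_left)
  qed
qed

text \<open>The second difference over a parallelogram is symmetric in \<open>p\<close> and
  \<open>q\<close>, so its two mean value representations agree; shrinking the parallelogram turns
  this into equality of the mixed derivatives at \<open>x\<close>.\<close>

lemma dderiv_commute:
  fixes f :: "'a::real_normed_vector \<Rightarrow> 'b::real_inner"
  assumes C: "Ck_on (Suc (Suc k)) f S" and S: "open S" "x \<in> S"
  shows "dderiv q (dderiv p f) x = dderiv p (dderiv q f) x"
proof -
  have C2: "Ck_on (Suc (Suc 0)) f S"
    by (rule Ck_on_le[OF C]) simp
  obtain r where r: "r > 0" "ball x r \<subseteq> S"
    using S openE by blast
  \<comment> \<open>Mean value points depend on the pairing vector. With the discrepancy itself as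
    that vector, the single scalar identity \<open>b \<bullet> b = 0\<close> is enough.\<close>
  define b where "b = dderiv q (dderiv p f) x - dderiv p (dderiv q f) x"
  have lim: "(\<lambda>n. dderiv v (dderiv w f) (z n) \<bullet> b) \<longlonglongrightarrow> dderiv v (dderiv w f) x \<bullet> b"
    if "z \<longlonglongrightarrow> x" for v w and z :: "nat \<Rightarrow> 'a"
  proof -
    have "isCont (dderiv v (dderiv w f)) x"
      using Ck_on_imp_continuous_on[OF Ck_on_dderiv[OF Ck_on_dderiv[OF C2]]] S
      by (simp add: continuous_on_eq_continuous_at)
    then show ?thesis
      by (intro tendsto_inner tendsto_const isCont_tendsto_compose[OF _ that])
  qed
  \<comment> \<open>The added 1 keeps the divisor \<open>N\<close> positive when
    \<open>p = q = 0\<close> and gives the strict inequality that keeps the parallelogram inside the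
    ball.\<close>
  define N where "N = norm p + norm q + 1"
  have N: "N > 0" "norm p + norm q < N"
    by (auto simp: N_def add_nonneg_pos)
  define h where "h n = r / (N * real (Suc n))" for n
  have h: "h n > 0" "h n * (norm p + norm q) < r" for n
  proof -
    show pos: "h n > 0" using r N by (simp add: h_def)
    have "h n * (norm p + norm q) < h n * N"
      using pos N by (intro mult_strict_left_mono) auto
    also have "\<dots> = r / real (Suc n)" using N by (simp add: h_def)
    also have "\<dots> \<le> r" using r by (simp add: field_simps)
    finally show "h n * (norm p + norm q) < r" .
  qed
  have h0: "(\<lambda>n. h n * (norm p + norm q)) \<longlonglongrightarrow> 0"
  proof -
    have "(\<lambda>n. r / N * inverse (real (Suc n)) * (norm p + norm q)) \<longlonglongrightarrow> r / N * 0 * (norm p + norm q)"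
      by (intro tendsto_intros LIMSEQ_inverse_real_of_nat)
    then show ?thesis by (simp add: h_def divide_inverse mult.assoc)
  qed
  have "\<exists>z. dist x z \<le> h n * (norm p + norm q) \<and>
    (f (x + h n *\<^sub>R p + h n *\<^sub>R q) - f (x + h n *\<^sub>R p) - f (x + h n *\<^sub>R q) + f x) \<bullet> b = (h n)^2 * (dderiv q (dderiv p f) z \<bullet> b)" for n
    using second_difference_mean_value[OF C2 r(2) h] by metis
  then obtain z where z: "\<And>n. dist x (z n) \<le> h n * (norm p + norm q)"
    "\<And>n. (f (x + h n *\<^sub>R p + h n *\<^sub>R q) - f (x + h n *\<^sub>R p) - f (x + h n *\<^sub>R q) + f x) \<bullet> b = (h n)^2 * (dderiv q (dderiv p f) (z n) \<bullet> b)"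
    by metis
  have "\<exists>z. dist x z \<le> h n * (norm q + norm p) \<and>
    (f (x + h n *\<^sub>R q + h n *\<^sub>R p) - f (x + h n *\<^sub>R q) - f (x + h n *\<^sub>R p) + f x) \<bullet> b = (h n)^2 * (dderiv p (dderiv q f) z \<bullet> b)" for n
    using second_difference_mean_value[OF C2 r(2) h(1), of n q p] h(2)[of n] by (metis add.commute)
  then obtain y where y: "\<And>n. dist x (y n) \<le> h n * (norm q + norm p)"
    "\<And>n. (f (x + h n *\<^sub>R q + h n *\<^sub>R p) - f (x + h n *\<^sub>R q) - f (x + h n *\<^sub>R p) + f x) \<bullet> b = (h n)^2 * (dderiv p (dderiv q f) (y n) \<bullet> b)"
    by metis
  have "z \<longlonglongrightarrow> x" "y \<longlonglongrightarrow> x"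
    using z(1) y(1)
    by (auto intro!: metric_tendsto_imp_tendsto[OF h0] eventuallyI order_trans[OF _ abs_ge_self]
        simp: dist_commute add.commute)
  moreover have "dderiv q (dderiv p f) (z n) \<bullet> b = dderiv p (dderiv q f) (y n) \<bullet> b" for n
  proof -
    have "(h n)^2 * (dderiv q (dderiv p f) (z n) \<bullet> b) = (h n)^2 * (dderiv p (dderiv q f) (y n) \<bullet> b)"
      unfolding z(2)[symmetric] y(2)[symmetric] by (simp add: algebra_simps)
    then show ?thesis using h(1)[of n] by simp
  qed
  ultimately have "dderiv q (dderiv p f) x \<bullet> b = dderiv p (dderiv q f) x \<bullet> b"
    using LIMSEQ_unique[OF lim[of z q p]] lim[of y p q] by simp
  then have "b \<bullet> b = 0" by (simp add: b_def inner_diff_left)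
  then show ?thesis by (simp add: b_def)
qed

text \<open>The commutation holds at every point of the open set \<open>S\<close>, so it survives a
  further differentiation.\<close>

lemma dderiv_commute_inner:
  fixes f :: "'a::real_normed_vector \<Rightarrow> 'b::real_inner"
  assumes C: "Ck_on (Suc (Suc (Suc k))) f S" and S: "open S" "x \<in> S"
  shows "dderiv r (dderiv q (dderiv p f)) x = dderiv r (dderiv p (dderiv q f)) x"
  by (rule dderiv_cong[OF _ S])
    (use dderiv_commute[OF C S(1)] Ck_on_differentiable[OF Ck_on_dderiv[OF Ck_on_dderiv[OF C]] S(2)] in auto)

text \<open>The inner direction is a parameter of the function being differentiated, so linearity in
  it does not come from the outer derivative; swapping makes it the outer direction.\<close>

lemma linear_dderiv2_left:
  fixes f :: "'a::real_normed_vector \<Rightarrow> 'b::real_inner"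
  assumes C: "Ck_on (Suc (Suc k)) f S" and S: "open S" "x \<in> S"
  shows "linear (\<lambda>p. dderiv q (dderiv p f) x)"
  using linear_dderiv[OF Ck_on_differentiable[OF Ck_on_dderiv[OF C] S(2)], of q]
  by (simp add: dderiv_commute[OF C S])

lemma linear_dderiv3_left:
  fixes f :: "'a::real_normed_vector \<Rightarrow> 'b::real_inner"
  assumes C: "Ck_on (Suc (Suc (Suc k))) f S" and S: "open S" "x \<in> S"
  shows "linear (\<lambda>p. dderiv r (dderiv q (dderiv p f)) x)"
  using linear_dderiv2_left[OF Ck_on_dderiv[OF C] S, of r q]
  by (simp add: dderiv_commute_inner[OF C S, of r q])

lemma linear_eq_sum_Basis:
  fixes L :: "'a::euclidean_space \<Rightarrow> 'b::real_vector"
  assumes "linear L"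
  shows "L v = (\<Sum>i\<in>Basis. (v \<bullet> i) *\<^sub>R L i)"
proof -
  have "L v = L (\<Sum>i\<in>Basis. (v \<bullet> i) *\<^sub>R i)"
    by (simp add: euclidean_representation)
  also have "\<dots> = (\<Sum>i\<in>Basis. (v \<bullet> i) *\<^sub>R L i)"
    by (simp only: linear_sum[OF assms] linear_scale[OF assms])
  finally show ?thesis .
qed

text \<open>The direction moves along with the point. Expanding it in the basis leaves real
  coefficients depending on \<open>s\<close> and derivatives in fixed directions, to which the
  product and chain rules apply.\<close>

lemma has_vector_derivative_dderiv_curve:
  fixes f :: "'a::euclidean_space \<Rightarrow> 'b::real_inner"
  assumes C: "Ck_on (Suc (Suc k)) f UNIV"
    and g: "(g has_vector_derivative g') (at s)" and v: "(v has_vector_derivative v') (at s)"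
  shows "((\<lambda>s. dderiv (v s) f (g s)) has_vector_derivative
     dderiv g' (dderiv (v s) f) (g s) + dderiv v' f (g s)) (at s)"
proof -
  have lin: "linear (\<lambda>v. dderiv v f x)" for x
    by (rule linear_dderiv[OF Ck_on_differentiable[OF C UNIV_I]])
  have lin2: "linear (\<lambda>v. dderiv w (dderiv v f) x)" for w x
    by (rule linear_dderiv2_left[OF C open_UNIV UNIV_I])
  have "((\<lambda>s. \<Sum>i\<in>Basis. (v s \<bullet> i) *\<^sub>R dderiv i f (g s)) has_vector_derivative
     (\<Sum>i\<in>Basis. (v s \<bullet> i) *\<^sub>R dderiv g' (dderiv i f) (g s) + (v' \<bullet> i) *\<^sub>R dderiv i f (g s))) (at s)"
    using v
    by (intro has_vector_derivative_sum has_vector_derivative_scaleR dderiv_along_curve g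
      Ck_on_differentiable[OF Ck_on_dderiv[OF C]])
      (auto simp: has_real_derivative_iff_has_vector_derivative
        intro: bounded_linear.has_vector_derivative[OF bounded_linear_inner_left])
  also have "(\<Sum>i\<in>Basis. (v s \<bullet> i) *\<^sub>R dderiv g' (dderiv i f) (g s) + (v' \<bullet> i) *\<^sub>R dderiv i f (g s)) =
     dderiv g' (dderiv (v s) f) (g s) + dderiv v' f (g s)"
    using linear_eq_sum_Basis[OF lin[of "g s"], of v']
      linear_eq_sum_Basis[OF lin2[of g' "g s"], of "v s"]
    by (simp add: sum.distrib)
  also have "(\<lambda>s. \<Sum>i\<in>Basis. (v s \<bullet> i) *\<^sub>R dderiv i f (g s)) = (\<lambda>s. dderiv (v s) f (g s))"
    by (subst linear_eq_sum_Basis[OF lin]) simp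
  finally show ?thesis .
qed

lemma has_vector_derivative_dderiv2_curve:
  fixes f :: "'a::euclidean_space \<Rightarrow> 'b::real_inner"
  assumes C: "Ck_on (Suc (Suc (Suc k))) f UNIV"
    and g: "(g has_vector_derivative g') (at s)"
    and v: "(v has_vector_derivative v') (at s)" and w: "(w has_vector_derivative w') (at s)"
  shows "((\<lambda>s. dderiv (w s) (dderiv (v s) f) (g s)) has_vector_derivative
     dderiv g' (dderiv (w s) (dderiv (v s) f)) (g s) + dderiv w' (dderiv (v s) f) (g s) +
     dderiv (w s) (dderiv v' f) (g s)) (at s)"
proof -
  have lin: "linear (\<lambda>v. dderiv w (dderiv v f) x)" for w x
    by (rule linear_dderiv2_left[OF C open_UNIV UNIV_I])
  have lin3: "linear (\<lambda>v. dderiv z (dderiv w (dderiv v f)) x)" for w z x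
    by (rule linear_dderiv3_left[OF C open_UNIV UNIV_I])
  have "((\<lambda>s. \<Sum>i\<in>Basis. (v s \<bullet> i) *\<^sub>R dderiv (w s) (dderiv i f) (g s)) has_vector_derivative
     (\<Sum>i\<in>Basis. (v s \<bullet> i) *\<^sub>R (dderiv g' (dderiv (w s) (dderiv i f)) (g s) + dderiv w' (dderiv i f) (g s)) +
       (v' \<bullet> i) *\<^sub>R dderiv (w s) (dderiv i f) (g s))) (at s)"
    using v
    by (intro has_vector_derivative_sum has_vector_derivative_scaleR
      has_vector_derivative_dderiv_curve[OF Ck_on_dderiv[OF C] g w])
      (auto simp: has_real_derivative_iff_has_vector_derivative
        intro: bounded_linear.has_vector_derivative[OF bounded_linear_inner_left])
  also have "(\<Sum>i\<in>Basis. (v s \<bullet> i) *\<^sub>R (dderiv g' (dderiv (w s) (dderiv i f)) (g s) + dderiv w' (dderiv i f) (g s)) +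
       (v' \<bullet> i) *\<^sub>R dderiv (w s) (dderiv i f) (g s)) =
     dderiv g' (dderiv (w s) (dderiv (v s) f)) (g s) + dderiv w' (dderiv (v s) f) (g s) +
     dderiv (w s) (dderiv v' f) (g s)"
    using linear_eq_sum_Basis[OF lin[of "w s" "g s"], of v']
      linear_eq_sum_Basis[OF lin[of w' "g s"], of "v s"]
      linear_eq_sum_Basis[OF lin3[of g' "w s" "g s"], of "v s"]
    by (simp add: sum.distrib scaleR_add_right)
  also have "(\<lambda>s. \<Sum>i\<in>Basis. (v s \<bullet> i) *\<^sub>R dderiv (w s) (dderiv i f) (g s)) = (\<lambda>s. dderiv (w s) (dderiv (v s) f) (g s))"
    by (subst linear_eq_sum_Basis[OF lin]) simp
  finally show ?thesis .
qed

text \<open>The Faa di Bruno formula to third order, as the composition of \<open>F\<close> with the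
  parametrization on a ray requires it.\<close>

lemma jet3_compose:
  fixes f :: "'a::euclidean_space \<Rightarrow> 'b::real_inner"
  assumes C: "Ck_on (Suc (Suc (Suc k))) f UNIV"
    and g: "\<forall>\<^sub>F s in nhds 0. (g has_vector_derivative g1 s) (at s)"
    and g1: "\<forall>\<^sub>F s in nhds 0. (g1 has_vector_derivative g2 s) (at s)"
    and g2: "(g2 has_vector_derivative c) (at 0)"
  shows "jet3 (\<lambda>s. f (g s)) (f (g 0)) (dderiv (g1 0) f (g 0))
     ((1/2) *\<^sub>R (deriv2 f (g 0) (g1 0) (g1 0) + dderiv (g2 0) f (g 0)))
     ((1/6) *\<^sub>R (deriv3 f (g 0) (g1 0) (g1 0) (g1 0) + 3 *\<^sub>R deriv2 f (g 0) (g1 0) (g2 0) + dderiv c f (g 0)))"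
proof (rule jet3_taylor)
  show "\<forall>\<^sub>F s in nhds 0. ((\<lambda>s. f (g s)) has_vector_derivative dderiv (g1 s) f (g s)) (at s)"
    using g by eventually_elim (rule dderiv_along_curve[OF Ck_on_differentiable[OF C UNIV_I]])
  show "\<forall>\<^sub>F s in nhds 0. ((\<lambda>s. dderiv (g1 s) f (g s)) has_vector_derivative
      deriv2 f (g s) (g1 s) (g1 s) + dderiv (g2 s) f (g s)) (at s)"
    using g g1 by eventually_elim (unfold deriv2_dderiv, rule has_vector_derivative_dderiv_curve[OF C])
  have g0: "(g has_vector_derivative g1 0) (at 0)" "(g1 has_vector_derivative g2 0) (at 0)"
    using eventually_nhds_x_imp_x[OF g] eventually_nhds_x_imp_x[OF g1] .
  \<comment> \<open>The product rule produces three terms with one \<open>g1\<close> and one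
    \<open>g2\<close>, two of them with the arguments exchanged; symmetry merges them into the
    factor 3.\<close>
  have "((\<lambda>s. deriv2 f (g s) (g1 s) (g1 s) + dderiv (g2 s) f (g s)) has_vector_derivative
     (deriv3 f (g 0) (g1 0) (g1 0) (g1 0) + deriv2 f (g 0) (g1 0) (g2 0) + deriv2 f (g 0) (g2 0) (g1 0)) +
     (deriv2 f (g 0) (g2 0) (g1 0) + dderiv c f (g 0))) (at 0)"
    unfolding deriv2_dderiv deriv3_dderiv
    by (intro has_vector_derivative_add has_vector_derivative_dderiv2_curve[OF C]
      has_vector_derivative_dderiv_curve[OF C] g0 g2)
  moreover have "deriv2 f (g 0) (g2 0) (g1 0) = deriv2 f (g 0) (g1 0) (g2 0)"
    unfolding deriv2_dderiv by (rule dderiv_commute[OF C]) auto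
  ultimately show "((\<lambda>s. deriv2 f (g s) (g1 s) (g1 s) + dderiv (g2 s) f (g s)) has_vector_derivative
     deriv3 f (g 0) (g1 0) (g1 0) (g1 0) + 3 *\<^sub>R deriv2 f (g 0) (g1 0) (g2 0) + dderiv c f (g 0)) (at 0)"
    by (simp add: scaleR_left_distrib[of 2 1, simplified] scaleR_2 algebra_simps numeral_3_eq_3)
qed

section \<open>Local solutions of the restricted system\<close>

text \<open>\<open>Ck_on\<close> provides continuity for one fixed direction at a time. Bounds in
  the finitely many basis directions add up to one that is uniform in the direction; it serves
  Lipschitz constants and the matrix of the variational equation alike.\<close>

lemma linear_family_bounded_on_compact:
  fixes L :: "'x::topological_space \<Rightarrow> 'a::euclidean_space \<Rightarrow> 'b::real_normed_vector"
  assumes X: "compact X" and lin: "\<And>x. x \<in> X \<Longrightarrow> linear (L x)"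
    and cont: "\<And>v. continuous_on X (\<lambda>x. L x v)"
  obtains K where "K \<ge> 0" "\<And>x v. x \<in> X \<Longrightarrow> norm (L x v) \<le> K * norm v"
proof -
  have "\<exists>M. \<forall>x\<in>X. norm (L x i) \<le> M" for i
    using compact_imp_bounded[OF compact_continuous_image[OF cont X]] by (auto simp: bounded_iff)
  then obtain M where M: "\<And>i x. x \<in> X \<Longrightarrow> norm (L x i) \<le> M i"
    by metis
  show ?thesis
  proof (rule that)
    show "(\<Sum>i\<in>Basis. \<bar>M i\<bar>) \<ge> 0" by (rule sum_nonneg) simp
    fix x v assume x: "x \<in> X"
    have "norm (L x v) = norm (\<Sum>i\<in>Basis. (v \<bullet> i) *\<^sub>R L x i)"
      using linear_eq_sum_Basis[OF lin[OF x], of v] by simp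
    also have "\<dots> \<le> (\<Sum>i\<in>Basis. norm v * \<bar>M i\<bar>)"
      using order_trans[OF M[OF x] abs_ge_self] Basis_le_norm[of _ v]
      by (intro sum_norm_le) (auto intro!: mult_mono)
    finally show "norm (L x v) \<le> (\<Sum>i\<in>Basis. \<bar>M i\<bar>) * norm v"
      by (simp add: sum_distrib_left mult.commute)
  qed
qed

lemma Ck_on_1_imp_lipschitz_on_cball:
  fixes f :: "'a::euclidean_space \<Rightarrow> 'b::real_normed_vector"
  assumes C: "Ck_on 1 f S" and S: "cball x r \<subseteq> S"
  shows "\<exists>L. L-lipschitz_on (cball x r) f"
proof -
  have diff: "f differentiable (at y)" if "y \<in> cball x r" for y
    using C S that by auto
  obtain L where L: "L \<ge> 0" "\<And>y v. y \<in> cball x r \<Longrightarrow> norm (dderiv v f y) \<le> L * norm v"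
  proof (rule linear_family_bounded_on_compact[of "cball x r" "\<lambda>y v. dderiv v f y"])
    show "continuous_on (cball x r) (dderiv v f)" for v
      using C S by (auto simp: dderiv_def [abs_def] intro: continuous_on_subset)
  qed (use linear_dderiv[OF diff] in auto)
  moreover have "(f has_derivative (\<lambda>v. dderiv v f y)) (at y within cball x r)" if "y \<in> cball x r" for y
    using has_derivative_dderiv[OF diff[OF that]] by (rule has_derivative_at_withinI)
  ultimately have "L-lipschitz_on (cball x r) f"
    by (intro bounded_derivative_imp_lipschitz onorm_le convex_cball) auto
  then show ?thesis ..
qed

text \<open>
  Composing \<open>f\<close> with the nearest-point projection onto the ball makes it globally Lipschitz and bounded
  without changing it along the solution. The fixed point is sought on \<open>[0, 2r]\<close> with the initial
  condition at the midpoint \<open>r\<close> and shifted afterwards.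
\<close>

lemma picard_lindelof:
  fixes f :: "'a::euclidean_space \<Rightarrow> 'a"
  assumes lip: "L-lipschitz_on (cball x0 \<rho>) f" and \<rho>: "\<rho> > 0"
  obtains r x where "r > 0" "x 0 = x0"
    "\<And>t. t \<in> {-r<..<r} \<Longrightarrow> x t \<in> cball x0 \<rho>"
    "\<And>t. t \<in> {-r<..<r} \<Longrightarrow> (x has_vector_derivative f (x t)) (at t)"
proof -
  define P where "P = closest_point (cball x0 \<rho>)"
  have P_in: "P y \<in> cball x0 \<rho>" for y
    unfolding P_def by (rule closest_point_in_set) (use \<rho> in auto)
  have P_id: "P y = y" if "y \<in> cball x0 \<rho>" for y
    unfolding P_def by (rule closest_point_self) (use that in auto)
  have P_lip: "dist (P y) (P z) \<le> dist y z" for y z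
    unfolding P_def by (rule closest_point_lipschitz) (use \<rho> in auto)
  have L: "L \<ge> 0" using lip lipschitz_on_nonneg by blast
  define g where "g y = f (P y)" for y
  have g_lip: "norm (g y - g z) \<le> L * dist y z" for y z
  proof -
    have "dist (g y) (g z) \<le> L * dist (P y) (P z)"
      unfolding g_def using lipschitz_onD[OF lip P_in P_in] .
    also have "\<dots> \<le> L * dist y z" using P_lip L by (intro mult_left_mono)
    finally show ?thesis by (simp add: dist_norm)
  qed
  then have g_cont: "continuous_on UNIV g"
    using L by (intro lipschitz_on_continuous_on[of L]) (auto intro!: lipschitz_onI simp: dist_norm)
  have "bounded (f ` cball x0 \<rho>)"
    by (intro compact_imp_bounded compact_continuous_image lipschitz_on_continuous_on[OF lip] compact_cball)
  then obtain M where M: "M > 0" "\<And>y. y \<in> cball x0 \<rho> \<Longrightarrow> norm (f y) \<le> M"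
    by (auto simp: bounded_pos)
  have g_bound: "norm (g y) \<le> M" for y
    using M(2)[OF P_in] by (simp add: g_def)
  \<comment> \<open>The integrals up to \<open>c t \<le> 2 * r\<close> and up to \<open>r\<close>
    cover together a length of at most \<open>3 * r\<close>. The first entry of the minimum keeps
    the solution in the ball, the second makes \<Phi> a contraction with constant 1/2.\<close>
  define r where "r = min (\<rho> / (3 * M)) (1 / (6 * (L + 1)))"
  have r: "r > 0" "3 * r * M \<le> \<rho>" "3 * r * L \<le> 1/2"
  proof -
    show "r > 0" using \<rho> M L by (auto simp: r_def)
    show "3 * r * M \<le> \<rho>" using M by (auto simp: r_def min_def field_simps)
    have "r \<le> 1 / (6 * (L + 1))" by (simp add: r_def)
    then have "r * (6 * (L + 1)) \<le> 1" using L by (simp add: pos_le_divide_eq)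
    then show "3 * r * L \<le> 1/2" using \<open>r > 0\<close> by (simp add: algebra_simps)
  qed
  \<comment> \<open>Clamping time to \<open>[0, 2r]\<close> turns a function on that interval into a
    bounded continuous function on the line, an element of the complete space in which the fixed
    point is sought.\<close>
  define c where "c t = max 0 (min (2 * r) t)" for t
  have c: "0 \<le> c t" "c t \<le> 2 * r" for t using r by (auto simp: c_def)
  define I where "I x t = integral {0..t} (\<lambda>s. g (apply_bcontfun x s))" for x :: "real \<Rightarrow>\<^sub>C 'a" and t
  have gx_cont: "continuous_on A (\<lambda>s. g (apply_bcontfun x s))" for x :: "real \<Rightarrow>\<^sub>C 'a" and A
    by (rule continuous_on_compose2[OF g_cont]) auto
  have I_bound: "norm (I x t) \<le> M * t" if "t \<ge> 0" for x t
    unfolding I_def using integral_bound[OF that gx_cont] g_bound by simp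
  have I_cont: "continuous_on UNIV (\<lambda>t. I x (c t))" for x
  proof -
    have "continuous_on {0..2*r} (I x)"
      unfolding I_def by (intro indefinite_integral_continuous_1 integrable_continuous_real gx_cont)
    moreover have "continuous_on UNIV c"
      unfolding c_def [abs_def] by (intro continuous_intros)
    ultimately show ?thesis
      by (rule continuous_on_compose2) (use c in auto)
  qed
  have incr: "norm (I x (c t) - I x r) \<le> 3 * r * M" for x t
  proof -
    have "norm (I x (c t) - I x r) \<le> M * c t + M * r"
      using norm_triangle_ineq4[of "I x (c t)" "I x r"] I_bound[of "c t" x] I_bound[of r x] c r by force
    also have "\<dots> \<le> M * (2 * r) + M * r"
      using c M by (intro add_right_mono mult_left_mono) auto
    finally show ?thesis by (simp add: algebra_simps)
  qed
  define \<Phi> where "\<Phi> x = Bcontfun (\<lambda>t. x0 + (I x (c t) - I x r))" for x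
  have \<Phi>: "apply_bcontfun (\<Phi> x) t = x0 + (I x (c t) - I x r)" for x t
  proof -
    have "(\<lambda>t. x0 + (I x (c t) - I x r)) \<in> bcontfun"
      unfolding bcontfun_def
    proof (intro CollectI conjI)
      show "continuous_on UNIV (\<lambda>t. x0 + (I x (c t) - I x r))"
        by (intro continuous_intros I_cont)
      have "norm (x0 + (I x (c t) - I x r)) \<le> norm x0 + 3 * r * M" for t
        using norm_triangle_ineq incr[of x t] by (meson add_left_mono order_trans)
      then show "bounded (range (\<lambda>t. x0 + (I x (c t) - I x r)))"
        by (auto simp: bounded_iff)
    qed
    then show ?thesis by (simp add: \<Phi>_def Bcontfun_inverse)
  qed
  have I_lip: "norm (I x t - I y t) \<le> L * dist x y * t" if "t \<ge> 0" for x y t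
  proof -
    have "I x t - I y t = integral {0..t} (\<lambda>s. g (apply_bcontfun x s) - g (apply_bcontfun y s))"
      unfolding I_def by (intro integral_diff [symmetric] integrable_continuous_real gx_cont)
    also have "norm \<dots> \<le> L * dist x y * (t - 0)"
    proof (rule integral_bound[OF that])
      show "continuous_on {0..t} (\<lambda>s. g (apply_bcontfun x s) - g (apply_bcontfun y s))"
        by (intro continuous_intros gx_cont)
      show "norm (g (apply_bcontfun x s) - g (apply_bcontfun y s)) \<le> L * dist x y" for s
        using g_lip dist_bounded L by (meson mult_left_mono order_trans)
    qed
    finally show ?thesis by simp
  qed
  have "\<exists>!x. \<Phi> x = x"
  proof (rule banach_fix_type[where c = "1/2"])
    show "\<forall>x y. dist (\<Phi> x) (\<Phi> y) \<le> 1/2 * dist x y"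
    proof (intro allI dist_bound)
      fix x y t
      have "dist (\<Phi> x t) (\<Phi> y t) = norm ((I x (c t) - I y (c t)) - (I x r - I y r))"
        by (simp add: \<Phi> dist_norm algebra_simps)
      also have "\<dots> \<le> L * dist x y * c t + L * dist x y * r"
        using norm_triangle_ineq4[of "I x (c t) - I y (c t)" "I x r - I y r"]
          I_lip[of "c t" x y] I_lip[of r x y] c r by force
      also have "\<dots> \<le> L * dist x y * (2 * r) + L * dist x y * r"
        using c L by (intro add_right_mono mult_left_mono) auto
      also have "\<dots> = (3 * r * L) * dist x y" by (simp add: algebra_simps)
      also have "\<dots> \<le> 1/2 * dist x y" using r by (intro mult_right_mono) auto
      finally show "dist (\<Phi> x t) (\<Phi> y t) \<le> 1/2 * dist x y" .
    qed
  qed auto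
  then obtain x where x: "\<Phi> x = x" by auto
  have x_eq: "apply_bcontfun x t = x0 + (I x (c t) - I x r)" for t
    using \<Phi>[of x t] by (simp add: x)
  have x_in: "apply_bcontfun x t \<in> cball x0 \<rho>" for t
    using incr[of x t] r by (simp add: x_eq[of t] dist_norm norm_minus_commute)
  have x_deriv: "(apply_bcontfun x has_vector_derivative f (apply_bcontfun x t)) (at t)" if "t \<in> {0<..<2*r}" for t
  proof -
    have "(I x has_vector_derivative g (apply_bcontfun x t)) (at t within {0..2*r})"
      unfolding I_def [abs_def] by (rule integral_has_vector_derivative[OF gx_cont]) (use that in auto)
    then have "(I x has_vector_derivative g (apply_bcontfun x t)) (at t within {0<..<2*r})"
      by (rule has_vector_derivative_within_subset) auto
    then have "(I x has_vector_derivative g (apply_bcontfun x t)) (at t)"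
      by (simp add: at_within_open[OF that])
    then have "((\<lambda>s. x0 + (I x s - I x r)) has_vector_derivative g (apply_bcontfun x t)) (at t)"
      by (auto intro!: derivative_eq_intros)
    then have "(apply_bcontfun x has_vector_derivative g (apply_bcontfun x t)) (at t)"
      by (rule has_vector_derivative_transform_within_open[OF _ open_greaterThanLessThan that])
        (simp add: x_eq c_def)
    then show ?thesis using P_id[OF x_in] by (simp add: g_def)
  qed
  show ?thesis
  proof (rule that[of r "\<lambda>t. apply_bcontfun x (t + r)"])
    show "apply_bcontfun x (0 + r) = x0"
      using r by (simp add: x_eq[of r] c_def)
    show "apply_bcontfun x (t + r) \<in> cball x0 \<rho>" for t
      by (rule x_in)
    fix t assume "t \<in> {-r<..<r}"
    then show "((\<lambda>t. apply_bcontfun x (t + r)) has_vector_derivative f (apply_bcontfun x (t + r))) (at t)"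
      using vector_diff_chain_at[OF has_vector_derivative_add[OF has_vector_derivative_id has_vector_derivative_const[of r]]
          x_deriv[of "t + r"]]
      by (simp add: o_def)
  qed (use r in auto)
qed

text \<open>Existential constants let the Lipschitz property of the polynomial right-hand side be
  assembled factor by factor; compactness bounds the factors.\<close>

lemma lipschitz_on_mult_compact:
  fixes f g :: "'a::metric_space \<Rightarrow> real"
  assumes "compact X" "\<exists>L. L-lipschitz_on X f" "\<exists>L. L-lipschitz_on X g"
  shows "\<exists>L. L-lipschitz_on X (\<lambda>x. f x * g x)"
proof -
  obtain L M where L: "L-lipschitz_on X f" and M: "M-lipschitz_on X g"
    using assms by auto
  have "bounded (f ` X)" "bounded (g ` X)"
    using assms(1) L M by (auto intro!: compact_imp_bounded compact_continuous_image lipschitz_on_continuous_on)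
  then obtain p q where p: "p > 0" "\<And>x. x \<in> X \<Longrightarrow> \<bar>f x\<bar> \<le> p" and q: "q > 0" "\<And>x. x \<in> X \<Longrightarrow> \<bar>g x\<bar> \<le> q"
    by (auto simp: bounded_pos)
  have "(p * M + L * q)-lipschitz_on X (\<lambda>x. f x * g x)"
  proof (rule lipschitz_onI)
    fix x y assume xy: "x \<in> X" "y \<in> X"
    have "f x * g x - f y * g y = f x * (g x - g y) + (f x - f y) * g y"
      by (simp add: algebra_simps)
    also have "\<bar>\<dots>\<bar> \<le> \<bar>f x\<bar> * \<bar>g x - g y\<bar> + \<bar>f x - f y\<bar> * \<bar>g y\<bar>"
      by (metis abs_mult abs_triangle_ineq)
    also have "\<dots> \<le> p * (M * dist x y) + (L * dist x y) * q"
      using lipschitz_onD[OF L xy] lipschitz_onD[OF M xy] p q xy lipschitz_on_nonneg[OF L]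
      by (intro add_mono mult_mono) (auto simp: dist_real_def)
    finally show "dist (f x * g x) (f y * g y) \<le> (p * M + L * q) * dist x y"
      by (simp add: dist_real_def algebra_simps)
  qed (use p q lipschitz_on_nonneg[OF L] lipschitz_on_nonneg[OF M] in auto)
  then show ?thesis ..
qed

lemma lipschitz_on_add_ex:
  fixes f g :: "'a::metric_space \<Rightarrow> 'b::real_normed_vector"
  shows "\<exists>L. L-lipschitz_on X f \<Longrightarrow> \<exists>L. L-lipschitz_on X g \<Longrightarrow> \<exists>L. L-lipschitz_on X (\<lambda>x. f x + g x)"
  using lipschitz_on_add by blast

lemma lipschitz_on_vector2:
  fixes f g :: "'a::metric_space \<Rightarrow> real"
  assumes "\<exists>L. L-lipschitz_on X f" "\<exists>L. L-lipschitz_on X g"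
  shows "\<exists>L. L-lipschitz_on X (\<lambda>x. vector [f x, g x] :: real^2)"
proof -
  obtain L M where L: "L-lipschitz_on X f" and M: "M-lipschitz_on X g"
    using assms by auto
  have "(L + M)-lipschitz_on X (\<lambda>x. vector [f x, g x] :: real^2)"
  proof (rule lipschitz_onI)
    fix x y assume xy: "x \<in> X" "y \<in> X"
    have "dist (vector [f x, g x] :: real^2) (vector [f y, g y]) \<le> \<bar>f x - f y\<bar> + \<bar>g x - g y\<bar>"
      using norm_le_l1_cart[of "vector [f x, g x] - vector [f y, g y] :: real^2"]
      by (simp add: dist_norm sum_2)
    also have "\<dots> \<le> L * dist x y + M * dist x y"
      using lipschitz_onD[OF L xy] lipschitz_onD[OF M xy] by (simp add: dist_real_def)
    finally show "dist (vector [f x, g x] :: real^2) (vector [f y, g y]) \<le> (L + M) * dist x y"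
      by (simp add: algebra_simps)
  qed (use lipschitz_on_nonneg[OF L] lipschitz_on_nonneg[OF M] in auto)
  then show ?thesis ..
qed

text \<open>With \<open>(\<tau>, \<xi>)\<close> as one unknown the system is autonomous. A closed
  ball around the initial point inside the open domain supplies the Lipschitz constants and keeps
  \<xi> in \<open>ball 0 \<delta>\<close>.\<close>

lemma R2_normal_form_local_solution:
  fixes \<xi>0 :: "real^2"
  assumes R: "Ck_on 1 (\<lambda>(\<tau>, \<xi>). R0 \<tau> \<xi>) (UNIV \<times> ball 0 \<delta>)"
    "Ck_on 1 (\<lambda>(\<tau>, \<xi>). R1 \<tau> \<xi>) (UNIV \<times> ball 0 \<delta>)"
    "Ck_on 1 (\<lambda>(\<tau>, \<xi>). R2 \<tau> \<xi>) (UNIV \<times> ball 0 \<delta>)"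
    and \<xi>0: "\<xi>0 \<in> ball 0 \<delta>"
  obtains r \<tau> \<xi> where "r > 0" "\<tau> 0 = \<tau>0" "\<xi> 0 = \<xi>0" "\<And>t. t \<in> {-r<..<r} \<Longrightarrow> \<xi> t \<in> ball 0 \<delta>"
    "solves_R2_normal_form \<alpha> a b R0 R1 R2 \<tau> \<xi> {-r<..<r}"
proof -
  have "open (UNIV \<times> ball 0 \<delta> :: (real \<times> (real^2)) set)"
    by (intro open_Times) auto
  then obtain \<rho> where \<rho>: "\<rho> > 0" "cball (\<tau>0, \<xi>0) \<rho> \<subseteq> UNIV \<times> ball 0 \<delta>"
    using \<xi>0 open_contains_cball by blast
  let ?X = "cball (\<tau>0, \<xi>0) \<rho>"
  note R_lip = R[THEN Ck_on_1_imp_lipschitz_on_cball, OF \<rho>(2), unfolded case_prod_beta]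
  have const: "\<exists>L. L-lipschitz_on ?X (\<lambda>_. c)" for c :: real
    using lipschitz_on_constant by blast
  have comp: "\<exists>L. L-lipschitz_on ?X (\<lambda>p. snd p $ i)" for i
    using bounded_linear.lipschitz_boundE[OF bounded_linear_compose[OF bounded_linear_vec_nth bounded_linear_snd]]
    by metis
  define f where "f p = (1 + \<alpha> * (snd p $ 1)^2 + R0 (fst p) (snd p),
      vector [snd p $ 2 + \<alpha> * (snd p $ 1)^2 * (snd p $ 2) + R1 (fst p) (snd p),
              a * (snd p $ 1)^3 + b * (snd p $ 1)^2 * (snd p $ 2) + R2 (fst p) (snd p)] :: real^2)" for p
  have "\<exists>L. L-lipschitz_on ?X (\<lambda>p. 1 + \<alpha> * (snd p $ 1)^2 + R0 (fst p) (snd p))"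
    unfolding power2_eq_square power3_eq_cube
    by (intro lipschitz_on_add_ex lipschitz_on_mult_compact compact_cball const comp R_lip)
  moreover have "\<exists>L. L-lipschitz_on ?X (\<lambda>p.
      vector [snd p $ 2 + \<alpha> * (snd p $ 1)^2 * (snd p $ 2) + R1 (fst p) (snd p),
              a * (snd p $ 1)^3 + b * (snd p $ 1)^2 * (snd p $ 2) + R2 (fst p) (snd p)] :: real^2)"
    unfolding power2_eq_square power3_eq_cube
    by (intro lipschitz_on_vector2 lipschitz_on_add_ex lipschitz_on_mult_compact compact_cball const comp R_lip)
  ultimately obtain L where "L-lipschitz_on ?X f"
    unfolding f_def [abs_def] using lipschitz_on_Pair by blast
  from picard_lindelof[OF this \<rho>(1)] obtain r x where x: "r > 0" "x 0 = (\<tau>0, \<xi>0)"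
    "\<And>t. t \<in> {-r<..<r} \<Longrightarrow> x t \<in> ?X"
    "\<And>t. t \<in> {-r<..<r} \<Longrightarrow> (x has_vector_derivative f (x t)) (at t)"
    by blast
  show ?thesis
  proof (rule that[of r "\<lambda>t. fst (x t)" "\<lambda>t. snd (x t)"])
    show "snd (x t) \<in> ball 0 \<delta>" if "t \<in> {-r<..<r}" for t
      using x(3)[OF that] \<rho>(2) by (auto simp: mem_Times_iff)
    show "solves_R2_normal_form \<alpha> a b R0 R1 R2 (\<lambda>t. fst (x t)) (\<lambda>t. snd (x t)) {-r<..<r}"
      unfolding solves_R2_normal_form_def
    proof (intro ballI)
      fix t assume t: "t \<in> {-r<..<r}"
      note d = x(4)[OF t]
      have s: "((\<lambda>t. snd (x t) $ i) has_vector_derivative snd (f (x t)) $ i) (at t)" for i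
        by (rule bounded_linear.has_vector_derivative[OF bounded_linear_compose[OF bounded_linear_vec_nth bounded_linear_snd] d])
      show "((\<lambda>t. fst (x t)) has_real_derivative 1 + \<alpha> * (snd (x t) $ 1)\<^sup>2 + R0 (fst (x t)) (snd (x t))) (at t) \<and>
        ((\<lambda>s. snd (x s) $ 1) has_real_derivative snd (x t) $ 2 + \<alpha> * (snd (x t) $ 1)\<^sup>2 * snd (x t) $ 2 + R1 (fst (x t)) (snd (x t))) (at t) \<and>
        ((\<lambda>s. snd (x s) $ 2) has_real_derivative a * snd (x t) $ 1 ^ 3 + b * (snd (x t) $ 1)\<^sup>2 * snd (x t) $ 2 + R2 (fst (x t)) (snd (x t))) (at t)"
        using s[of 1] s[of 2] bounded_linear.has_vector_derivative[OF bounded_linear_fst d]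
        by (simp add: has_real_derivative_iff_has_vector_derivative f_def)
    qed
  qed (use x in auto)
qed

section \<open>Simple multipliers and linear periodic equations\<close>

lemma poly_det:
  fixes A :: "'a::comm_ring_1 poly^'n^'n"
  shows "poly (det A) x = det (\<chi> i j. poly (A $ i $ j) x)"
  by (simp add: det_def poly_sum poly_prod)

lemma poly_charpoly: "poly (charpoly M) x = det (mat x - M)"
  unfolding charpoly_def poly_det
  by (rule arg_cong[where f = det]) (simp add: vec_eq_iff mat_def)

lemma mat_vector_mult: "mat c *v v = c *s v"
  for v :: "'a::comm_semiring_1^'n"
  by (simp add: vec_eq_iff matrix_vector_mult_def mat_def if_distrib[of "\<lambda>x. x * _"] sum.delta cong: if_cong)

text \<open>The order of a root is meaningful only for a nonzero polynomial. A real number exceeding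
  the operator norm of \<open>M\<close> cannot be an eigenvalue, so it is not a root.\<close>

lemma charpoly_complex_nonzero:
  fixes M :: "complex^'n^'n"
  shows "charpoly M \<noteq> 0"
proof
  assume 0: "charpoly M = 0"
  have lin: "linear (\<lambda>v. M *v v)"
    by (rule linearI) (simp_all add: vec_eq_iff matrix_vector_mult_def sum.distrib distrib_left scaleR_right.sum)
  define r where "r = onorm (\<lambda>v. M *v v) + 1"
  have "det (mat (complex_of_real r) - M) = 0"
    using poly_charpoly[of M "complex_of_real r"] 0 by simp
  then obtain v where v: "v \<noteq> 0" "(mat (complex_of_real r) - M) *v v = 0"
    by (metis invertible_det_nz invertible_left_inverse matrix_left_invertible_ker)
  have "M *v v = mat (complex_of_real r) *v v"
    using v(2) by (simp add: matrix_vector_mult_diff_rdistrib)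
  also have "\<dots> = r *\<^sub>R v"
    by (simp add: mat_vector_mult vec_eq_iff scaleR_conv_of_real [where 'a = complex])
  finally have "norm (M *v v) = \<bar>r\<bar> * norm v" by simp
  moreover have "norm (M *v v) \<le> onorm (\<lambda>v. M *v v) * norm v"
    using lin by (intro onorm) (simp add: linear_conv_bounded_linear)
  moreover have "onorm (\<lambda>v. M *v v) \<ge> 0"
    using lin by (intro onorm_pos_le) (simp add: linear_conv_bounded_linear)
  ultimately show False
    using v(1) by (simp add: r_def algebra_simps)
qed

text \<open>
  Replacing the columns \<open>i\<close> and \<open>j\<close> of \<open>xI - M\<close> by the two eigenvectors divides its determinant, up to a
  nonzero constant, by \<open>(x - \<mu>)\<^sup>2\<close>, and the result is still a polynomial in \<open>x\<close>.
\<close>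

lemma two_eigenvectors_algebraic_multiplicity:
  fixes M :: "complex^'n^'n"
  assumes p: "M *v p = \<mu> *s p" "p $ i \<noteq> 0"
    and q: "M *v q = \<mu> *s q" "q $ i = 0" "q $ j \<noteq> 0"
  shows "algebraic_multiplicity M \<mu> \<ge> 2"
proof -
  define E :: "complex poly^'n^'n" where
    "E = (\<chi> r c. if c = j then [:q $ r:] else if c = i then [:p $ r:]
            else (if r = c then [:0, 1:] else 0) - [:M $ r $ c:])"
  have det_E: "(x - \<mu>)^2 * poly (det E) x = p $ i * q $ j * poly (charpoly M) x" if "x \<noteq> \<mu>" for x
  proof -
    define N where "N = mat x - M"
    have shift: "N *v v = (x - \<mu>) *s v" if "M *v v = \<mu> *s v" for v
      using that
      by (simp add: N_def matrix_vector_mult_diff_rdistrib mat_vector_mult vec_eq_iff left_diff_distrib)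
    \<comment> \<open>The eigenvector divided by \<open>x - \<mu>\<close> solves the linear system
      with the eigenvector on the right. By Cramer's rule, putting the eigenvector into a column
      then multiplies the determinant by a component of this solution.\<close>
    have solve: "N *v (inverse (x - \<mu>) *s v) = v" if "M *v v = \<mu> *s v" for v
      unfolding vec.scale shift[OF that] vector_smult_assoc
      using \<open>x \<noteq> \<mu>\<close> by simp
    define N1 where "N1 = (\<chi> r c. if c = i then p $ r else N $ r $ c)"
    have "det N1 = inverse (x - \<mu>) * p $ i * det N"
      using cramer_lemma[of i N "inverse (x - \<mu>) *s p"] unfolding solve[OF p(1)] N1_def by simp
    \<comment> \<open>\<open>N1\<close> differs from \<open>N\<close> only in column
      \<open>i\<close>, which is multiplied by \<open>q $ i = 0\<close>.\<close>
    moreover have N1q: "N1 *v (inverse (x - \<mu>) *s q) = q"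
    proof -
      have "N1 *v (inverse (x - \<mu>) *s q) = N *v (inverse (x - \<mu>) *s q)"
        unfolding N1_def matrix_vector_mult_def vec_eq_iff
        by (auto intro!: sum.cong simp: q(2))
      then show ?thesis by (simp add: solve[OF q(1)])
    qed
    have "det (\<chi> r c. if c = j then q $ r else N1 $ r $ c) = inverse (x - \<mu>) * q $ j * det N1"
      using cramer_lemma[of j N1 "inverse (x - \<mu>) *s q"] unfolding N1q by simp
    moreover have "poly (det E) x = det (\<chi> r c. if c = j then q $ r else N1 $ r $ c)"
      unfolding poly_det by (rule arg_cong[where f = det]) (simp add: vec_eq_iff E_def N1_def N_def mat_def)
    moreover have cancel: "d^2 * (inverse d * y * (inverse d * z)) = y * z" if "d \<noteq> 0" for d y z :: complex
      using that by (simp add: power2_eq_square field_simps)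
    ultimately show ?thesis
      using cancel[of "x - \<mu>" "q $ j" "p $ i * det N"] \<open>x \<noteq> \<mu>\<close>
      by (simp add: poly_charpoly N_def [symmetric] mult_ac)
  qed
  \<comment> \<open>\<open>det_E\<close> excludes \<open>x = \<mu>\<close>. An extra factor
    vanishing there makes the identity hold at every point, hence between polynomials, and is then
    cancelled.\<close>
  have "poly ([:-\<mu>, 1:] * ([:-\<mu>, 1:]^2 * det E)) x = poly ([:-\<mu>, 1:] * smult (p $ i * q $ j) (charpoly M)) x" for x
    using det_E[of x] by (cases "x = \<mu>") (simp_all add: algebra_simps)
  then have "[:-\<mu>, 1:] * ([:-\<mu>, 1:]^2 * det E) = [:-\<mu>, 1:] * smult (p $ i * q $ j) (charpoly M)"
    unfolding poly_eq_poly_eq_iff [symmetric] by (rule ext)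
  then have "[:-\<mu>, 1:]^2 * det E = smult (p $ i * q $ j) (charpoly M)"
    by (metis mult_left_cancel one_neq_zero pCons_eq_0_iff)
  then have "[:-\<mu>, 1:]^2 dvd smult (p $ i * q $ j) (charpoly M)"
    by (metis dvd_triv_left)
  then have "[:-\<mu>, 1:]^2 dvd charpoly M"
    using p(2) q(3) by (simp add: dvd_smult_iff)
  then show ?thesis
    using charpoly_complex_nonzero[of M] by (simp add: algebraic_multiplicity_def order_divides)
qed

text \<open>If \<open>q\<close> were not a multiple of \<open>p\<close>, clearing from
  \<open>q\<close> a component in which \<open>p\<close> is nonzero would leave a second nonzero
  fixed vector, and the two would force multiplicity at least 2. They are complexified because
  multiplicities are defined over the complex numbers.\<close>

lemma simple_eigenvalue_one_fixed_vectors: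
  fixes M :: "real^'n^'n"
  assumes simple: "algebraic_multiplicity (complexify M) 1 = 1"
    and p: "M *v p = p" "p \<noteq> 0" and q: "M *v q = q"
  obtains c where "q = c *\<^sub>R p"
proof -
  define cv :: "real^'n \<Rightarrow> complex^'n" where "cv v = (\<chi> i. complex_of_real (v $ i))" for v
  have cv: "complexify M *v cv v = 1 *s cv v" if "M *v v = v" for v
    using that by (simp add: vec_eq_iff complexify_def cv_def matrix_vector_mult_def
        flip: of_real_mult of_real_sum)
  obtain i where i: "p $ i \<noteq> 0"
    using p(2) by (auto simp: vec_eq_iff)
  define q' where "q' = q - (q $ i / p $ i) *\<^sub>R p"
  have "q' = 0"
  proof (rule ccontr)
    assume "q' \<noteq> 0"
    then obtain j where j: "q' $ j \<noteq> 0"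
      by (auto simp: vec_eq_iff)
    have "M *v q' = q'"
      using p q by (simp add: q'_def matrix_vector_mult_diff_distrib scaleR_matrix_vector_assoc matrix_vector_mult_scaleR)
    then have "algebraic_multiplicity (complexify M) 1 \<ge> 2"
      using i j by (intro two_eigenvectors_algebraic_multiplicity[of _ "cv p" _ i "cv q'" j] cv p)
        (auto simp: cv_def q'_def simp flip: of_real_mult of_real_divide of_real_diff)
    then show False using simple by simp
  qed
  then show ?thesis
    by (intro that[of "q $ i / p $ i"]) (simp add: q'_def)
qed

text \<open>Gronwall's argument: the squared norm of a solution grows at most at the rate
  \<open>2 * K\<close>, so divided by \<open>exp (2 * K * t)\<close> it is nonincreasing, and it
  starts at 0.\<close>

lemma linear_ode_zero_unique:
  fixes A :: "real \<Rightarrow> real^'n^'n"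
  assumes K: "\<And>\<tau> v. \<tau> \<in> {0..T} \<Longrightarrow> norm (A \<tau> *v v) \<le> K * norm v"
    and k: "\<And>\<tau>. \<tau> \<in> {0..T} \<Longrightarrow> (k has_vector_derivative A \<tau> *v k \<tau>) (at \<tau> within {0..T})"
    and k0: "k 0 = 0" and \<tau>: "\<tau> \<in> {0..T}"
  shows "k \<tau> = 0"
proof (cases "\<tau> = 0")
  case False
  define \<phi> where "\<phi> t = exp (- (2 * K * t)) * (k t \<bullet> k t)" for t
  have cont: "continuous_on {0..T} k"
    by (auto simp: continuous_on_eq_continuous_within intro!: has_vector_derivative_continuous k)
  have "\<phi> \<tau> \<le> \<phi> 0"
  proof (rule DERIV_nonpos_imp_decreasing_open[where f = \<phi> and a = 0 and b = \<tau>])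
    show "0 \<le> \<tau>" using \<tau> by simp
    show "continuous_on {0..\<tau>} \<phi>"
      unfolding \<phi>_def using cont \<tau> by (intro continuous_intros continuous_on_subset[OF cont]) auto
    fix t assume t: "0 < t" "t < \<tau>"
    then have "t \<in> {0<..<T}" using \<tau> by auto
    then have kt: "(k has_vector_derivative A t *v k t) (at t)"
      using k[of t] by (metis at_within_open greaterThanLessThan_subseteq_atLeastAtMost_iff
          has_vector_derivative_within_subset open_greaterThanLessThan order_refl subsetD)
    have "((\<lambda>t. k t \<bullet> k t) has_vector_derivative k t \<bullet> (A t *v k t) + (A t *v k t) \<bullet> k t) (at t)"
      by (rule bounded_bilinear.has_vector_derivative[OF bounded_bilinear_inner kt kt])
    then have "(\<phi> has_real_derivative exp (- (2 * K * t)) * (2 * (k t \<bullet> (A t *v k t)) - 2 * K * (k t \<bullet> k t))) (at t)"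
      unfolding \<phi>_def has_real_derivative_iff_has_vector_derivative [symmetric]
      by (auto intro!: derivative_eq_intros simp: inner_commute algebra_simps)
    moreover have "k t \<bullet> (A t *v k t) \<le> K * (k t \<bullet> k t)"
    proof -
      have "k t \<bullet> (A t *v k t) \<le> norm (k t) * norm (A t *v k t)"
        by (rule norm_cauchy_schwarz)
      also have "\<dots> \<le> norm (k t) * (K * norm (k t))"
        using K[of t "k t"] t \<tau> by (intro mult_left_mono) auto
      finally show ?thesis by (simp add: dot_square_norm power2_eq_square mult_ac)
    qed
    ultimately show "\<exists>y. (\<phi> has_real_derivative y) (at t) \<and> y \<le> 0"
      by (intro exI conjI) (auto simp: mult_le_0_iff)
  qed
  then have "k \<tau> \<bullet> k \<tau> \<le> 0"
    by (simp add: \<phi>_def k0 mult_le_0_iff)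
  then show ?thesis by (metis inner_gt_zero_iff not_less)
qed (use k0 in simp)

lemma fundamental_matrix_solution:
  fixes A Y :: "real \<Rightarrow> real^'n^'n"
  assumes K: "\<And>\<tau> v. \<tau> \<in> {0..T} \<Longrightarrow> norm (A \<tau> *v v) \<le> K * norm v"
    and Y: "\<And>\<tau>. \<tau> \<in> {0..T} \<Longrightarrow> (Y has_vector_derivative A \<tau> ** Y \<tau>) (at \<tau> within {0..T})" "Y 0 = mat 1"
    and k: "\<And>\<tau>. \<tau> \<in> {0..T} \<Longrightarrow> (k has_vector_derivative A \<tau> *v k \<tau>) (at \<tau> within {0..T})"
    and \<tau>: "\<tau> \<in> {0..T}"
  shows "k \<tau> = Y \<tau> *v k 0"
proof -
  have bl: "bounded_linear (\<lambda>M::real^'n^'n. M *v k 0)"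
    unfolding linear_conv_bounded_linear [symmetric]
    by (rule linearI) (simp_all add: matrix_vector_mult_add_rdistrib scaleR_matrix_vector_assoc)
  have "k \<tau> - Y \<tau> *v k 0 = 0"
  proof (rule linear_ode_zero_unique[where A = A and T = T and K = K and k = "\<lambda>\<tau>. k \<tau> - Y \<tau> *v k 0"])
    fix t assume t: "t \<in> {0..T}"
    show "((\<lambda>\<tau>. k \<tau> - Y \<tau> *v k 0) has_vector_derivative A t *v (k t - Y t *v k 0)) (at t within {0..T})"
      using has_vector_derivative_diff[OF k[OF t] bounded_linear.has_vector_derivative[OF bl Y(1)[OF t]]]
      by (simp add: matrix_vector_mult_diff_distrib matrix_vector_mul_assoc)
  qed (use K \<tau> Y(2) in auto)
  then show ?thesis by simp
qed

section \<open>The homological equation\<close>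

text \<open>The boundary value problems give one-sided derivatives at 0 and \<open>T\<close>.
  Antiperiodicity carries the left derivative at \<open>T\<close> over to 0, where
  \<open>d T = - d 0\<close> makes it match the right one. The chain rule along a solution of the
  restricted system requires two-sided derivatives.\<close>

lemma antiperiodic_has_vector_derivative:
  fixes v :: "real \<Rightarrow> 'a::real_normed_vector"
  assumes T: "T > 0" and v: "\<And>\<tau>. \<tau> \<in> {0..T} \<Longrightarrow> (v has_vector_derivative d \<tau>) (at \<tau> within {0..T})"
    and ext: "\<And>\<tau>. v (\<tau> + T) = - v \<tau>" and d: "d T = - d 0" and \<tau>: "\<tau> \<in> {0..T}"
  shows "(v has_vector_derivative d \<tau>) (at \<tau>)"
proof -
  have d0: "(v has_vector_derivative d 0) (at 0)"
  proof -
    have "(v has_derivative (\<lambda>x. x *\<^sub>R d T)) (at (0 + T) within (\<lambda>x. x + T) ` {-T..0})"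
      using v[of T] T by (simp add: has_vector_derivative_def)
    moreover have "((\<lambda>x. x + T) has_derivative (\<lambda>x. x)) (at 0 within {-T..0})"
      by (auto intro!: derivative_eq_intros)
    ultimately have "((\<lambda>x. v (x + T)) has_derivative (\<lambda>x. x *\<^sub>R d T)) (at 0 within {-T..0})"
      using diff_chain_within[of "\<lambda>x. x + T" "\<lambda>x. x" 0 "{-T..0}" v "\<lambda>x. x *\<^sub>R d T"]
      by (simp add: o_def)
    then have "(v has_derivative (\<lambda>x. x *\<^sub>R d 0)) (at 0 within {-T..0})"
      unfolding ext d using has_derivative_minus by fastforce
    moreover have "(v has_derivative (\<lambda>x. x *\<^sub>R d 0)) (at 0 within {0..T})"
      using v[of 0] T by (simp add: has_vector_derivative_def)
    ultimately have "(v has_derivative (\<lambda>x. x *\<^sub>R d 0)) (at 0 within {-T..0} \<union> {0..T})"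
      by (simp add: has_derivative_within Lim_within_Un)
    also have "{-T..0} \<union> {0..T} = {-T..T}" using T by auto
    also have "at 0 within {-T..T} = at 0"
      using T by (intro at_within_interior) auto
    finally show ?thesis by (simp add: has_vector_derivative_def)
  qed
  consider "\<tau> = 0" | "\<tau> = T" | "\<tau> \<in> {0<..<T}"
    using \<tau> by (cases "\<tau> = 0"; cases "\<tau> = T") auto
  then show ?thesis
  proof cases
    case 2
    have "((\<lambda>x. x - T) has_vector_derivative 1) (at T)"
      by (auto intro!: derivative_eq_intros)
    from vector_diff_chain_at[OF this, of v "d 0"] d0
    have "((\<lambda>x. v (x - T)) has_vector_derivative d 0) (at T)"
      by (simp add: o_def)
    then have "((\<lambda>x. - v (x - T)) has_vector_derivative - d 0) (at T)"
      by (rule has_vector_derivative_minus)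
    moreover have "- v (x - T) = v x" for x
      using ext[of "x - T"] by simp
    ultimately show ?thesis using 2 d by simp
  next
    case 3
    then have "(v has_vector_derivative d \<tau>) (at \<tau> within {0<..<T})"
      using v[of \<tau>] by (auto intro: has_vector_derivative_within_subset)
    then show ?thesis by (simp only: at_within_open[OF 3 open_greaterThanLessThan])
  qed (use d0 in simp)
qed

lemma vec2_eq: "x = (x $ 1) *\<^sub>R axis 1 1 + (x $ 2) *\<^sub>R axis 2 1" for x :: "real^2"
  by (simp add: vec_eq_iff forall_2 axis_def)

text \<open>Both derivatives are taken at time 0, when the local solution passes through the chosen
  point. \<open>H\<close> is kept apart from \<open>u0\<close>, \<open>v1\<close>, \<open>v2\<close>
  because only \<open>H\<close> is differentiated jointly in \<tau> and \<xi>.\<close>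

lemma homological_equation:
  fixes F :: "real^'n \<Rightarrow> real^'n" and H :: "real \<Rightarrow> real^2 \<Rightarrow> real^'n" and \<xi>0 :: "real^2"
  defines "K \<equiv> (\<lambda>(\<tau>, \<xi>). H \<tau> \<xi>)"
  assumes u0: "(u0 has_vector_derivative du) (at \<tau>0)" and v1: "(v1 has_vector_derivative dv1) (at \<tau>0)"
    and v2: "(v2 has_vector_derivative dv2) (at \<tau>0)"
    and K: "Ck_on (Suc k) K (UNIV \<times> ball 0 \<delta>)"
    and R: "Ck_on 1 (\<lambda>(\<tau>, \<xi>). R0 \<tau> \<xi>) (UNIV \<times> ball 0 \<delta>)"
    "Ck_on 1 (\<lambda>(\<tau>, \<xi>). R1 \<tau> \<xi>) (UNIV \<times> ball 0 \<delta>)"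
    "Ck_on 1 (\<lambda>(\<tau>, \<xi>). R2 \<tau> \<xi>) (UNIV \<times> ball 0 \<delta>)"
    and inv: "\<forall>\<tau> \<xi> r s. (\<forall>t\<in>{r<..<s}. \<xi> t \<in> ball 0 \<delta>) \<and>
           solves_R2_normal_form \<alpha> a b R0 R1 R2 \<tau> \<xi> {r<..<s} \<longrightarrow>
           (\<forall>t\<in>{r<..<s}.
              ((\<lambda>t. cm_param u0 v1 v2 H (\<tau> t) (\<xi> t)) has_vector_derivative
                 F (cm_param u0 v1 v2 H (\<tau> t) (\<xi> t))) (at t))"
    and \<xi>0: "\<xi>0 \<in> ball 0 \<delta>"
  shows "(1 + \<alpha> * (\<xi>0 $ 1)^2 + R0 \<tau>0 \<xi>0) *\<^sub>R
        (du + (\<xi>0 $ 1) *\<^sub>R dv1 + (\<xi>0 $ 2) *\<^sub>R dv2 + dderiv (1, 0) K (\<tau>0, \<xi>0)) +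
      (\<xi>0 $ 2 + \<alpha> * (\<xi>0 $ 1)^2 * \<xi>0 $ 2 + R1 \<tau>0 \<xi>0) *\<^sub>R
        (v1 \<tau>0 + dderiv (0, axis 1 1) K (\<tau>0, \<xi>0)) +
      (a * (\<xi>0 $ 1)^3 + b * (\<xi>0 $ 1)^2 * \<xi>0 $ 2 + R2 \<tau>0 \<xi>0) *\<^sub>R
        (v2 \<tau>0 + dderiv (0, axis 2 1) K (\<tau>0, \<xi>0)) =
      F (cm_param u0 v1 v2 H \<tau>0 \<xi>0)"
proof -
  obtain r \<tau> \<xi> where r: "r > 0" and init: "\<tau> 0 = \<tau>0" "\<xi> 0 = \<xi>0"
    and ball: "\<And>t. t \<in> {-r<..<r} \<Longrightarrow> \<xi> t \<in> ball 0 \<delta>"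
    and sol: "solves_R2_normal_form \<alpha> a b R0 R1 R2 \<tau> \<xi> {-r<..<r}"
    using R2_normal_form_local_solution[OF R \<xi>0] by metis
  define p q1 q2 where "p = 1 + \<alpha> * (\<xi>0 $ 1)^2 + R0 \<tau>0 \<xi>0"
    and "q1 = \<xi>0 $ 2 + \<alpha> * (\<xi>0 $ 1)^2 * \<xi>0 $ 2 + R1 \<tau>0 \<xi>0"
    and "q2 = a * (\<xi>0 $ 1)^3 + b * (\<xi>0 $ 1)^2 * \<xi>0 $ 2 + R2 \<tau>0 \<xi>0"
  have d: "(\<tau> has_vector_derivative p) (at 0)"
    "((\<lambda>s. \<xi> s $ 1) has_real_derivative q1) (at 0)" "((\<lambda>s. \<xi> s $ 2) has_real_derivative q2) (at 0)"
    using sol[unfolded solves_R2_normal_form_def, THEN bspec, of 0] r init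
    by (auto simp: has_real_derivative_iff_has_vector_derivative p_def q1_def q2_def)
  let ?D = "\<lambda>v. dderiv v K (\<tau>0, \<xi>0)"
  have diffK: "K differentiable (at (\<tau>0, \<xi>0))"
    by (rule Ck_on_differentiable[OF K]) (use \<xi>0 in auto)
  have along: "((\<lambda>t. w (\<tau> t)) has_vector_derivative p *\<^sub>R dw) (at 0)"
    if "(w has_vector_derivative dw) (at \<tau>0)" for w :: "real \<Rightarrow> real^'n" and dw
    using vector_diff_chain_at[OF d(1), of w dw] that by (simp add: init o_def)
  have "((\<lambda>t. (\<xi> t $ 1) *\<^sub>R axis 1 1 + (\<xi> t $ 2) *\<^sub>R axis 2 1 :: real^2) has_vector_derivative
      q1 *\<^sub>R axis 1 1 + q2 *\<^sub>R axis 2 1) (at 0)"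
    using d by (auto intro!: derivative_eq_intros)
  then have "(\<xi> has_vector_derivative q1 *\<^sub>R axis 1 1 + q2 *\<^sub>R axis 2 1) (at 0)"
    by (simp flip: vec2_eq)
  with d(1) have "((\<lambda>t. (\<tau> t, \<xi> t)) has_vector_derivative (p, q1 *\<^sub>R axis 1 1 + q2 *\<^sub>R axis 2 1)) (at 0)"
    by (rule has_vector_derivative_Pair)
  then have "((\<lambda>t. K (\<tau> t, \<xi> t)) has_vector_derivative ?D (p, q1 *\<^sub>R axis 1 1 + q2 *\<^sub>R axis 2 1)) (at 0)"
    using dderiv_along_curve[of K "\<lambda>t. (\<tau> t, \<xi> t)" 0] diffK init by simp
  also have "?D (p, q1 *\<^sub>R axis 1 1 + q2 *\<^sub>R axis 2 1) =
      ?D (p *\<^sub>R (1, 0) + q1 *\<^sub>R (0, axis 1 1) + q2 *\<^sub>R (0, axis 2 1))"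
    by simp
  also have "\<dots> = p *\<^sub>R ?D (1, 0) + q1 *\<^sub>R ?D (0, axis 1 1) + q2 *\<^sub>R ?D (0, axis 2 1)"
    by (simp only: linear_add[OF linear_dderiv[OF diffK]] linear_scale[OF linear_dderiv[OF diffK]])
  finally have dG: "((\<lambda>t. cm_param u0 v1 v2 H (\<tau> t) (\<xi> t)) has_vector_derivative
      p *\<^sub>R du + ((\<xi> 0 $ 1) *\<^sub>R (p *\<^sub>R dv1) + q1 *\<^sub>R v1 (\<tau> 0)) + ((\<xi> 0 $ 2) *\<^sub>R (p *\<^sub>R dv2) + q2 *\<^sub>R v2 (\<tau> 0)) +
      (p *\<^sub>R ?D (1, 0) + q1 *\<^sub>R ?D (0, axis 1 1) + q2 *\<^sub>R ?D (0, axis 2 1))) (at 0)"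
    unfolding cm_param_def K_def split
    by (intro has_vector_derivative_add has_vector_derivative_scaleR along u0 v1 v2 d)
  have "((\<lambda>t. cm_param u0 v1 v2 H (\<tau> t) (\<xi> t)) has_vector_derivative
      F (cm_param u0 v1 v2 H \<tau>0 \<xi>0)) (at 0)"
    using inv[THEN spec[of _ \<tau>], THEN spec[of _ \<xi>], THEN spec[of _ "-r"], THEN spec[of _ r],
        THEN mp, OF conjI[OF _ sol], THEN bspec[of _ _ 0]] ball r by (simp add: init)
  from vector_derivative_unique_at[OF dG this] show ?thesis
    unfolding p_def [symmetric] q1_def [symmetric] q2_def [symmetric]
    by (simp add: init algebra_simps)
qed

section \<open>Taylor coefficients of \<open>H\<close> in \<xi> and their derivatives in
  \<tau>\<close>

lemma jet3_tendsto:
  assumes "jet3 f c0 c1 c2 c3"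
  shows "(f \<longlongrightarrow> c0) (at 0)"
proof -
  let ?r = "\<lambda>s. (f s - (c0 + s *\<^sub>R c1 + s^2 *\<^sub>R c2 + s^3 *\<^sub>R c3)) /\<^sub>R s^3"
  have "((\<lambda>s. s^3 *\<^sub>R ?r s + (c0 + s *\<^sub>R c1 + s^2 *\<^sub>R c2 + s^3 *\<^sub>R c3)) \<longlongrightarrow>
      0^3 *\<^sub>R 0 + (c0 + 0 *\<^sub>R c1 + 0^2 *\<^sub>R c2 + 0^3 *\<^sub>R c3)) (at 0)"
    using assms unfolding jet3_def by (intro tendsto_intros)
  then show ?thesis
    by (rule tendsto_transform_at_0) auto
qed

lemma jet3_on_ray:
  fixes G :: "real \<times> (real^2) \<Rightarrow> 'b::real_inner"
  assumes G: "Ck_on (Suc (Suc (Suc k))) G (UNIV \<times> ball 0 \<delta>)" and \<delta>: "\<delta> > 0"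
  shows "jet3 (\<lambda>s. G (\<tau>, s *\<^sub>R \<eta>)) (G (\<tau>, 0)) (dderiv (0, \<eta>) G (\<tau>, 0))
     ((1/2) *\<^sub>R dderiv (0, \<eta>) (dderiv (0, \<eta>) G) (\<tau>, 0))
     ((1/6) *\<^sub>R dderiv (0, \<eta>) (dderiv (0, \<eta>) (dderiv (0, \<eta>) G)) (\<tau>, 0))"
proof -
  have "((\<lambda>s. s *\<^sub>R \<eta>) \<longlongrightarrow> 0 *\<^sub>R \<eta>) (nhds 0)"
    by (intro tendsto_intros) (simp add: filterlim_ident)
  then have ev: "\<forall>\<^sub>F s in nhds (0::real). s *\<^sub>R \<eta> \<in> ball 0 \<delta>"
    by (rule topological_tendstoD) (use \<delta> in auto)
  have curve: "((\<lambda>s. f (\<tau>, s *\<^sub>R \<eta>)) has_vector_derivative dderiv (0, \<eta>) f (\<tau>, s *\<^sub>R \<eta>)) (at s)"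
    if "Ck_on (Suc j) f (UNIV \<times> ball 0 \<delta>)" "s *\<^sub>R \<eta> \<in> ball 0 \<delta>" for f :: "real \<times> (real^2) \<Rightarrow> 'b" and j s
    by (rule dderiv_along_curve[where g = "\<lambda>s. (\<tau>, s *\<^sub>R \<eta>)", OF Ck_on_differentiable[OF that(1)]])
      (use that(2) in \<open>auto intro!: derivative_eq_intros has_vector_derivative_Pair\<close>)
  note G1 = Ck_on_dderiv[OF G] note G2 = Ck_on_dderiv[OF G1]
  have "((\<lambda>s. dderiv (0, \<eta>) (dderiv (0, \<eta>) G) (\<tau>, s *\<^sub>R \<eta>)) has_vector_derivative
     dderiv (0, \<eta>) (dderiv (0, \<eta>) (dderiv (0, \<eta>) G)) (\<tau>, 0)) (at 0)"
    using curve[OF G2, of 0] \<delta> by simp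
  from jet3_taylor[OF eventually_mono[OF ev curve[OF G]] eventually_mono[OF ev curve[OF G1]] this]
  show ?thesis by simp
qed

lemma dderiv2_add:
  fixes f :: "'a::real_normed_vector \<Rightarrow> 'b::real_inner"
  assumes C: "Ck_on (Suc (Suc k)) f S" and S: "open S" "x \<in> S"
  shows "dderiv (p + q) (dderiv (p + q) f) x =
     dderiv p (dderiv p f) x + 2 *\<^sub>R dderiv p (dderiv q f) x + dderiv q (dderiv q f) x"
proof -
  note l = linear_add[OF linear_dderiv2_left[OF C S]]
    linear_add[OF linear_dderiv[OF Ck_on_differentiable[OF Ck_on_dderiv[OF C] S(2)]]]
  show ?thesis
    by (simp add: l dderiv_commute[OF C S, of q p] scaleR_2)
qed

lemma dderiv3_add:
  fixes f :: "'a::real_normed_vector \<Rightarrow> 'b::real_inner"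
  assumes C: "Ck_on (Suc (Suc (Suc k))) f S" and S: "open S" "x \<in> S"
  shows "dderiv (p + q) (dderiv (p + q) (dderiv (p + q) f)) x =
     dderiv p (dderiv p (dderiv p f)) x + 3 *\<^sub>R dderiv p (dderiv p (dderiv q f)) x +
     3 *\<^sub>R dderiv p (dderiv q (dderiv q f)) x + dderiv q (dderiv q (dderiv q f)) x"
proof -
  note C1 = Ck_on_dderiv[OF C]
  note l = linear_add[OF linear_dderiv3_left[OF C S]] linear_add[OF linear_dderiv2_left[OF C1 S]]
    linear_add[OF linear_dderiv[OF Ck_on_differentiable[OF Ck_on_dderiv[OF C1] S(2)]]]
  have 1: "dderiv p (dderiv q (dderiv p f)) x = dderiv p (dderiv p (dderiv q f)) x"
    "dderiv q (dderiv q (dderiv p f)) x = dderiv q (dderiv p (dderiv q f)) x"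
    by (rule dderiv_commute_inner[OF C S])+
  have 2: "dderiv q (dderiv p (dderiv p f)) x = dderiv p (dderiv q (dderiv p f)) x"
    "dderiv q (dderiv p (dderiv q f)) x = dderiv p (dderiv q (dderiv q f)) x"
    by (rule dderiv_commute[OF C1 S])+
  have 3: "3 *\<^sub>R y = y + y + y" for y :: 'b
    using scaleR_left_distrib[of 2 1 y] by (simp add: scaleR_2)
  show ?thesis
    unfolding l 1 2 3 by (simp add: algebra_simps)
qed

text \<open>The second derivative of \<open>H\<close> at \<xi> = 0 along \<open>(x, y)\<close>, in
  terms of coefficients normalized by \<open>1 / (fact i * fact j)\<close>, so that half of it is
  the quadratic part of the expansion. \<open>form3\<close> is the cubic counterpart.\<close>

definition form2 :: "(nat \<Rightarrow> nat \<Rightarrow> 'a::real_vector) \<Rightarrow> real \<Rightarrow> real \<Rightarrow> 'a" where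
  "form2 c x y = x^2 *\<^sub>R c 2 0 + (2 * x * y) *\<^sub>R c 1 1 + y^2 *\<^sub>R c 0 2"

definition form3 :: "(nat \<Rightarrow> nat \<Rightarrow> 'a::real_vector) \<Rightarrow> real \<Rightarrow> real \<Rightarrow> 'a" where
  "form3 c x y = x^3 *\<^sub>R c 3 0 + (3 * x^2 * y) *\<^sub>R c 2 1 + (3 * x * y^2) *\<^sub>R c 1 2 + y^3 *\<^sub>R c 0 3"

lemma sum_degree_3: "i + j = 3 \<longleftrightarrow> (i, j) \<in> {(3, 0), (2, 1), (1, 2), (0, 3 :: nat)}" for i j :: nat
  by auto

lemma sum_degree_2: "i + j = 2 \<longleftrightarrow> (i, j) \<in> {(2, 0), (1, 1), (0, 2 :: nat)}" for i j :: nat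
  by auto

lemma coeff_of_form2:
  fixes c :: "nat \<Rightarrow> nat \<Rightarrow> 'a::real_vector"
  shows "c 2 0 = form2 c 1 0" "c 0 2 = form2 c 0 1"
    "c 1 1 = (1/2) *\<^sub>R (form2 c 1 1 - form2 c 1 0 - form2 c 0 1)"
  by (simp_all add: form2_def)

text \<open>The values at \<open>(1, 1)\<close> and \<open>(1, -1)\<close> split the cubic into
  parts odd and even in \<open>y\<close>; each part contains one mixed and one pure coefficient, and
  the pure one is then removed.\<close>

lemma coeff_of_form3:
  fixes c :: "nat \<Rightarrow> nat \<Rightarrow> 'a::real_vector"
  shows "c 3 0 = form3 c 1 0" "c 0 3 = form3 c 0 1"
    "c 2 1 = (1/6) *\<^sub>R (form3 c 1 1 - form3 c 1 (-1) - 2 *\<^sub>R form3 c 0 1)"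
    "c 1 2 = (1/6) *\<^sub>R (form3 c 1 1 + form3 c 1 (-1) - 2 *\<^sub>R form3 c 1 0)"
proof -
  have 6: "(1/6) *\<^sub>R (3 *\<^sub>R y + 3 *\<^sub>R y) = y" for y :: 'a
    by (simp flip: scaleR_left_distrib)
  have 2: "z + z - 2 *\<^sub>R z = 0" for z :: 'a
    by (simp add: scaleR_2)
  show "c 3 0 = form3 c 1 0" "c 0 3 = form3 c 0 1"
    by (simp_all add: form3_def)
  have "form3 c 1 1 - form3 c 1 (-1) - 2 *\<^sub>R form3 c 0 1 =
      3 *\<^sub>R c 2 1 + 3 *\<^sub>R c 2 1"
    using 2[of "c 0 3"] by (simp add: form3_def algebra_simps)
  then show "c 2 1 = (1/6) *\<^sub>R (form3 c 1 1 - form3 c 1 (-1) - 2 *\<^sub>R form3 c 0 1)"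
    by (simp only: 6)
  have "form3 c 1 1 + form3 c 1 (-1) - 2 *\<^sub>R form3 c 1 0 =
      3 *\<^sub>R c 1 2 + 3 *\<^sub>R c 1 2"
    using 2[of "c 3 0"] by (simp add: form3_def algebra_simps)
  then show "c 1 2 = (1/6) *\<^sub>R (form3 c 1 1 + form3 c 1 (-1) - 2 *\<^sub>R form3 c 1 0)"
    by (simp only: 6)
qed

text \<open>\<open>O[at 0]\<close> constrains only points other than 0, so the ray has to leave the
  origin, hence \<open>\<eta> \<noteq> 0\<close>.\<close>

lemma bigo_norm4_on_ray:
  fixes f :: "'a::real_normed_vector \<Rightarrow> real"
  assumes "f \<in> O[at 0](\<lambda>\<xi>. norm \<xi> ^ 4)" "\<eta> \<noteq> 0"
  obtains M where "\<forall>\<^sub>F s in at 0. \<bar>f (s *\<^sub>R \<eta>)\<bar> \<le> M * s^4"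
proof -
  from landau_o.bigE[OF assms(1)] obtain c where
    c: "\<forall>\<^sub>F \<xi> in at 0. norm (f \<xi>) \<le> c * norm (norm \<xi> ^ 4)" by blast
  have "((\<lambda>s. s *\<^sub>R \<eta>) \<longlongrightarrow> 0 *\<^sub>R \<eta>) (at (0::real))"
    by (intro tendsto_intros)
  then have "filterlim (\<lambda>s. s *\<^sub>R \<eta>) (at 0) (at (0::real))"
    using assms(2) by (auto simp: filterlim_at eventually_at_filter)
  from eventually_compose_filterlim[OF c this]
  have "\<forall>\<^sub>F s in at 0. \<bar>f (s *\<^sub>R \<eta>)\<bar> \<le> (c * norm \<eta> ^ 4) * s^4"
    by eventually_elim (simp add: power_mult_distrib mult_ac)
  then show ?thesis by (rule that)
qed

text \<open>On a ray \<open>H\<close> has two third-order expansions, Taylor's and the one in the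
  hypothesis, and uniqueness equates them. An asymptotic statement thereby becomes an identity
  between derivatives at \<open>(\<tau>, 0)\<close>, which can be differentiated in \<tau>.\<close>

lemma taylor_coefficients_on_ray:
  fixes H :: "real \<Rightarrow> real^2 \<Rightarrow> 'b::euclidean_space"
  defines "K \<equiv> (\<lambda>(\<tau>, \<xi>). H \<tau> \<xi>)"
  assumes K: "Ck_on (Suc (Suc (Suc k))) K (UNIV \<times> ball 0 \<delta>)" and \<delta>: "\<delta> > 0"
    and bigo: "(\<lambda>\<xi>. norm (H \<tau> \<xi> -
               (\<Sum>(i, j) \<in> {(i, j). 2 \<le> i + j \<and> i + j \<le> 3}.
                  (1 / (fact i * fact j) * (\<xi> $ 1)^i * (\<xi> $ 2)^j) *\<^sub>R h i j \<tau>)))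
             \<in> O[at 0](\<lambda>\<xi>. norm \<xi> ^ 4)"
  shows "K (\<tau>, 0) = 0" "dderiv (0, \<eta>) K (\<tau>, 0) = 0"
    "dderiv (0, \<eta>) (dderiv (0, \<eta>) K) (\<tau>, 0) = form2 (\<lambda>i j. h i j \<tau>) (\<eta> $ 1) (\<eta> $ 2)"
    "dderiv (0, \<eta>) (dderiv (0, \<eta>) (dderiv (0, \<eta>) K)) (\<tau>, 0) = form3 (\<lambda>i j. h i j \<tau>) (\<eta> $ 1) (\<eta> $ 2)"
proof -
  have S: "{(i, j). 2 \<le> i + j \<and> i + j \<le> 3} =
      {(2, 0), (1, 1), (0, 2), (3, 0), (2, 1), (1, 2), (0, 3 :: nat)}"
  proof -
    have "2 \<le> i + j \<and> i + j \<le> 3 \<longleftrightarrow> i + j = 2 \<or> i + j = 3" for i j :: nat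
      by arith
    then show ?thesis by (auto simp: sum_degree_2 sum_degree_3)
  qed
  have jet: "jet3 (\<lambda>s. K (\<tau>, s *\<^sub>R \<eta>)) 0 0
      ((1/2) *\<^sub>R form2 (\<lambda>i j. h i j \<tau>) (\<eta> $ 1) (\<eta> $ 2)) ((1/6) *\<^sub>R form3 (\<lambda>i j. h i j \<tau>) (\<eta> $ 1) (\<eta> $ 2))"
    if "\<eta> \<noteq> 0" for \<eta>
  proof -
    have eq: "(\<Sum>(i, j) \<in> {(i, j). 2 \<le> i + j \<and> i + j \<le> 3}.
        (1 / (fact i * fact j) * ((s *\<^sub>R \<eta>) $ 1)^i * ((s *\<^sub>R \<eta>) $ 2)^j) *\<^sub>R h i j \<tau>) =
      0 + s *\<^sub>R 0 + s^2 *\<^sub>R ((1/2) *\<^sub>R form2 (\<lambda>i j. h i j \<tau>) (\<eta> $ 1) (\<eta> $ 2)) +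
        s^3 *\<^sub>R ((1/6) *\<^sub>R form3 (\<lambda>i j. h i j \<tau>) (\<eta> $ 1) (\<eta> $ 2))" for s
      unfolding S form2_def form3_def
      by (simp add: fact_numeral scaleR_add_right power_mult_distrib power2_eq_square power3_eq_cube mult_ac)
    from bigo_norm4_on_ray[OF bigo that]
    obtain M where "\<forall>\<^sub>F s in at 0. \<bar>norm (H \<tau> (s *\<^sub>R \<eta>) -
        (0 + s *\<^sub>R 0 + s^2 *\<^sub>R ((1/2) *\<^sub>R form2 (\<lambda>i j. h i j \<tau>) (\<eta> $ 1) (\<eta> $ 2)) +
        s^3 *\<^sub>R ((1/6) *\<^sub>R form3 (\<lambda>i j. h i j \<tau>) (\<eta> $ 1) (\<eta> $ 2))))\<bar> \<le> M * s^4"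
      unfolding eq by blast
    then show ?thesis
      unfolding K_def split by (intro jet3_of_bound[where M = M]) simp
  qed
  note u = jet3_unique[OF jet3_on_ray[OF K \<delta>] jet]
  have "axis 1 1 \<noteq> (0 :: real^2)" by (simp add: axis_eq_0_iff)
  from u(1)[OF this] show "K (\<tau>, 0) = 0" .
  have diff: "f differentiable (at (\<tau>, 0))" if "Ck_on (Suc j) f (UNIV \<times> ball 0 \<delta>)" for f :: "real \<times> (real^2) \<Rightarrow> 'b" and j
    by (rule Ck_on_differentiable[OF that]) (use \<delta> in auto)
  \<comment> \<open>\<open>jet\<close> excludes the direction 0; there both sides vanish, the left
    one by linearity of the derivative.\<close>
  have z: "dderiv (0, 0) f (\<tau>, 0) = 0" if "Ck_on (Suc j) f (UNIV \<times> ball 0 \<delta>)" for f :: "real \<times> (real^2) \<Rightarrow> 'b" and j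
    using linear_0[OF linear_dderiv[OF diff[OF that]]] by (simp add: zero_prod_def)
  show "dderiv (0, \<eta>) K (\<tau>, 0) = 0"
    using u(2)[of \<eta>] z[OF K] by (cases "\<eta> = 0") auto
  show "dderiv (0, \<eta>) (dderiv (0, \<eta>) K) (\<tau>, 0) = form2 (\<lambda>i j. h i j \<tau>) (\<eta> $ 1) (\<eta> $ 2)"
    using u(3)[of \<eta>] z[OF Ck_on_dderiv[OF K]] by (cases "\<eta> = 0") (auto simp: form2_def)
  show "dderiv (0, \<eta>) (dderiv (0, \<eta>) (dderiv (0, \<eta>) K)) (\<tau>, 0) = form3 (\<lambda>i j. h i j \<tau>) (\<eta> $ 1) (\<eta> $ 2)"
    using u(4)[of \<eta>] z[OF Ck_on_dderiv[OF Ck_on_dderiv[OF K]]] by (cases "\<eta> = 0") (auto simp: form3_def)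
qed

text \<open>Brings the outermost direction \<open>e\<close>, later the \<tau>-direction
  \<open>(1, 0)\<close>, to the innermost place, so that it acts on \<open>f\<close> first.\<close>

lemma dderiv_commute_dderiv2:
  fixes f :: "'a::real_normed_vector \<Rightarrow> 'b::real_inner"
  assumes C: "Ck_on (Suc (Suc (Suc k))) f S" and S: "open S" "x \<in> S"
  shows "dderiv e (dderiv p (dderiv q f)) x = dderiv p (dderiv q (dderiv e f)) x"
  using dderiv_commute[OF Ck_on_dderiv[OF C] S] dderiv_commute_inner[OF C S] by metis

lemma dderiv_commute_dderiv3:
  fixes f :: "'a::real_normed_vector \<Rightarrow> 'b::real_inner"
  assumes C: "Ck_on (Suc (Suc (Suc (Suc k)))) f S" and S: "open S" "x \<in> S"
  shows "dderiv e (dderiv p (dderiv q (dderiv r f))) x = dderiv p (dderiv q (dderiv r (dderiv e f))) x"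
proof -
  have "dderiv e (dderiv p (dderiv q (dderiv r f))) x = dderiv p (dderiv e (dderiv q (dderiv r f))) x"
    by (rule dderiv_commute[OF Ck_on_dderiv[OF Ck_on_dderiv[OF C]] S])
  also have "\<dots> = dderiv p (dderiv q (dderiv r (dderiv e f))) x"
    by (rule dderiv_cong[OF _ S])
      (use dderiv_commute_dderiv2[OF C S(1)] S(2)
        Ck_on_differentiable[OF Ck_on_dderiv[OF Ck_on_dderiv[OF Ck_on_dderiv[OF C]]]] in auto)
  finally show ?thesis .
qed

text \<open>The \<xi>-derivatives of \<open>H\<close> at \<open>(\<tau>, 0)\<close> are forms in the
  \<open>h i j\<close>. Differentiating them in \<tau> and commuting yields the \<xi>-derivatives of
  the \<tau>-derivative of \<open>H\<close>, and thus its expansion on a ray.\<close>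

lemma taylor_coefficients_derivative:
  fixes H :: "real \<Rightarrow> real^2 \<Rightarrow> 'b::euclidean_space"
  defines "K \<equiv> (\<lambda>(\<tau>, \<xi>). H \<tau> \<xi>)"
  assumes K: "Ck_on 4 K (UNIV \<times> ball 0 \<delta>)" and \<delta>: "\<delta> > 0"
    and bigo: "\<And>\<tau>. (\<lambda>\<xi>. norm (H \<tau> \<xi> -
               (\<Sum>(i, j) \<in> {(i, j). 2 \<le> i + j \<and> i + j \<le> 3}.
                  (1 / (fact i * fact j) * (\<xi> $ 1)^i * (\<xi> $ 2)^j) *\<^sub>R h i j \<tau>)))
             \<in> O[at 0](\<lambda>\<xi>. norm \<xi> ^ 4)"
  obtains dh where
    "\<And>i j \<tau>. i + j = 2 \<or> i + j = 3 \<Longrightarrow> (h i j has_vector_derivative dh i j \<tau>) (at \<tau>)"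
    "\<And>\<tau> \<eta>. jet3 (\<lambda>s. dderiv (1, 0) K (\<tau>, s *\<^sub>R \<eta>)) 0 0
       ((1/2) *\<^sub>R form2 (\<lambda>i j. dh i j \<tau>) (\<eta> $ 1) (\<eta> $ 2)) ((1/6) *\<^sub>R form3 (\<lambda>i j. dh i j \<tau>) (\<eta> $ 1) (\<eta> $ 2))"
proof -
  define S where "S = (UNIV \<times> ball 0 \<delta> :: (real \<times> (real^2)) set)"
  have S: "open S" "(\<tau>, 0) \<in> S" for \<tau>
    using \<delta> by (auto simp: S_def intro: open_Times)
  have K4: "Ck_on (Suc (Suc (Suc (Suc 0)))) K S"
    using K by (simp add: S_def numeral_eq_Suc del: Ck_on.simps)
  note K3 = Ck_on_SucD[OF K4]
  note coeffs = taylor_coefficients_on_ray[where k = 0 and H = H and h = h and \<delta> = \<delta>, folded K_def S_def, OF K3 \<delta> bigo]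
  have along: "((\<lambda>\<tau>. f (\<tau>, 0)) has_vector_derivative dderiv (1, 0) f (\<tau>, 0)) (at \<tau>)"
    if "Ck_on (Suc j) f S" for f :: "real \<times> (real^2) \<Rightarrow> 'b" and j \<tau>
    by (rule dderiv_along_curve[where g = "\<lambda>\<tau>. (\<tau>, 0)", OF Ck_on_differentiable[OF that S(2)]])
      (auto intro!: derivative_eq_intros has_vector_derivative_Pair)
  define E where "E \<tau> \<eta> = dderiv (0, \<eta>) (dderiv (0, \<eta>) (dderiv (1, 0) K)) (\<tau>, 0)" for \<tau> \<eta>
  define G where "G \<tau> \<eta> = dderiv (0, \<eta>) (dderiv (0, \<eta>) (dderiv (0, \<eta>) (dderiv (1, 0) K))) (\<tau>, 0)" for \<tau> \<eta>
  have E: "((\<lambda>\<tau>. form2 (\<lambda>i j. h i j \<tau>) (\<eta> $ 1) (\<eta> $ 2)) has_vector_derivative E \<tau> \<eta>) (at \<tau>)" for \<tau> \<eta>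
    using along[OF Ck_on_dderiv[OF Ck_on_dderiv[OF K4]], of "(0, \<eta>)" "(0, \<eta>)" \<tau>]
    by (simp add: coeffs E_def dderiv_commute_dderiv2[OF K3 S])
  have G: "((\<lambda>\<tau>. form3 (\<lambda>i j. h i j \<tau>) (\<eta> $ 1) (\<eta> $ 2)) has_vector_derivative G \<tau> \<eta>) (at \<tau>)" for \<tau> \<eta>
    using along[OF Ck_on_dderiv[OF Ck_on_dderiv[OF Ck_on_dderiv[OF K4]]], of "(0, \<eta>)" "(0, \<eta>)" "(0, \<eta>)" \<tau>]
    by (simp add: coeffs G_def dderiv_commute_dderiv3[OF K4 S])
  have form2_diff: "(\<lambda>\<tau>. form2 (\<lambda>i j. h i j \<tau>) x y) differentiable (at \<tau>)" for x y \<tau>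
    using E[of "vector [x, y]" \<tau>] by (auto simp: has_vector_derivative_def intro: differentiableI)
  have form3_diff: "(\<lambda>\<tau>. form3 (\<lambda>i j. h i j \<tau>) x y) differentiable (at \<tau>)" for x y \<tau>
    using G[of "vector [x, y]" \<tau>] by (auto simp: has_vector_derivative_def intro: differentiableI)
  \<comment> \<open>So far only the forms are known to be differentiable. Each single coefficient is
    a combination of values of a form at fixed arguments and inherits differentiability from
    them.\<close>
  define dh where "dh i j \<tau> = vector_derivative (h i j) (at \<tau>)" for i j \<tau>
  have dh: "(h i j has_vector_derivative dh i j \<tau>) (at \<tau>)" if ij: "i + j = 2 \<or> i + j = 3" for i j \<tau>
  proof -
    note c2 = coeff_of_form2[of "\<lambda>i j. h i j \<tau>" for \<tau>] and c3 = coeff_of_form3[of "\<lambda>i j. h i j \<tau>" for \<tau>]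
    have c: "h 2 0 = (\<lambda>\<tau>. form2 (\<lambda>i j. h i j \<tau>) 1 0)" "h 0 2 = (\<lambda>\<tau>. form2 (\<lambda>i j. h i j \<tau>) 0 1)"
      "h 1 1 = (\<lambda>\<tau>. (1/2) *\<^sub>R (form2 (\<lambda>i j. h i j \<tau>) 1 1 - form2 (\<lambda>i j. h i j \<tau>) 1 0 - form2 (\<lambda>i j. h i j \<tau>) 0 1))"
      "h 3 0 = (\<lambda>\<tau>. form3 (\<lambda>i j. h i j \<tau>) 1 0)" "h 0 3 = (\<lambda>\<tau>. form3 (\<lambda>i j. h i j \<tau>) 0 1)"
      "h 2 1 = (\<lambda>\<tau>. (1/6) *\<^sub>R (form3 (\<lambda>i j. h i j \<tau>) 1 1 - form3 (\<lambda>i j. h i j \<tau>) 1 (-1) - 2 *\<^sub>R form3 (\<lambda>i j. h i j \<tau>) 0 1))"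
      "h 1 2 = (\<lambda>\<tau>. (1/6) *\<^sub>R (form3 (\<lambda>i j. h i j \<tau>) 1 1 + form3 (\<lambda>i j. h i j \<tau>) 1 (-1) - 2 *\<^sub>R form3 (\<lambda>i j. h i j \<tau>) 1 0))"
      by (rule ext, rule c2 c3)+
    have "h 2 0 differentiable (at \<tau>)" "h 0 2 differentiable (at \<tau>)" "h 1 1 differentiable (at \<tau>)"
      "h 3 0 differentiable (at \<tau>)" "h 0 3 differentiable (at \<tau>)"
      "h 2 1 differentiable (at \<tau>)" "h 1 2 differentiable (at \<tau>)"
      by (subst c, intro derivative_intros differentiable_diff differentiable_add form2_diff form3_diff)+
    with ij have "h i j differentiable (at \<tau>)"
      unfolding sum_degree_2 sum_degree_3 by auto
    then show ?thesis
      by (simp add: dh_def vector_derivative_works)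
  qed
  have E_eq: "E \<tau> \<eta> = form2 (\<lambda>i j. dh i j \<tau>) (\<eta> $ 1) (\<eta> $ 2)" for \<tau> \<eta>
  proof (rule vector_derivative_unique_at[OF E])
    show "((\<lambda>\<tau>. form2 (\<lambda>i j. h i j \<tau>) (\<eta> $ 1) (\<eta> $ 2)) has_vector_derivative
        form2 (\<lambda>i j. dh i j \<tau>) (\<eta> $ 1) (\<eta> $ 2)) (at \<tau>)"
      unfolding form2_def by (auto intro!: derivative_eq_intros dh)
  qed
  have G_eq: "G \<tau> \<eta> = form3 (\<lambda>i j. dh i j \<tau>) (\<eta> $ 1) (\<eta> $ 2)" for \<tau> \<eta>
  proof (rule vector_derivative_unique_at[OF G])
    show "((\<lambda>\<tau>. form3 (\<lambda>i j. h i j \<tau>) (\<eta> $ 1) (\<eta> $ 2)) has_vector_derivative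
        form3 (\<lambda>i j. dh i j \<tau>) (\<eta> $ 1) (\<eta> $ 2)) (at \<tau>)"
      unfolding form3_def by (auto intro!: derivative_eq_intros dh)
  qed
  \<comment> \<open>\<open>H\<close> and its first \<xi>-derivatives vanish at \<xi> = 0 for every
    \<tau>, hence so do their derivatives in \<tau>.\<close>
  have zero: "dderiv (1, 0) K (\<tau>, 0) = 0" "dderiv (0, \<eta>) (dderiv (1, 0) K) (\<tau>, 0) = 0" for \<tau> \<eta>
  proof -
    have const: "d = 0" if "((\<lambda>\<tau>. 0) has_vector_derivative d) (at \<tau>)" for d :: 'b and \<tau> :: real
      using vector_derivative_unique_at[OF that has_vector_derivative_const] .
    show "dderiv (1, 0) K (\<tau>, 0) = 0"
      using along[OF K4, of \<tau>] by (intro const[of _ \<tau>]) (simp add: coeffs)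
    have "dderiv (1, 0) (dderiv (0, \<eta>) K) (\<tau>, 0) = 0"
      using along[OF Ck_on_dderiv[OF K4], of "(0, \<eta>)" \<tau>] by (intro const[of _ \<tau>]) (simp add: coeffs)
    then show "dderiv (0, \<eta>) (dderiv (1, 0) K) (\<tau>, 0) = 0"
      by (simp add: dderiv_commute[OF K4 S])
  qed
  show ?thesis
  proof (rule that[OF dh])
    show "jet3 (\<lambda>s. dderiv (1, 0) K (\<tau>, s *\<^sub>R \<eta>)) 0 0
       ((1/2) *\<^sub>R form2 (\<lambda>i j. dh i j \<tau>) (\<eta> $ 1) (\<eta> $ 2)) ((1/6) *\<^sub>R form3 (\<lambda>i j. dh i j \<tau>) (\<eta> $ 1) (\<eta> $ 2))" for \<tau> \<eta>
      using jet3_on_ray[OF Ck_on_dderiv[OF K4[unfolded S_def]] \<delta>, of "(1, 0)" \<tau> \<eta>]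
      by (simp add: zero flip: E_eq G_eq) (simp add: E_def G_def)
  qed
qed

text \<open>Expanding the derivative of \<open>H\<close> along the first axis mixes this axis with
  the direction \<eta> of the ray, while the known forms have all directions equal. Moving \<eta> by
  plus and minus the axis vector isolates the terms in which the axis occurs once.\<close>

lemma taylor_coefficients_polarized:
  fixes H :: "real \<Rightarrow> real^2 \<Rightarrow> 'b::euclidean_space"
  defines "K \<equiv> (\<lambda>(\<tau>, \<xi>). H \<tau> \<xi>)"
  assumes K: "Ck_on (Suc (Suc (Suc (Suc k)))) K (UNIV \<times> ball 0 \<delta>)" and \<delta>: "\<delta> > 0"
    and bigo: "(\<lambda>\<xi>. norm (H \<tau> \<xi> -
               (\<Sum>(i, j) \<in> {(i, j). 2 \<le> i + j \<and> i + j \<le> 3}.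
                  (1 / (fact i * fact j) * (\<xi> $ 1)^i * (\<xi> $ 2)^j) *\<^sub>R h i j \<tau>)))
             \<in> O[at 0](\<lambda>\<xi>. norm \<xi> ^ 4)"
  shows "jet3 (\<lambda>s. dderiv (0, axis 1 1) K (\<tau>, s *\<^sub>R \<eta>)) 0
    ((\<eta> $ 1) *\<^sub>R h 2 0 \<tau> + (\<eta> $ 2) *\<^sub>R h 1 1 \<tau>)
    ((1/2) *\<^sub>R ((\<eta> $ 1)^2 *\<^sub>R h 3 0 \<tau> + (2 * \<eta> $ 1 * \<eta> $ 2) *\<^sub>R h 2 1 \<tau> + (\<eta> $ 2)^2 *\<^sub>R h 1 2 \<tau>))
    ((1/6) *\<^sub>R dderiv (0, \<eta>) (dderiv (0, \<eta>) (dderiv (0, \<eta>) (dderiv (0, axis 1 1) K))) (\<tau>, 0))"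
proof -
  define S where "S = (UNIV \<times> ball 0 \<delta> :: (real \<times> (real^2)) set)"
  have S: "open S" "(\<tau>, 0) \<in> S"
    using \<delta> by (auto simp: S_def intro: open_Times)
  note K4 = K[folded S_def]
  note K3 = Ck_on_SucD[OF K4] note K2 = Ck_on_SucD[OF K3]
  note coeffs = taylor_coefficients_on_ray[where k = k and H = H and h = h and \<tau> = \<tau> and \<delta> = \<delta>, folded K_def S_def, OF K3 \<delta> bigo]
  have ax: "(axis 1 1 :: real^2) $ 1 = 1" "(axis 1 1 :: real^2) $ 2 = 0"
    by (simp_all add: axis_def)
  have half: "(1/2) *\<^sub>R (2 *\<^sub>R u) = u" "(1/6) *\<^sub>R (6 *\<^sub>R u) = u" for u :: 'b by simp_all
  let ?p = "(0 :: real, \<eta>)" and ?q = "(0 :: real, axis 1 1 :: real^2)"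
  have "2 *\<^sub>R dderiv ?p (dderiv ?q K) (\<tau>, 0) =
      2 *\<^sub>R ((\<eta> $ 1) *\<^sub>R h 2 0 \<tau> + (\<eta> $ 2) *\<^sub>R h 1 1 \<tau>)"
    using dderiv2_add[OF K2 S, of ?p ?q]
    by (simp add: coeffs form2_def ax power2_eq_square algebra_simps scaleR_2)
  then have D2: "dderiv ?p (dderiv ?q K) (\<tau>, 0) = (\<eta> $ 1) *\<^sub>R h 2 0 \<tau> + (\<eta> $ 2) *\<^sub>R h 1 1 \<tau>"
    by (metis half(1))
  \<comment> \<open>\<open>X\<close> contains the axis once and \<open>Z\<close> twice. Reversing
    the axis changes the sign of \<open>X\<close> but not of \<open>Z\<close>, so the two expansions
    combine to \<open>6 *\<^sub>R X\<close>.\<close>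
  define X where "X = dderiv ?p (dderiv ?p (dderiv ?q K)) (\<tau>, 0)"
  define Z where "Z = dderiv ?p (dderiv ?q (dderiv ?q K)) (\<tau>, 0)"
  have nX: "dderiv ?p (dderiv ?p (dderiv (- ?q) K)) (\<tau>, 0) = - X"
    using linear_neg[OF linear_dderiv3_left[OF K3 S, of ?p ?p], of ?q] by (simp add: X_def)
  have nZ: "dderiv ?p (dderiv (- ?q) (dderiv (- ?q) K)) (\<tau>, 0) = Z"
    using linear_neg[OF linear_dderiv3_left[OF K3 S, of ?p "- ?q"], of ?q]
      linear_neg[OF linear_dderiv2_left[OF Ck_on_dderiv[OF K3, of ?q] S, of ?p], of ?q] by (simp add: Z_def)
  have nq: "- ?q = (0, - axis 1 1)" by simp
  have "(3 *\<^sub>R X + 3 *\<^sub>R Z) + (3 *\<^sub>R X - 3 *\<^sub>R Z) =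
      6 *\<^sub>R ((\<eta> $ 1)^2 *\<^sub>R h 3 0 \<tau> + (2 * \<eta> $ 1 * \<eta> $ 2) *\<^sub>R h 2 1 \<tau> + (\<eta> $ 2)^2 *\<^sub>R h 1 2 \<tau>)"
  proof -
    let ?f = "form3 (\<lambda>i j. h i j \<tau>)"
    have 1: "3 *\<^sub>R X + 3 *\<^sub>R Z = ?f (\<eta> $ 1 + 1) (\<eta> $ 2) - ?f (\<eta> $ 1) (\<eta> $ 2) - ?f 1 0"
      using dderiv3_add[OF K3 S, of ?p ?q, folded X_def Z_def]
      by (simp add: coeffs ax)
    have 2: "3 *\<^sub>R X - 3 *\<^sub>R Z = - ?f (\<eta> $ 1 - 1) (\<eta> $ 2) + ?f (\<eta> $ 1) (\<eta> $ 2) + ?f (-1) 0"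
      using dderiv3_add[OF K3 S, of ?p "- ?q", unfolded nX nZ] unfolding nq
      by (simp add: coeffs ax algebra_simps)
    have "?f (\<eta> $ 1 + 1) (\<eta> $ 2) - ?f (\<eta> $ 1) (\<eta> $ 2) - ?f 1 0 +
        (- ?f (\<eta> $ 1 - 1) (\<eta> $ 2) + ?f (\<eta> $ 1) (\<eta> $ 2) + ?f (-1) 0) =
      ((\<eta> $ 1 + 1)^3 - (\<eta> $ 1 - 1)^3 - 2) *\<^sub>R h 3 0 \<tau> +
      (3 * (\<eta> $ 1 + 1)^2 * \<eta> $ 2 - 3 * (\<eta> $ 1 - 1)^2 * \<eta> $ 2) *\<^sub>R h 2 1 \<tau> +
      (3 * (\<eta> $ 1 + 1) * (\<eta> $ 2)^2 - 3 * (\<eta> $ 1 - 1) * (\<eta> $ 2)^2) *\<^sub>R h 1 2 \<tau>"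
      by (simp add: form3_def scaleR_left_diff_distrib scaleR_2)
    also have "(\<eta> $ 1 + 1)^3 - (\<eta> $ 1 - 1)^3 - 2 = 6 * (\<eta> $ 1)^2"
      by (simp add: power2_eq_square power3_eq_cube algebra_simps)
    also have "3 * (\<eta> $ 1 + 1)^2 * \<eta> $ 2 - 3 * (\<eta> $ 1 - 1)^2 * \<eta> $ 2 = 6 * (2 * \<eta> $ 1 * \<eta> $ 2)"
      by (simp add: power2_eq_square algebra_simps)
    also have "3 * (\<eta> $ 1 + 1) * (\<eta> $ 2)^2 - 3 * (\<eta> $ 1 - 1) * (\<eta> $ 2)^2 = 6 * (\<eta> $ 2)^2"
      by (simp add: algebra_simps)
    finally show ?thesis
      unfolding 1 2 by (simp only: scaleR_add_right scaleR_scaleR)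
  qed
  also have "(3 *\<^sub>R X + 3 *\<^sub>R Z) + (3 *\<^sub>R X - 3 *\<^sub>R Z) = 6 *\<^sub>R X"
    using scaleR_left_distrib[of 3 3 X] by simp
  finally have D3: "X = (\<eta> $ 1)^2 *\<^sub>R h 3 0 \<tau> + (2 * \<eta> $ 1 * \<eta> $ 2) *\<^sub>R h 2 1 \<tau> + (\<eta> $ 2)^2 *\<^sub>R h 1 2 \<tau>"
    by (metis half(2))
  show ?thesis
    using jet3_on_ray[OF Ck_on_dderiv[OF K] \<delta>, of ?q \<tau> \<eta>]
    unfolding coeffs(2) D2 D3[symmetric] X_def .
qed

section \<open>The homological equation on rays, order by order\<close>

lemma jet3_scaleR: "jet3 f a0 a1 a2 a3 \<Longrightarrow> jet3 (\<lambda>s. r *\<^sub>R f s) (r *\<^sub>R a0) (r *\<^sub>R a1) (r *\<^sub>R a2) (r *\<^sub>R a3)"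
  by (rule jet3_linear[OF bounded_linear_scaleR_right])

lemma jet3_affine_plus:
  assumes "jet3 f 0 a1 a2 a3"
  shows "jet3 (\<lambda>s. c + s *\<^sub>R d + f s) c (d + a1) a2 a3"
  using jet3_add[OF jet3_add[OF jet3_const[of c] jet3_times_s[OF jet3_const[of d]]] assms] by simp

lemma homological_equation_jets:
  fixes F :: "real^'n \<Rightarrow> real^'n" and H :: "real \<Rightarrow> real^2 \<Rightarrow> real^'n"
  defines "K \<equiv> (\<lambda>(\<tau>, \<xi>). H \<tau> \<xi>)"
  assumes u0: "(u0 has_vector_derivative du) (at \<tau>)" and v1: "(v1 has_vector_derivative dv1) (at \<tau>)"
    and v2: "(v2 has_vector_derivative dv2) (at \<tau>)"
    and F: "Ck_on (Suc (Suc (Suc l))) F UNIV"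
    and K: "Ck_on 4 K (UNIV \<times> ball 0 \<delta>)" and \<delta>: "\<delta> > 0"
    and bigo: "(\<lambda>\<xi>. norm (H \<tau> \<xi> -
               (\<Sum>(i, j) \<in> {(i, j). 2 \<le> i + j \<and> i + j \<le> 3}.
                  (1 / (fact i * fact j) * (\<xi> $ 1)^i * (\<xi> $ 2)^j) *\<^sub>R h i j \<tau>)))
             \<in> O[at 0](\<lambda>\<xi>. norm \<xi> ^ 4)"
    and dh: "jet3 (\<lambda>s. dderiv (1, 0) K (\<tau>, s *\<^sub>R \<eta>)) 0 0
       ((1/2) *\<^sub>R form2 (\<lambda>i j. dh i j) (\<eta> $ 1) (\<eta> $ 2)) ((1/6) *\<^sub>R form3 (\<lambda>i j. dh i j) (\<eta> $ 1) (\<eta> $ 2))"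
    and R: "higher_order_term T \<delta> R0" "higher_order_term T \<delta> R1" "higher_order_term T \<delta> R2"
    and inv: "\<forall>\<tau> \<xi> r s. (\<forall>t\<in>{r<..<s}. \<xi> t \<in> ball 0 \<delta>) \<and>
           solves_R2_normal_form \<alpha> a b R0 R1 R2 \<tau> \<xi> {r<..<s} \<longrightarrow>
           (\<forall>t\<in>{r<..<s}.
              ((\<lambda>t. cm_param u0 v1 v2 H (\<tau> t) (\<xi> t)) has_vector_derivative
                 F (cm_param u0 v1 v2 H (\<tau> t) (\<xi> t))) (at t))"
    and \<eta>: "\<eta> \<noteq> 0"
  defines "x \<equiv> \<eta> $ 1" and "y \<equiv> \<eta> $ 2"
  defines "w \<equiv> x *\<^sub>R v1 \<tau> + y *\<^sub>R v2 \<tau>"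
  defines "P2 \<equiv> form2 (\<lambda>i j. h i j \<tau>) x y" and "P3 \<equiv> form3 (\<lambda>i j. h i j \<tau>) x y"
  shows "(1/2) *\<^sub>R form2 dh x y + (\<alpha> * x^2) *\<^sub>R du + y *\<^sub>R (x *\<^sub>R h 2 0 \<tau> + y *\<^sub>R h 1 1 \<tau>) =
      (1/2) *\<^sub>R (deriv2 F (u0 \<tau>) w w + dderiv P2 F (u0 \<tau>))"
    and "(1/6) *\<^sub>R form3 dh x y + (\<alpha> * x^2) *\<^sub>R (x *\<^sub>R dv1 + y *\<^sub>R dv2) +
      y *\<^sub>R ((1/2) *\<^sub>R (x^2 *\<^sub>R h 3 0 \<tau> + (2 * x * y) *\<^sub>R h 2 1 \<tau> + y^2 *\<^sub>R h 1 2 \<tau>) + (\<alpha> * x^2) *\<^sub>R v1 \<tau>) +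
      (a * x^3 + b * x^2 * y) *\<^sub>R v2 \<tau> =
      (1/6) *\<^sub>R (deriv3 F (u0 \<tau>) w w w + 3 *\<^sub>R deriv2 F (u0 \<tau>) w P2 + dderiv P3 F (u0 \<tau>))"
proof -
  define S where "S = (UNIV \<times> ball 0 \<delta> :: (real \<times> (real^2)) set)"
  have K4: "Ck_on (Suc (Suc (Suc (Suc 0)))) K S"
    using K by (simp add: S_def numeral_eq_Suc del: Ck_on.simps)
  note K4' = K4[unfolded S_def]
  note K3 = Ck_on_SucD[OF K4]
  note coeffs = taylor_coefficients_on_ray[where k = 0 and H = H and h = h and \<tau> = \<tau> and \<delta> = \<delta>, folded K_def, OF K3[unfolded S_def] \<delta> bigo]
  define U where "U s = du + s *\<^sub>R (x *\<^sub>R dv1 + y *\<^sub>R dv2) + dderiv (1, 0) K (\<tau>, s *\<^sub>R \<eta>)" for s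
  define V where "V s = v1 \<tau> + dderiv (0, axis 1 1) K (\<tau>, s *\<^sub>R \<eta>)" for s
  define W where "W s = v2 \<tau> + dderiv (0, axis 2 1) K (\<tau>, s *\<^sub>R \<eta>)" for s
  obtain V3 where V: "jet3 V (v1 \<tau>) (x *\<^sub>R h 2 0 \<tau> + y *\<^sub>R h 1 1 \<tau>)
      ((1/2) *\<^sub>R (x^2 *\<^sub>R h 3 0 \<tau> + (2 * x * y) *\<^sub>R h 2 1 \<tau> + y^2 *\<^sub>R h 1 2 \<tau>)) V3"
    using jet3_add[OF jet3_const[of "v1 \<tau>"] taylor_coefficients_polarized[where H = H and \<delta> = \<delta> and h = h and \<tau> = \<tau> and \<eta> = \<eta>, folded K_def, OF K4' \<delta> bigo]]
    by (simp add: V_def [abs_def] x_def y_def)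
  \<comment> \<open>The velocity of the second component of \<xi> starts at order \<open>s^3\<close>
    on the ray, so of the expansion of \<open>W\<close> only the value \<open>v2 \<tau>\<close>
    reaches third order.\<close>
  obtain W1 W2 W3 where W: "jet3 W (v2 \<tau>) W1 W2 W3"
    using jet3_add[OF jet3_const[of "v2 \<tau>"] jet3_on_ray[OF Ck_on_dderiv[OF K4'] \<delta>, of "(0, axis 2 1)" \<tau> \<eta>]]
    by (simp add: W_def [abs_def] coeffs)
  have U: "jet3 U du (x *\<^sub>R dv1 + y *\<^sub>R dv2) ((1/2) *\<^sub>R form2 dh x y) ((1/6) *\<^sub>R form3 dh x y)"
    using jet3_affine_plus[OF dh, of du "x *\<^sub>R dv1 + y *\<^sub>R dv2"]
    by (simp add: U_def [abs_def] x_def y_def)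
  have neg: "jet3 (\<lambda>s. R \<tau> (s *\<^sub>R \<eta>) *\<^sub>R f s) 0 0 0 0"
    if "higher_order_term T \<delta> R" "jet3 f f0 f1 f2 f3"
    for R :: "real \<Rightarrow> real^2 \<Rightarrow> real" and f :: "real \<Rightarrow> real^'n" and f0 f1 f2 f3
  proof -
    have "R \<tau> \<in> O[at 0](\<lambda>\<xi>. norm \<xi> ^ 4)"
      using that(1) by (simp add: higher_order_term_def)
    from bigo_norm4_on_ray[OF this \<eta>] obtain M where "\<forall>\<^sub>F s in at 0. \<bar>R \<tau> (s *\<^sub>R \<eta>)\<bar> \<le> M * s^4" .
    then have "jet3 (\<lambda>s. R \<tau> (s *\<^sub>R \<eta>)) 0 0 0 0"
      by (intro jet3_of_bound[where M = M]) simp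
    then show ?thesis
      by (rule jet3_negligible_mult[OF _ jet3_tendsto[OF that(2)]])
  qed
  \<comment> \<open>The powers of \<open>s\<close> carried by \<xi> are written as repeated factors,
    each of which shifts the coefficients by \<open>jet3_times_s\<close>.\<close>
  let ?L = "\<lambda>s. U s + (\<alpha> * x^2) *\<^sub>R (s *\<^sub>R s *\<^sub>R U s) + y *\<^sub>R (s *\<^sub>R V s + (\<alpha> * x^2) *\<^sub>R (s *\<^sub>R s *\<^sub>R s *\<^sub>R V s)) +
      (a * x^3 + b * x^2 * y) *\<^sub>R (s *\<^sub>R s *\<^sub>R s *\<^sub>R W s) +
      (R0 \<tau> (s *\<^sub>R \<eta>) *\<^sub>R U s + R1 \<tau> (s *\<^sub>R \<eta>) *\<^sub>R V s + R2 \<tau> (s *\<^sub>R \<eta>) *\<^sub>R W s)"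
  let ?g = "\<lambda>s. cm_param u0 v1 v2 H \<tau> (s *\<^sub>R \<eta>)"
  have "((\<lambda>s. s *\<^sub>R \<eta>) \<longlongrightarrow> 0 *\<^sub>R \<eta>) (nhds 0)"
    by (intro tendsto_intros) (simp add: filterlim_ident)
  then have ev: "\<forall>\<^sub>F s in nhds (0::real). s *\<^sub>R \<eta> \<in> ball 0 \<delta>"
    by (rule topological_tendstoD) (use \<delta> in auto)
  have L_jet: "jet3 ?L du ((x *\<^sub>R dv1 + y *\<^sub>R dv2) + y *\<^sub>R v1 \<tau>)
     ((1/2) *\<^sub>R form2 dh x y + (\<alpha> * x^2) *\<^sub>R du + y *\<^sub>R (x *\<^sub>R h 2 0 \<tau> + y *\<^sub>R h 1 1 \<tau>))
     ((1/6) *\<^sub>R form3 dh x y + (\<alpha> * x^2) *\<^sub>R (x *\<^sub>R dv1 + y *\<^sub>R dv2) +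
      y *\<^sub>R ((1/2) *\<^sub>R (x^2 *\<^sub>R h 3 0 \<tau> + (2 * x * y) *\<^sub>R h 2 1 \<tau> + y^2 *\<^sub>R h 1 2 \<tau>) + (\<alpha> * x^2) *\<^sub>R v1 \<tau>) +
      (a * x^3 + b * x^2 * y) *\<^sub>R v2 \<tau>)"
    using jet3_add[OF jet3_add[OF jet3_add[OF
        jet3_add[OF U jet3_scaleR[OF jet3_times_s[OF jet3_times_s[OF U]], of "\<alpha> * x^2"]]
        jet3_scaleR[OF jet3_add[OF jet3_times_s[OF V]
          jet3_scaleR[OF jet3_times_s[OF jet3_times_s[OF jet3_times_s[OF V]]], of "\<alpha> * x^2"]], of y]]
        jet3_scaleR[OF jet3_times_s[OF jet3_times_s[OF jet3_times_s[OF W]]], of "a * x^3 + b * x^2 * y"]]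
        jet3_add[OF jet3_add[OF neg[OF R(1) U] neg[OF R(2) V]] neg[OF R(3) W]]]
    by (simp only: scaleR_zero_right add_0_right add_0_left)
  moreover have "\<forall>\<^sub>F s in at 0. ?L s = F (?g s)"
  proof -
    have "?L s = F (?g s)" if "s *\<^sub>R \<eta> \<in> ball 0 \<delta>" for s
      using homological_equation[where H = H, folded K_def, OF u0 v1 v2 K4' _ _ _ inv that] R
      by (simp add: higher_order_term_def U_def V_def W_def x_def [symmetric] y_def [symmetric]
          del: Ck_on.simps One_nat_def)
        (simp add: algebra_simps power2_eq_square power3_eq_cube)
    then show ?thesis
      using eventually_mono[OF ev] by (auto simp: eventually_nhds_conv_at)
  qed
  ultimately have L: "jet3 (\<lambda>s. F (?g s)) du ((x *\<^sub>R dv1 + y *\<^sub>R dv2) + y *\<^sub>R v1 \<tau>)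
     ((1/2) *\<^sub>R form2 dh x y + (\<alpha> * x^2) *\<^sub>R du + y *\<^sub>R (x *\<^sub>R h 2 0 \<tau> + y *\<^sub>R h 1 1 \<tau>))
     ((1/6) *\<^sub>R form3 dh x y + (\<alpha> * x^2) *\<^sub>R (x *\<^sub>R dv1 + y *\<^sub>R dv2) +
      y *\<^sub>R ((1/2) *\<^sub>R (x^2 *\<^sub>R h 3 0 \<tau> + (2 * x * y) *\<^sub>R h 2 1 \<tau> + y^2 *\<^sub>R h 1 2 \<tau>) + (\<alpha> * x^2) *\<^sub>R v1 \<tau>) +
      (a * x^3 + b * x^2 * y) *\<^sub>R v2 \<tau>)"
    by (rule jet3_cong)
  have curve: "((\<lambda>s. f (\<tau>, s *\<^sub>R \<eta>)) has_vector_derivative dderiv (0, \<eta>) f (\<tau>, s *\<^sub>R \<eta>)) (at s)"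
    if "Ck_on (Suc j) f (UNIV \<times> ball 0 \<delta>)" "s *\<^sub>R \<eta> \<in> ball 0 \<delta>" for f :: "real \<times> (real^2) \<Rightarrow> real^'n" and j s
    by (rule dderiv_along_curve[where g = "\<lambda>s. (\<tau>, s *\<^sub>R \<eta>)", OF Ck_on_differentiable[OF that(1)]])
      (use that(2) in \<open>auto intro!: derivative_eq_intros has_vector_derivative_Pair\<close>)
  have g: "?g s = u0 \<tau> + s *\<^sub>R w + K (\<tau>, s *\<^sub>R \<eta>)" for s
    by (simp add: cm_param_def K_def w_def x_def y_def algebra_simps)
  have "\<forall>\<^sub>F s in nhds 0. (?g has_vector_derivative w + dderiv (0, \<eta>) K (\<tau>, s *\<^sub>R \<eta>)) (at s)"
    using ev unfolding g by eventually_elim (auto intro!: derivative_eq_intros curve[OF K4'])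
  moreover have "\<forall>\<^sub>F s in nhds 0. ((\<lambda>s. w + dderiv (0, \<eta>) K (\<tau>, s *\<^sub>R \<eta>)) has_vector_derivative
      dderiv (0, \<eta>) (dderiv (0, \<eta>) K) (\<tau>, s *\<^sub>R \<eta>)) (at s)"
    using ev by eventually_elim (auto intro!: derivative_eq_intros curve[OF Ck_on_dderiv[OF K4']])
  moreover have "((\<lambda>s. dderiv (0, \<eta>) (dderiv (0, \<eta>) K) (\<tau>, s *\<^sub>R \<eta>)) has_vector_derivative P3) (at 0)"
    using curve[OF Ck_on_dderiv[OF Ck_on_dderiv[OF K4', of "(0, \<eta>)"], of "(0, \<eta>)"], of 0] \<delta> by (simp add: coeffs P3_def x_def y_def)
  ultimately have "jet3 (\<lambda>s. F (?g s)) (F (u0 \<tau>)) (dderiv w F (u0 \<tau>))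
     ((1/2) *\<^sub>R (deriv2 F (u0 \<tau>) w w + dderiv P2 F (u0 \<tau>)))
     ((1/6) *\<^sub>R (deriv3 F (u0 \<tau>) w w w + 3 *\<^sub>R deriv2 F (u0 \<tau>) w P2 + dderiv P3 F (u0 \<tau>)))"
    using jet3_compose[OF F] by (fastforce simp: coeffs g P2_def x_def y_def)
  \<comment> \<open>Orders 0 and 1 would only restate the equations of \<open>u0\<close>,
    \<open>v1\<close> and \<open>v2\<close>; the new information lies in orders 2 and 3.\<close>
  from jet3_unique(3,4)[OF L this]
  show "(1/2) *\<^sub>R form2 dh x y + (\<alpha> * x^2) *\<^sub>R du + y *\<^sub>R (x *\<^sub>R h 2 0 \<tau> + y *\<^sub>R h 1 1 \<tau>) =
      (1/2) *\<^sub>R (deriv2 F (u0 \<tau>) w w + dderiv P2 F (u0 \<tau>))"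
    and "(1/6) *\<^sub>R form3 dh x y + (\<alpha> * x^2) *\<^sub>R (x *\<^sub>R dv1 + y *\<^sub>R dv2) +
      y *\<^sub>R ((1/2) *\<^sub>R (x^2 *\<^sub>R h 3 0 \<tau> + (2 * x * y) *\<^sub>R h 2 1 \<tau> + y^2 *\<^sub>R h 1 2 \<tau>) + (\<alpha> * x^2) *\<^sub>R v1 \<tau>) +
      (a * x^3 + b * x^2 * y) *\<^sub>R v2 \<tau> =
      (1/6) *\<^sub>R (deriv3 F (u0 \<tau>) w w w + 3 *\<^sub>R deriv2 F (u0 \<tau>) w P2 + dderiv P3 F (u0 \<tau>))" .
qed

text \<open>Both hypotheses compare polynomials in \<open>x\<close> and \<open>y\<close>; their
  coefficients are separated by evaluation at \<open>(1, 0)\<close>, \<open>(0, 1)\<close>,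
  \<open>(1, 1)\<close> and \<open>(1, -1)\<close>.\<close>

lemma coefficient_equations:
  fixes F :: "real^'n \<Rightarrow> real^'n" and c dc :: "nat \<Rightarrow> nat \<Rightarrow> real^'n"
  assumes F: "Ck_on (Suc (Suc (Suc l))) F UNIV"
    and E2: "\<And>x y. x \<noteq> 0 \<or> y \<noteq> 0 \<Longrightarrow>
      (1/2) *\<^sub>R form2 dc x y + (\<alpha> * x^2) *\<^sub>R du + y *\<^sub>R (x *\<^sub>R c 2 0 + y *\<^sub>R c 1 1) =
      (1/2) *\<^sub>R (deriv2 F u (x *\<^sub>R p + y *\<^sub>R q) (x *\<^sub>R p + y *\<^sub>R q) + dderiv (form2 c x y) F u)"
    and E3: "\<And>x y. x \<noteq> 0 \<or> y \<noteq> 0 \<Longrightarrow>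
      (1/6) *\<^sub>R form3 dc x y + (\<alpha> * x^2) *\<^sub>R (x *\<^sub>R dp + y *\<^sub>R dq) +
      y *\<^sub>R ((1/2) *\<^sub>R (x^2 *\<^sub>R c 3 0 + (2 * x * y) *\<^sub>R c 2 1 + y^2 *\<^sub>R c 1 2) + (\<alpha> * x^2) *\<^sub>R p) +
      (a * x^3 + b * x^2 * y) *\<^sub>R q =
      (1/6) *\<^sub>R (deriv3 F u (x *\<^sub>R p + y *\<^sub>R q) (x *\<^sub>R p + y *\<^sub>R q) (x *\<^sub>R p + y *\<^sub>R q) +
        3 *\<^sub>R deriv2 F u (x *\<^sub>R p + y *\<^sub>R q) (form2 c x y) + dderiv (form3 c x y) F u)"
  shows "dc 2 0 = dderiv (c 2 0) F u + deriv2 F u p p - (2 * \<alpha>) *\<^sub>R du"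
    and "dc 1 1 = dderiv (c 1 1) F u + deriv2 F u p q - c 2 0"
    and "dc 0 2 = dderiv (c 0 2) F u + deriv2 F u q q - 2 *\<^sub>R c 1 1"
    and "dc 3 0 = dderiv (c 3 0) F u + deriv3 F u p p p + 3 *\<^sub>R deriv2 F u p (c 2 0) - (6 * \<alpha>) *\<^sub>R dp - (6 * a) *\<^sub>R q"
    and "dc 2 1 = dderiv (c 2 1) F u + deriv3 F u p p q + deriv2 F u (c 2 0) q + 2 *\<^sub>R deriv2 F u (c 1 1) p
      - (2 * \<alpha>) *\<^sub>R (dq + p) - c 3 0 - (2 * b) *\<^sub>R q"
proof -
  note F1 = Ck_on_dderiv[OF F] note U = open_UNIV UNIV_I
  have lA: "linear (\<lambda>v. dderiv v F u)"
    by (rule linear_dderiv[OF Ck_on_differentiable[OF F UNIV_I]])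
  have lB1: "linear (\<lambda>v. deriv2 F u v w)" and lB2: "linear (\<lambda>v. deriv2 F u w v)" for w
    unfolding deriv2_dderiv
    by (rule linear_dderiv2_left[OF F U], rule linear_dderiv[OF Ck_on_differentiable[OF F1 UNIV_I]])
  have lC1: "linear (\<lambda>v. deriv3 F u v w z)" and lC2: "linear (\<lambda>v. deriv3 F u w v z)"
    and lC3: "linear (\<lambda>v. deriv3 F u w z v)" for w z
    unfolding deriv3_dderiv
    by (rule linear_dderiv3_left[OF F U], rule linear_dderiv2_left[OF F1 U],
        rule linear_dderiv[OF Ck_on_differentiable[OF Ck_on_dderiv[OF F1] UNIV_I]])
  have Bsym: "deriv2 F u v w = deriv2 F u w v" for v w
    unfolding deriv2_dderiv by (rule dderiv_commute[OF F U])
  have Csym12: "deriv3 F u v w z = deriv3 F u w v z" for v w z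
    unfolding deriv3_dderiv by (rule dderiv_commute_inner[OF F U])
  have Csym23: "deriv3 F u v w z = deriv3 F u v z w" for v w z
    unfolding deriv3_dderiv by (rule dderiv_commute[OF F1 U])
  have C: "deriv3 F u q p p = deriv3 F u p p q" "deriv3 F u p q p = deriv3 F u p p q"
    "deriv3 F u q p q = deriv3 F u p q q" "deriv3 F u q q p = deriv3 F u p q q"
    using Csym12 Csym23 by metis+
  note expand = linear_add[OF lA] linear_diff[OF lA] linear_scale[OF lA] linear_neg[OF lA]
    linear_add[OF lB1] linear_diff[OF lB1] linear_scale[OF lB1] linear_neg[OF lB1]
    linear_add[OF lB2] linear_diff[OF lB2] linear_scale[OF lB2] linear_neg[OF lB2]
    linear_add[OF lC1] linear_diff[OF lC1] linear_scale[OF lC1] linear_neg[OF lC1]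
    linear_add[OF lC2] linear_diff[OF lC2] linear_scale[OF lC2] linear_neg[OF lC2]
    linear_add[OF lC3] linear_diff[OF lC3] linear_scale[OF lC3] linear_neg[OF lC3]
  \<comment> \<open>In each component the separation is linear arithmetic over the reals.\<close>
  note e = arg_cong[where f = "\<lambda>v :: real^'n. v $ i" for i]
  note e2 = e[OF E2] note e3 = e[OF E3]
  have "dc 2 0 $ i = (dderiv (c 2 0) F u + deriv2 F u p p - (2 * \<alpha>) *\<^sub>R du) $ i" for i
    using e2[of 1 0 i] by (simp add: form2_def)
  then show "dc 2 0 = dderiv (c 2 0) F u + deriv2 F u p p - (2 * \<alpha>) *\<^sub>R du"
    by (intro vec_eq_iff[THEN iffD2] allI)
  have c02: "dc 0 2 $ i = (dderiv (c 0 2) F u + deriv2 F u q q - 2 *\<^sub>R c 1 1) $ i" for i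
    using e2[of 0 1 i] by (simp add: form2_def)
  then show "dc 0 2 = dderiv (c 0 2) F u + deriv2 F u q q - 2 *\<^sub>R c 1 1"
    by (intro vec_eq_iff[THEN iffD2] allI)
  have "dc 1 1 $ i = (dderiv (c 1 1) F u + deriv2 F u p q - c 2 0) $ i" for i
    using e2[of 1 0 i] e2[of 0 1 i] e2[of 1 1 i]
    by (simp add: form2_def expand Bsym[of q p]) (simp add: field_simps)
  then show "dc 1 1 = dderiv (c 1 1) F u + deriv2 F u p q - c 2 0"
    by (intro vec_eq_iff[THEN iffD2] allI)
  have "dc 3 0 $ i = (dderiv (c 3 0) F u + deriv3 F u p p p + 3 *\<^sub>R deriv2 F u p (c 2 0) - (6 * \<alpha>) *\<^sub>R dp - (6 * a) *\<^sub>R q) $ i" for i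
    using e3[of 1 0 i] by (simp add: form2_def form3_def)
  then show "dc 3 0 = dderiv (c 3 0) F u + deriv3 F u p p p + 3 *\<^sub>R deriv2 F u p (c 2 0) - (6 * \<alpha>) *\<^sub>R dp - (6 * a) *\<^sub>R q"
    by (intro vec_eq_iff[THEN iffD2] allI)
  \<comment> \<open>The difference of the values at \<open>(1, 1)\<close> and \<open>(1, -1)\<close>
    keeps the odd powers of \<open>y\<close>; the value at \<open>(0, 1)\<close> removes the
    \<open>y^3\<close> terms, and the \<open>x^2 * y\<close> terms remain.\<close>
  have "dc 2 1 $ i = (dderiv (c 2 1) F u + deriv3 F u p p q + deriv2 F u (c 2 0) q + 2 *\<^sub>R deriv2 F u (c 1 1) p
      - (2 * \<alpha>) *\<^sub>R (dq + p) - c 3 0 - (2 * b) *\<^sub>R q) $ i" for i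
    using e3[of 1 1 i] e3[of 1 "-1" i] e3[of 0 1 i]
    by (simp add: form2_def form3_def expand C Bsym[of "c 2 0" q] Bsym[of "c (Suc 0) (Suc 0)" p]) (simp add: field_simps)
  then show "dc 2 1 = dderiv (c 2 1) F u + deriv3 F u p p q + deriv2 F u (c 2 0) q + 2 *\<^sub>R deriv2 F u (c 1 1) p
      - (2 * \<alpha>) *\<^sub>R (dq + p) - c 3 0 - (2 * b) *\<^sub>R q"
    by (intro vec_eq_iff[THEN iffD2] allI)
qed

text \<open>The symmetry couples the shift by \<open>T\<close> with a reflection of \<xi>, which
  preserves quadratic forms and reverses cubic ones.\<close>

lemma taylor_coefficients_shift:
  fixes H :: "real \<Rightarrow> real^2 \<Rightarrow> 'b::euclidean_space"
  assumes K: "Ck_on (Suc (Suc (Suc k))) (\<lambda>(\<tau>, \<xi>). H \<tau> \<xi>) (UNIV \<times> ball 0 \<delta>)" and \<delta>: "\<delta> > 0"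
    and bigo: "\<And>\<tau>. (\<lambda>\<xi>. norm (H \<tau> \<xi> -
               (\<Sum>(i, j) \<in> {(i, j). 2 \<le> i + j \<and> i + j \<le> 3}.
                  (1 / (fact i * fact j) * (\<xi> $ 1)^i * (\<xi> $ 2)^j) *\<^sub>R h i j \<tau>)))
             \<in> O[at 0](\<lambda>\<xi>. norm \<xi> ^ 4)"
    and sym: "\<And>\<xi>. \<xi> \<in> ball 0 \<delta> \<Longrightarrow> H (\<tau> + T) (- \<xi>) = H \<tau> \<xi>"
  shows "h 2 0 (\<tau> + T) = h 2 0 \<tau>" "h 1 1 (\<tau> + T) = h 1 1 \<tau>" "h 0 2 (\<tau> + T) = h 0 2 \<tau>"
    "h 3 0 (\<tau> + T) = - h 3 0 \<tau>" "h 2 1 (\<tau> + T) = - h 2 1 \<tau>"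
proof -
  let ?K = "\<lambda>(\<tau>, \<xi>). H \<tau> \<xi>"
  have jet: "jet3 (\<lambda>s. H \<tau> (s *\<^sub>R \<eta>)) 0 0 ((1/2) *\<^sub>R form2 (\<lambda>i j. h i j \<tau>) (\<eta> $ 1) (\<eta> $ 2))
      ((1/6) *\<^sub>R form3 (\<lambda>i j. h i j \<tau>) (\<eta> $ 1) (\<eta> $ 2))" for \<eta> \<tau>
    using jet3_on_ray[OF K \<delta>, of \<tau> \<eta>]
      taylor_coefficients_on_ray[where H = H and h = h and \<tau> = \<tau> and \<delta> = \<delta>, OF K \<delta> bigo]
    by simp
  have eq: "form2 (\<lambda>i j. h i j (\<tau> + T)) (- x) (- y) = form2 (\<lambda>i j. h i j \<tau>) x y"
    "form3 (\<lambda>i j. h i j (\<tau> + T)) (- x) (- y) = form3 (\<lambda>i j. h i j \<tau>) x y" for x y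
  proof -
    let ?\<eta> = "vector [x, y] :: real^2"
    have "((\<lambda>s. s *\<^sub>R ?\<eta>) \<longlongrightarrow> 0 *\<^sub>R ?\<eta>) (at 0)"
      by (intro tendsto_intros)
    then have "\<forall>\<^sub>F s in at (0::real). s *\<^sub>R ?\<eta> \<in> ball 0 \<delta>"
      by (rule topological_tendstoD) (use \<delta> in auto)
    then have ev: "\<forall>\<^sub>F s in at 0. H (\<tau> + T) (s *\<^sub>R (- ?\<eta>)) = H \<tau> (s *\<^sub>R ?\<eta>)"
      by eventually_elim (simp add: sym)
    note u = jet3_unique[OF jet3_cong[OF jet[of "\<tau> + T" "- ?\<eta>"] ev] jet[of \<tau> ?\<eta>]]
    show "form2 (\<lambda>i j. h i j (\<tau> + T)) (- x) (- y) = form2 (\<lambda>i j. h i j \<tau>) x y"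
      "form3 (\<lambda>i j. h i j (\<tau> + T)) (- x) (- y) = form3 (\<lambda>i j. h i j \<tau>) x y"
      using u(3,4) by simp_all
  qed
  have "form2 (\<lambda>i j. h i j (\<tau> + T)) x y = form2 (\<lambda>i j. h i j \<tau>) x y" for x y
    using eq(1)[of x y] by (simp add: form2_def)
  note c = coeff_of_form2[of "\<lambda>i j. h i j (\<tau> + T)", unfolded this] coeff_of_form2[of "\<lambda>i j. h i j \<tau>"]
  show "h 2 0 (\<tau> + T) = h 2 0 \<tau>" "h 1 1 (\<tau> + T) = h 1 1 \<tau>" "h 0 2 (\<tau> + T) = h 0 2 \<tau>"
    by (simp_all only: c)
  have "form3 (\<lambda>i j. h i j (\<tau> + T)) x y = form3 (\<lambda>i j. - h i j \<tau>) x y" for x y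
    using eq(2)[of "- x" "- y"] by (simp add: form3_def)
  note c = coeff_of_form3[of "\<lambda>i j. h i j (\<tau> + T)", unfolded this] coeff_of_form3[of "\<lambda>i j. - h i j \<tau>"]
  show "h 3 0 (\<tau> + T) = - h 3 0 \<tau>" "h 2 1 (\<tau> + T) = - h 2 1 \<tau>"
    by (simp_all only: c)
qed

section \<open>Solvability conditions and the theorem\<close>

lemma adjoint_pairing_has_integral:
  fixes A :: "real \<Rightarrow> real^'n^'n"
  assumes "0 \<le> T"
    and \<phi>: "\<And>\<tau>. \<tau> \<in> {0..T} \<Longrightarrow> (\<phi> has_vector_derivative r \<tau> - transpose (A \<tau>) *v \<phi> \<tau>) (at \<tau> within {0..T})"
    and k: "\<And>\<tau>. \<tau> \<in> {0..T} \<Longrightarrow> (k has_vector_derivative A \<tau> *v k \<tau> + s \<tau>) (at \<tau> within {0..T})"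
    and bc: "\<phi> T \<bullet> k T = \<phi> 0 \<bullet> k 0"
  shows "((\<lambda>\<tau>. \<phi> \<tau> \<bullet> s \<tau> + r \<tau> \<bullet> k \<tau>) has_integral 0) {0..T}"
proof -
  \<comment> \<open>The fundamental theorem yields the existence of the integral together with its
    value, and so the integrability of the terms in \<open>B\<close> and \<open>C\<close> later on.
    The source \<open>r\<close> is 0 for \<open>\<phi>s\<close> and \<open>v1s\<close>, and it is
    \<open>v1s\<close> for \<open>v2s\<close>.\<close>
  have "((\<lambda>\<tau>. \<phi> \<tau> \<bullet> s \<tau> + r \<tau> \<bullet> k \<tau>) has_integral \<phi> T \<bullet> k T - \<phi> 0 \<bullet> k 0) {0..T}"
  proof (rule fundamental_theorem_of_calculus[OF assms(1)])
    fix \<tau> assume \<tau>: "\<tau> \<in> {0..T}"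
    show "((\<lambda>\<tau>. \<phi> \<tau> \<bullet> k \<tau>) has_vector_derivative \<phi> \<tau> \<bullet> s \<tau> + r \<tau> \<bullet> k \<tau>) (at \<tau> within {0..T})"
      using bounded_bilinear.has_vector_derivative[OF bounded_bilinear_inner \<phi>[OF \<tau>] k[OF \<tau>]]
      by (simp add: inner_add_right inner_diff_left dot_lmul_matrix flip: vector_transpose_matrix)
  qed
  then show ?thesis by (simp add: bc)
qed

theorem mainTheorem5:
  fixes F :: "real^'n \<Rightarrow> real^'n"
    and u0 v1 v2 \<phi>s v1s v2s :: "real \<Rightarrow> real^'n"
    and A Y :: "real \<Rightarrow> real^'n^'n"
    and B :: "real \<Rightarrow> real^'n \<Rightarrow> real^'n \<Rightarrow> real^'n"
    and C :: "real \<Rightarrow> real^'n \<Rightarrow> real^'n \<Rightarrow> real^'n \<Rightarrow> real^'n"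
    and H :: "real \<Rightarrow> real^2 \<Rightarrow> real^'n"
    and h :: "nat \<Rightarrow> nat \<Rightarrow> real \<Rightarrow> real^'n"
    and T \<alpha> a b :: real
  assumes F_smooth: "Ck_on 4 F UNIV"
    and cycle: "periodic_orbit F u0 T"
    and A: "A = (\<lambda>\<tau>. jacobian F (at (u0 \<tau>)))"
    and B: "B = (\<lambda>\<tau>. deriv2 F (u0 \<tau>))"
    and C: "C = (\<lambda>\<tau>. deriv3 F (u0 \<tau>))"
    and Y_ode: "\<forall>\<tau>\<in>{0..T}. (Y has_vector_derivative A \<tau> ** Y \<tau>) (at \<tau> within {0..T})"
    and Y_init: "Y 0 = mat 1"
    and R2: "R2_multipliers (Y T)"
    and v1_ode: "\<forall>\<tau>\<in>{0..T}. (v1 has_vector_derivative A \<tau> *v v1 \<tau>) (at \<tau> within {0..T})"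
    and v1_bc: "v1 T = - v1 0"
    and v1_norm: "integral {0..T} (\<lambda>\<tau>. v1 \<tau> \<bullet> v1 \<tau>) = 1"
    and v1_ext: "\<forall>\<tau>. v1 (\<tau> + T) = - v1 \<tau>"
    and v2_ode: "\<forall>\<tau>\<in>{0..T}.
          (v2 has_vector_derivative A \<tau> *v v2 \<tau> - v1 \<tau>) (at \<tau> within {0..T})"
    and v2_bc: "v2 T = - v2 0"
    and v2_norm: "integral {0..T} (\<lambda>\<tau>. v2 \<tau> \<bullet> v1 \<tau>) = 0"
    and v2_ext: "\<forall>\<tau>. v2 (\<tau> + T) = - v2 \<tau>"
    and \<phi>s_ode: "\<forall>\<tau>\<in>{0..T}.
          (\<phi>s has_vector_derivative - (transpose (A \<tau>) *v \<phi>s \<tau>)) (at \<tau> within {0..T})"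
    and \<phi>s_bc: "\<phi>s T = \<phi>s 0"
    and \<phi>s_norm: "integral {0..T} (\<lambda>\<tau>. \<phi>s \<tau> \<bullet> F (u0 \<tau>)) = 1"
    and v1s_ode: "\<forall>\<tau>\<in>{0..T}.
          (v1s has_vector_derivative - (transpose (A \<tau>) *v v1s \<tau>)) (at \<tau> within {0..T})"
    and v1s_bc: "v1s T = - v1s 0"
    and v1s_norm: "integral {0..T} (\<lambda>\<tau>. v1s \<tau> \<bullet> v2 \<tau>) = 1"
    and v2s_ode: "\<forall>\<tau>\<in>{0..T}.
          (v2s has_vector_derivative v1s \<tau> - transpose (A \<tau>) *v v2s \<tau>) (at \<tau> within {0..T})"
    and v2s_bc: "v2s T = - v2s 0"
    and v2s_norm: "integral {0..T} (\<lambda>\<tau>. v2s \<tau> \<bullet> v2 \<tau>) = 0"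
    and center_manifold: "R2_center_manifold F u0 T v1 v2 H h \<alpha> a b"
  shows
    "\<alpha> = 1/2 * integral {0..T} (\<lambda>\<tau>. \<phi>s \<tau> \<bullet> B \<tau> (v1 \<tau>) (v1 \<tau>)) \<and>
     unique_solution_on {0..T}
       (\<lambda>g. (\<forall>\<tau>\<in>{0..T}. (g has_vector_derivative
                 A \<tau> *v g \<tau> + B \<tau> (v1 \<tau>) (v1 \<tau>) - (2 * \<alpha>) *\<^sub>R F (u0 \<tau>))
                 (at \<tau> within {0..T})) \<and>
            g T - g 0 = 0 \<and>
            integral {0..T} (\<lambda>\<tau>. \<phi>s \<tau> \<bullet> g \<tau>) =
              integral {0..T} (\<lambda>\<tau>. \<phi>s \<tau> \<bullet> B \<tau> (v1 \<tau>) (v2 \<tau>)))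
       (h 2 0) \<and>
     unique_solution_on {0..T}
       (\<lambda>g. (\<forall>\<tau>\<in>{0..T}. (g has_vector_derivative
                 A \<tau> *v g \<tau> + B \<tau> (v1 \<tau>) (v2 \<tau>) - h 2 0 \<tau>)
                 (at \<tau> within {0..T})) \<and>
            g T - g 0 = 0 \<and>
            integral {0..T} (\<lambda>\<tau>. \<phi>s \<tau> \<bullet> g \<tau>) =
              1/2 * integral {0..T} (\<lambda>\<tau>. \<phi>s \<tau> \<bullet> B \<tau> (v2 \<tau>) (v2 \<tau>)))
       (h 1 1) \<and>
     a = 1/6 * integral {0..T} (\<lambda>\<tau>. v1s \<tau> \<bullet>
           (C \<tau> (v1 \<tau>) (v1 \<tau>) (v1 \<tau>) + 3 *\<^sub>R B \<tau> (v1 \<tau>) (h 2 0 \<tau>)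
            - (6 * \<alpha>) *\<^sub>R (A \<tau> *v v1 \<tau>))) \<and>
     b = 1/2 * integral {0..T} (\<lambda>\<tau>. v1s \<tau> \<bullet>
           (- (2 * \<alpha>) *\<^sub>R (A \<tau> *v v2 \<tau>) + C \<tau> (v1 \<tau>) (v1 \<tau>) (v2 \<tau>)
            + B \<tau> (h 2 0 \<tau>) (v2 \<tau>) + 2 *\<^sub>R B \<tau> (h 1 1 \<tau>) (v1 \<tau>)))
       + 1/2 * integral {0..T} (\<lambda>\<tau>. v2s \<tau> \<bullet>
           (C \<tau> (v1 \<tau>) (v1 \<tau>) (v1 \<tau>) + 3 *\<^sub>R B \<tau> (v1 \<tau>) (h 2 0 \<tau>)
            - (6 * \<alpha>) *\<^sub>R (A \<tau> *v v1 \<tau>)))"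
proof -
  have F4: "Ck_on (Suc (Suc (Suc (Suc 0)))) F UNIV"
    using F_smooth by (simp only: numeral_eq_Suc pred_numeral_simps BitM.simps numeral_One One_nat_def)
  note F3 = Ck_on_SucD[OF F4]
  have T: "T > 0" and u0: "\<And>\<tau>. (u0 has_vector_derivative F (u0 \<tau>)) (at \<tau>)"
    and u0_per: "\<And>\<tau>. u0 (\<tau> + T) = u0 \<tau>"
    using cycle by (auto simp: periodic_orbit_def)
  have A_dderiv: "A \<tau> *v v = dderiv v F (u0 \<tau>)" for \<tau> v
    using dderiv_eqI[OF jacobian_works[THEN iffD1, OF Ck_on_differentiable[OF F4 UNIV_I]]]
    by (simp add: A)
  have A_per: "A T = A 0"
    using u0_per[of 0] by (simp add: A)
  have A_neg: "A \<tau> *v (- v) = - (A \<tau> *v v)" for \<tau> v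
    using linear_neg[OF matrix_vector_mul_linear] .
  have v1: "(v1 has_vector_derivative A \<tau> *v v1 \<tau>) (at \<tau>)" if "\<tau> \<in> {0..T}" for \<tau>
    by (rule antiperiodic_has_vector_derivative[OF T, where d = "\<lambda>\<tau>. A \<tau> *v v1 \<tau>"])
      (use v1_ode v1_ext v1_bc that in \<open>auto simp: A_per A_neg\<close>)
  have v2: "(v2 has_vector_derivative A \<tau> *v v2 \<tau> - v1 \<tau>) (at \<tau>)" if "\<tau> \<in> {0..T}" for \<tau>
    by (rule antiperiodic_has_vector_derivative[OF T, where d = "\<lambda>\<tau>. A \<tau> *v v2 \<tau> - v1 \<tau>"])
      (use v2_ode v2_ext v2_bc v1_bc that in \<open>auto simp: A_per A_neg\<close>)
  from center_manifold obtain \<delta> R0 R1 R2 where \<delta>: "\<delta> > 0"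
    and K4: "Ck_on 4 (\<lambda>(\<tau>, \<xi>). H \<tau> \<xi>) (UNIV \<times> ball 0 \<delta>)"
    and bigo': "\<forall>\<tau>. (\<lambda>\<xi>. norm (H \<tau> \<xi> -
               (\<Sum>(i, j) \<in> {(i, j). 2 \<le> i + j \<and> i + j \<le> 3}.
                  (1 / (fact i * fact j) * (\<xi> $ 1)^i * (\<xi> $ 2)^j) *\<^sub>R h i j \<tau>)))
             \<in> O[at 0](\<lambda>\<xi>. norm \<xi> ^ 4)"
    and sym: "\<forall>\<tau>. \<forall>\<xi>\<in>ball 0 \<delta>. cm_param u0 v1 v2 H \<tau> \<xi> = cm_param u0 v1 v2 H (\<tau> + T) (- \<xi>)"
    and R: "higher_order_term T \<delta> R0" "higher_order_term T \<delta> R1" "higher_order_term T \<delta> R2"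
    and inv: "\<forall>\<tau> \<xi> r s. (\<forall>t\<in>{r<..<s}. \<xi> t \<in> ball 0 \<delta>) \<and>
           solves_R2_normal_form \<alpha> a b R0 R1 R2 \<tau> \<xi> {r<..<s} \<longrightarrow>
           (\<forall>t\<in>{r<..<s}.
              ((\<lambda>t. cm_param u0 v1 v2 H (\<tau> t) (\<xi> t)) has_vector_derivative
                 F (cm_param u0 v1 v2 H (\<tau> t) (\<xi> t))) (at t))"
    unfolding R2_center_manifold_def by (elim exE conjE) (rule that; assumption)
  note bigo = bigo'[rule_format]
  have K4': "Ck_on (Suc (Suc (Suc (Suc 0)))) (\<lambda>(\<tau>, \<xi>). H \<tau> \<xi>) (UNIV \<times> ball 0 \<delta>)"
    using K4 by (simp only: numeral_eq_Suc pred_numeral_simps BitM.simps numeral_One One_nat_def)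
  \<comment> \<open>The rest of the parametrization satisfies the symmetry by itself, since
    \<open>u0\<close> is periodic and \<open>v1\<close>, \<open>v2\<close> are antiperiodic.\<close>
  have H_sym: "H (\<tau> + T) (- \<xi>) = H \<tau> \<xi>" if "\<xi> \<in> ball 0 \<delta>" for \<tau> \<xi>
    using sym[rule_format, OF that, of \<tau>] v1_ext v2_ext by (simp add: cm_param_def u0_per)
  note h_shift = taylor_coefficients_shift[where \<tau> = 0 and T = T and h = h and H = H, OF Ck_on_SucD[OF K4'] \<delta> bigo H_sym, simplified]
  from taylor_coefficients_derivative[OF K4 \<delta> bigo] obtain dh where
    dh: "\<And>i j \<tau>. i + j = 2 \<or> i + j = 3 \<Longrightarrow> (h i j has_vector_derivative dh i j \<tau>) (at \<tau>)"
    and dh_jet: "\<And>\<tau> \<eta>. jet3 (\<lambda>s. dderiv (1, 0) (\<lambda>(\<tau>, \<xi>). H \<tau> \<xi>) (\<tau>, s *\<^sub>R \<eta>)) 0 0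
       ((1/2) *\<^sub>R form2 (\<lambda>i j. dh i j \<tau>) (\<eta> $ 1) (\<eta> $ 2)) ((1/6) *\<^sub>R form3 (\<lambda>i j. dh i j \<tau>) (\<eta> $ 1) (\<eta> $ 2))"
    by blast
  have within: "(f has_vector_derivative d) (at \<tau> within {0..T})"
    if "(f has_vector_derivative d) (at \<tau>)" for f :: "real \<Rightarrow> real^'n" and d \<tau>
    using that by (rule has_vector_derivative_at_within)

  define Z where "Z \<tau> = C \<tau> (v1 \<tau>) (v1 \<tau>) (v1 \<tau>) + 3 *\<^sub>R B \<tau> (v1 \<tau>) (h 2 0 \<tau>) - (6 * \<alpha>) *\<^sub>R (A \<tau> *v v1 \<tau>)" for \<tau>
  \<comment> \<open>The factor \<alpha> multiplies the derivative of \<open>v2\<close>, which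
    contains \<open>- v1 \<tau>\<close>, through the \<tau>-velocity, and \<open>v1 \<tau>\<close>
    through the velocity of the first component of \<xi>. The two occurrences of
    \<open>v1 \<tau>\<close> cancel.\<close>
  define X where "X \<tau> = - (2 * \<alpha>) *\<^sub>R (A \<tau> *v v2 \<tau>) + C \<tau> (v1 \<tau>) (v1 \<tau>) (v2 \<tau>)
            + B \<tau> (h 2 0 \<tau>) (v2 \<tau>) + 2 *\<^sub>R B \<tau> (h 1 1 \<tau>) (v1 \<tau>)" for \<tau>
  have ode: "(h 2 0 has_vector_derivative A \<tau> *v h 2 0 \<tau> + (B \<tau> (v1 \<tau>) (v1 \<tau>) - (2 * \<alpha>) *\<^sub>R F (u0 \<tau>))) (at \<tau> within {0..T})"
    "(h 1 1 has_vector_derivative A \<tau> *v h 1 1 \<tau> + (B \<tau> (v1 \<tau>) (v2 \<tau>) - h 2 0 \<tau>)) (at \<tau> within {0..T})"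
    "(h 0 2 has_vector_derivative A \<tau> *v h 0 2 \<tau> + (B \<tau> (v2 \<tau>) (v2 \<tau>) - 2 *\<^sub>R h 1 1 \<tau>)) (at \<tau> within {0..T})"
    "(h 3 0 has_vector_derivative A \<tau> *v h 3 0 \<tau> + (Z \<tau> - (6 * a) *\<^sub>R v2 \<tau>)) (at \<tau> within {0..T})"
    "(h 2 1 has_vector_derivative A \<tau> *v h 2 1 \<tau> + (X \<tau> - h 3 0 \<tau> - (2 * b) *\<^sub>R v2 \<tau>)) (at \<tau> within {0..T})"
    if \<tau>: "\<tau> \<in> {0..T}" for \<tau>
  proof -
    note jets = homological_equation_jets[where h = h and dh = "\<lambda>i j. dh i j \<tau>" and H = H and \<tau> = \<tau> and F = F and ?u0.0 = u0 and ?v1.0 = v1 and ?v2.0 = v2, OF u0 v1[OF \<tau>] v2[OF \<tau>] F3 K4 \<delta> bigo dh_jet R inv]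
    have nz: "vector [x, y] \<noteq> (0 :: real^2)" if "x \<noteq> 0 \<or> y \<noteq> 0" for x y :: real
      using that by (auto simp: vec_eq_iff forall_2)
    note eqs = coefficient_equations[where p = "v1 \<tau>" and q = "v2 \<tau>" and u = "u0 \<tau>" and F = F
      and c = "\<lambda>i j. h i j \<tau>" and dc = "\<lambda>i j. dh i j \<tau>" and du = "F (u0 \<tau>)" and dp = "A \<tau> *v v1 \<tau>"
      and dq = "A \<tau> *v v2 \<tau> - v1 \<tau>", OF F3 jets(1)[OF nz, unfolded vector_2] jets(2)[OF nz, unfolded vector_2]]
    show "(h 2 0 has_vector_derivative A \<tau> *v h 2 0 \<tau> + (B \<tau> (v1 \<tau>) (v1 \<tau>) - (2 * \<alpha>) *\<^sub>R F (u0 \<tau>))) (at \<tau> within {0..T})"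
      using within[OF dh[of 2 0 \<tau>]] eqs(1) by (simp add: A_dderiv B add_diff_eq)
    show "(h 1 1 has_vector_derivative A \<tau> *v h 1 1 \<tau> + (B \<tau> (v1 \<tau>) (v2 \<tau>) - h 2 0 \<tau>)) (at \<tau> within {0..T})"
      using within[OF dh[of 1 1 \<tau>]] eqs(2) by (simp add: A_dderiv B add_diff_eq)
    show "(h 0 2 has_vector_derivative A \<tau> *v h 0 2 \<tau> + (B \<tau> (v2 \<tau>) (v2 \<tau>) - 2 *\<^sub>R h 1 1 \<tau>)) (at \<tau> within {0..T})"
      using within[OF dh[of 0 2 \<tau>]] eqs(3) by (simp add: A_dderiv B add_diff_eq)
    show "(h 3 0 has_vector_derivative A \<tau> *v h 3 0 \<tau> + (Z \<tau> - (6 * a) *\<^sub>R v2 \<tau>)) (at \<tau> within {0..T})"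
    proof -
      have "dh 3 0 \<tau> = A \<tau> *v h 3 0 \<tau> + (Z \<tau> - (6 * a) *\<^sub>R v2 \<tau>)"
        using eqs(4) by (simp add: Z_def A_dderiv B C)
      with within[OF dh[of 3 0 \<tau>]] show ?thesis by simp
    qed
    show "(h 2 1 has_vector_derivative A \<tau> *v h 2 1 \<tau> + (X \<tau> - h 3 0 \<tau> - (2 * b) *\<^sub>R v2 \<tau>)) (at \<tau> within {0..T})"
    proof -
      have "dh 2 1 \<tau> = A \<tau> *v h 2 1 \<tau> + (X \<tau> - h 3 0 \<tau> - (2 * b) *\<^sub>R v2 \<tau>)"
        using eqs(5) by (simp add: X_def A_dderiv B C)
      with within[OF dh[of 2 1 \<tau>]] show ?thesis by simp
    qed
  qed

  have cont_of: "continuous_on {0..T} f"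
    if "\<And>\<tau>. \<tau> \<in> {0..T} \<Longrightarrow> (f has_vector_derivative d \<tau>) (at \<tau> within {0..T})" for f d :: "real \<Rightarrow> real^'n"
    by (auto simp: continuous_on_eq_continuous_within intro!: has_vector_derivative_continuous that)
  have Fu0_deriv: "((\<lambda>\<tau>. F (u0 \<tau>)) has_vector_derivative A \<tau> *v F (u0 \<tau>)) (at \<tau> within {0..T})" for \<tau>
    unfolding A_dderiv by (intro within dderiv_along_curve Ck_on_differentiable[OF F4] u0 UNIV_I)
  note cont = cont_of[OF \<phi>s_ode[rule_format]] cont_of[OF v1s_ode[rule_format]] cont_of[OF v2s_ode[rule_format]]
    cont_of[OF v2_ode[rule_format]] cont_of[OF Fu0_deriv] cont_of[OF ode(1)] cont_of[OF ode(2)] cont_of[OF ode(4)]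
  have int: "(\<lambda>\<tau>. f \<tau> \<bullet> g \<tau>) integrable_on {0..T}"
    if "continuous_on {0..T} f" "continuous_on {0..T} g" for f g :: "real \<Rightarrow> real^'n"
    by (intro integrable_continuous_real continuous_intros that)
  note int_F = int[OF cont(1) cont(5)] and int_20 = int[OF cont(1) cont(6)] and int_11 = int[OF cont(1) cont(7)]
    and int_1v = int[OF cont(2) cont(4)] and int_2v = int[OF cont(3) cont(4)] and int_1h = int[OF cont(2) cont(8)]
  have \<phi>s_ode': "(\<phi>s has_vector_derivative 0 - transpose (A \<tau>) *v \<phi>s \<tau>) (at \<tau> within {0..T})" if "\<tau> \<in> {0..T}" for \<tau>
    using \<phi>s_ode that by simp
  have v1s_ode': "(v1s has_vector_derivative 0 - transpose (A \<tau>) *v v1s \<tau>) (at \<tau> within {0..T})" if "\<tau> \<in> {0..T}" for \<tau>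
    using v1s_ode that by simp
  note pairing = adjoint_pairing_has_integral[OF less_imp_le[OF T]]

  \<comment> \<open>Degree 2 is paired with the periodic \<open>\<phi>s\<close>, degree 3 with the
    antiperiodic \<open>v1s\<close> and \<open>v2s\<close>; in either case the product takes equal
    values at 0 and \<open>T\<close>.\<close>
  have p20: "((\<lambda>\<tau>. \<phi>s \<tau> \<bullet> (B \<tau> (v1 \<tau>) (v1 \<tau>) - (2 * \<alpha>) *\<^sub>R F (u0 \<tau>)) + 0 \<bullet> h 2 0 \<tau>) has_integral 0) {0..T}"
    by (rule pairing[OF \<phi>s_ode' ode(1)]) (simp_all add: \<phi>s_bc h_shift)
  have p11: "((\<lambda>\<tau>. \<phi>s \<tau> \<bullet> (B \<tau> (v1 \<tau>) (v2 \<tau>) - h 2 0 \<tau>) + 0 \<bullet> h 1 1 \<tau>) has_integral 0) {0..T}"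
    by (rule pairing[OF \<phi>s_ode' ode(2)]) (simp_all add: \<phi>s_bc h_shift[unfolded One_nat_def])
  have p02: "((\<lambda>\<tau>. \<phi>s \<tau> \<bullet> (B \<tau> (v2 \<tau>) (v2 \<tau>) - 2 *\<^sub>R h 1 1 \<tau>) + 0 \<bullet> h 0 2 \<tau>) has_integral 0) {0..T}"
    by (rule pairing[OF \<phi>s_ode' ode(3)]) (simp_all add: \<phi>s_bc h_shift)
  have p30: "((\<lambda>\<tau>. v1s \<tau> \<bullet> (Z \<tau> - (6 * a) *\<^sub>R v2 \<tau>) + 0 \<bullet> h 3 0 \<tau>) has_integral 0) {0..T}"
    by (rule pairing[OF v1s_ode' ode(4)]) (simp_all add: v1s_bc h_shift)
  \<comment> \<open>The source \<open>v1s\<close> in the equation of \<open>v2s\<close> brings in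
    the integral of \<open>v1s \<tau> \<bullet> h 3 0 \<tau>\<close>.\<close>
  have p30': "((\<lambda>\<tau>. v2s \<tau> \<bullet> (Z \<tau> - (6 * a) *\<^sub>R v2 \<tau>) + v1s \<tau> \<bullet> h 3 0 \<tau>) has_integral 0) {0..T}"
    by (rule pairing[OF v2s_ode[rule_format] ode(4)]) (simp_all add: v2s_bc h_shift)
  have p21: "((\<lambda>\<tau>. v1s \<tau> \<bullet> (X \<tau> - h 3 0 \<tau> - (2 * b) *\<^sub>R v2 \<tau>) + 0 \<bullet> h 2 1 \<tau>) has_integral 0) {0..T}"
    by (rule pairing[OF v1s_ode' ode(5)]) (simp_all add: v1s_bc h_shift[unfolded One_nat_def])

  have "((\<lambda>\<tau>. \<phi>s \<tau> \<bullet> B \<tau> (v1 \<tau>) (v1 \<tau>)) has_integral 2 * \<alpha>) {0..T}"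
    using has_integral_add[OF p20 has_integral_mult_right[OF integrable_integral[OF int_F], of "2 * \<alpha>"]]
    by (simp add: inner_diff_right \<phi>s_norm)
  then have \<alpha>_eq: "\<alpha> = 1/2 * integral {0..T} (\<lambda>\<tau>. \<phi>s \<tau> \<bullet> B \<tau> (v1 \<tau>) (v1 \<tau>))"
    by (simp add: integral_unique)
  have "((\<lambda>\<tau>. \<phi>s \<tau> \<bullet> B \<tau> (v1 \<tau>) (v2 \<tau>)) has_integral integral {0..T} (\<lambda>\<tau>. \<phi>s \<tau> \<bullet> h 2 0 \<tau>)) {0..T}"
    using has_integral_add[OF p11 integrable_integral[OF int_20]] by (simp add: inner_diff_right)
  then have h20_norm: "integral {0..T} (\<lambda>\<tau>. \<phi>s \<tau> \<bullet> h 2 0 \<tau>) = integral {0..T} (\<lambda>\<tau>. \<phi>s \<tau> \<bullet> B \<tau> (v1 \<tau>) (v2 \<tau>))"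
    by (simp add: integral_unique)
  have "((\<lambda>\<tau>. \<phi>s \<tau> \<bullet> B \<tau> (v2 \<tau>) (v2 \<tau>)) has_integral 2 * integral {0..T} (\<lambda>\<tau>. \<phi>s \<tau> \<bullet> h 1 1 \<tau>)) {0..T}"
    using has_integral_add[OF p02 has_integral_mult_right[OF integrable_integral[OF int_11], of 2]]
    by (simp add: inner_diff_right)
  then have h11_norm: "integral {0..T} (\<lambda>\<tau>. \<phi>s \<tau> \<bullet> h 1 1 \<tau>) = 1/2 * integral {0..T} (\<lambda>\<tau>. \<phi>s \<tau> \<bullet> B \<tau> (v2 \<tau>) (v2 \<tau>))"
    by (simp add: integral_unique)
  have "((\<lambda>\<tau>. v1s \<tau> \<bullet> Z \<tau>) has_integral 6 * a) {0..T}"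
    using has_integral_add[OF p30 has_integral_mult_right[OF integrable_integral[OF int_1v], of "6 * a"]]
    by (simp add: inner_diff_right v1s_norm)
  then have a_eq: "a = 1/6 * integral {0..T} (\<lambda>\<tau>. v1s \<tau> \<bullet> Z \<tau>)"
    by (simp add: integral_unique)
  \<comment> \<open>This unknown integral enters the next two identities with opposite signs, so
    their sum is \<open>2 * b\<close>. The normalization of \<open>v2s\<close> against
    \<open>v2\<close> removes \<open>a\<close>, that of \<open>v1s\<close> isolates
    \<open>b\<close>.\<close>
  let ?c = "integral {0..T} (\<lambda>\<tau>. v1s \<tau> \<bullet> h 3 0 \<tau>)"
  have "((\<lambda>\<tau>. v2s \<tau> \<bullet> Z \<tau>) has_integral - ?c) {0..T}"
    using has_integral_diff[OF has_integral_add[OF p30' has_integral_mult_right[OF integrable_integral[OF int_2v], of "6 * a"]]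
        integrable_integral[OF int_1h]]
    by (simp add: inner_diff_right v2s_norm)
  moreover have "((\<lambda>\<tau>. v1s \<tau> \<bullet> X \<tau>) has_integral ?c + 2 * b) {0..T}"
    using has_integral_add[OF has_integral_add[OF p21 integrable_integral[OF int_1h]]
        has_integral_mult_right[OF integrable_integral[OF int_1v], of "2 * b"]]
    by (simp add: inner_diff_right v1s_norm)
  ultimately have b_eq: "b = 1/2 * integral {0..T} (\<lambda>\<tau>. v1s \<tau> \<bullet> X \<tau>) + 1/2 * integral {0..T} (\<lambda>\<tau>. v2s \<tau> \<bullet> Z \<tau>)"
    by (simp add: integral_unique field_simps)

  obtain L where L: "\<And>\<tau> v. \<tau> \<in> {0..T} \<Longrightarrow> norm (A \<tau> *v v) \<le> L * norm v"
  proof (rule linear_family_bounded_on_compact[of "{0..T}" "\<lambda>\<tau> v. A \<tau> *v v"])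
    have "continuous_on {0..T} u0"
      by (auto intro!: continuous_at_imp_continuous_on has_vector_derivative_continuous u0)
    then show "continuous_on {0..T} (\<lambda>\<tau>. A \<tau> *v v)" for v
      unfolding A_dderiv
      by (rule continuous_on_compose2[OF Ck_on_imp_continuous_on[OF Ck_on_dderiv[OF F4]]]) auto
  qed auto
  have monodromy: "k \<tau> = Y \<tau> *v k 0"
    if "\<And>\<tau>. \<tau> \<in> {0..T} \<Longrightarrow> (k has_vector_derivative A \<tau> *v k \<tau>) (at \<tau> within {0..T})" "\<tau> \<in> {0..T}" for k \<tau>
    by (rule fundamental_matrix_solution[of T A L Y k \<tau>]) (use L Y_ode Y_init that in auto)
  have Fu0_fixed: "Y T *v F (u0 0) = F (u0 0)"
    using monodromy[OF Fu0_deriv, of T] T u0_per[of 0] by simp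
  \<comment> \<open>If \<open>F\<close> vanished at \<open>u0 0\<close>, then
    \<open>F (u0 \<tau>)\<close>, a solution of the variational equation, would vanish on the whole
    period, against its normalization with \<open>\<phi>s\<close>.\<close>
  have Fu0_nz: "F (u0 0) \<noteq> 0"
  proof
    assume "F (u0 0) = 0"
    then have "F (u0 \<tau>) = 0" if "\<tau> \<in> {0..T}" for \<tau>
      using monodromy[OF Fu0_deriv that] by simp
    then have "integral {0..T} (\<lambda>\<tau>. \<phi>s \<tau> \<bullet> F (u0 \<tau>)) = integral {0..T} (\<lambda>\<tau>. 0)"
      by (intro integral_cong) simp
    then show False using \<phi>s_norm by simp
  qed
  \<comment> \<open>A periodic solution starts at a fixed vector of the monodromy matrix, that is,
    at \<open>c\<close> times \<open>F (u0 0)\<close>, and its pairing with \<open>\<phi>s\<close>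
    equals \<open>c\<close>. This is why one integral condition selects a unique solution.\<close>
  have homogeneous: "k \<tau> = 0"
    if k: "\<And>\<tau>. \<tau> \<in> {0..T} \<Longrightarrow> (k has_vector_derivative A \<tau> *v k \<tau>) (at \<tau> within {0..T})"
      and per: "k T = k 0" and norm: "integral {0..T} (\<lambda>\<tau>. \<phi>s \<tau> \<bullet> k \<tau>) = 0" and \<tau>: "\<tau> \<in> {0..T}" for k \<tau>
  proof -
    have "Y T *v k 0 = k 0"
      using monodromy[OF k, of T] T per by simp
    then obtain c where c: "k 0 = c *\<^sub>R F (u0 0)"
      using simple_eigenvalue_one_fixed_vectors[OF _ Fu0_fixed Fu0_nz] R2 unfolding R2_multipliers_def by blast
    have k_eq: "k \<tau> = c *\<^sub>R F (u0 \<tau>)" if "\<tau> \<in> {0..T}" for \<tau>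
      using monodromy[OF k that] monodromy[OF Fu0_deriv that] by (simp add: c matrix_vector_mult_scaleR)
    then have "integral {0..T} (\<lambda>\<tau>. \<phi>s \<tau> \<bullet> k \<tau>) = integral {0..T} (\<lambda>\<tau>. c * (\<phi>s \<tau> \<bullet> F (u0 \<tau>)))"
      by (intro integral_cong) simp
    then have "c = 0"
      using norm \<phi>s_norm by simp
    with k_eq[OF \<tau>] show ?thesis by simp
  qed
  have unique: "k \<tau> = g \<tau>"
    if k: "\<And>\<tau>. \<tau> \<in> {0..T} \<Longrightarrow> (k has_vector_derivative A \<tau> *v k \<tau> + s \<tau>) (at \<tau> within {0..T})"
      and g: "\<And>\<tau>. \<tau> \<in> {0..T} \<Longrightarrow> (g has_vector_derivative A \<tau> *v g \<tau> + s \<tau>) (at \<tau> within {0..T})"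
      and per: "k T - k 0 = 0" "g T - g 0 = 0"
      and norm: "integral {0..T} (\<lambda>\<tau>. \<phi>s \<tau> \<bullet> k \<tau>) = integral {0..T} (\<lambda>\<tau>. \<phi>s \<tau> \<bullet> g \<tau>)" and \<tau>: "\<tau> \<in> {0..T}"
    for k g s :: "real \<Rightarrow> real^'n" and \<tau>
  proof -
    have "k \<tau> - g \<tau> = 0"
    proof (rule homogeneous[where k = "\<lambda>\<tau>. k \<tau> - g \<tau>", OF _ _ _ \<tau>])
      show "((\<lambda>\<tau>. k \<tau> - g \<tau>) has_vector_derivative A \<tau> *v (k \<tau> - g \<tau>)) (at \<tau> within {0..T})" if "\<tau> \<in> {0..T}" for \<tau>
        using has_vector_derivative_diff[OF k[OF that] g[OF that]] by (simp add: matrix_vector_mult_diff_distrib)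
      show "integral {0..T} (\<lambda>\<tau>. \<phi>s \<tau> \<bullet> (k \<tau> - g \<tau>)) = 0"
        using norm integral_diff[OF int[OF cont(1) cont_of[OF k]] int[OF cont(1) cont_of[OF g]]]
        by (simp add: inner_diff_right)
    qed (use per in simp)
    then show ?thesis by simp
  qed
  have h20: "unique_solution_on {0..T}
       (\<lambda>g. (\<forall>\<tau>\<in>{0..T}. (g has_vector_derivative
                 A \<tau> *v g \<tau> + B \<tau> (v1 \<tau>) (v1 \<tau>) - (2 * \<alpha>) *\<^sub>R F (u0 \<tau>))
                 (at \<tau> within {0..T})) \<and>
            g T - g 0 = 0 \<and>
            integral {0..T} (\<lambda>\<tau>. \<phi>s \<tau> \<bullet> g \<tau>) =
              integral {0..T} (\<lambda>\<tau>. \<phi>s \<tau> \<bullet> B \<tau> (v1 \<tau>) (v2 \<tau>)))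
       (h 2 0)"
    unfolding unique_solution_on_def add_diff_eq [symmetric]
  proof (intro conjI ballI allI impI; (elim conjE)?)
    show "h 2 0 T - h 2 0 0 = 0" using h_shift(1) by simp
    show "k \<tau> = h 2 0 \<tau>"
      if "\<forall>\<tau>\<in>{0..T}. (k has_vector_derivative A \<tau> *v k \<tau> + (B \<tau> (v1 \<tau>) (v1 \<tau>) - (2 * \<alpha>) *\<^sub>R F (u0 \<tau>))) (at \<tau> within {0..T})"
        "k T - k 0 = 0" "integral {0..T} (\<lambda>\<tau>. \<phi>s \<tau> \<bullet> k \<tau>) = integral {0..T} (\<lambda>\<tau>. \<phi>s \<tau> \<bullet> B \<tau> (v1 \<tau>) (v2 \<tau>))" "\<tau> \<in> {0..T}" for k \<tau>
      by (rule unique[OF that(1)[rule_format] ode(1)]) (use that h_shift(1) h20_norm in simp_all)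
  qed (use ode(1) h20_norm in auto)
  have h11: "unique_solution_on {0..T}
       (\<lambda>g. (\<forall>\<tau>\<in>{0..T}. (g has_vector_derivative
                 A \<tau> *v g \<tau> + B \<tau> (v1 \<tau>) (v2 \<tau>) - h 2 0 \<tau>)
                 (at \<tau> within {0..T})) \<and>
            g T - g 0 = 0 \<and>
            integral {0..T} (\<lambda>\<tau>. \<phi>s \<tau> \<bullet> g \<tau>) =
              1/2 * integral {0..T} (\<lambda>\<tau>. \<phi>s \<tau> \<bullet> B \<tau> (v2 \<tau>) (v2 \<tau>)))
       (h 1 1)"
    unfolding unique_solution_on_def add_diff_eq [symmetric]
  proof (intro conjI ballI allI impI; (elim conjE)?)
    show "h 1 1 T - h 1 1 0 = 0" using h_shift(2) by simp
    show "k \<tau> = h 1 1 \<tau>"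
      if "\<forall>\<tau>\<in>{0..T}. (k has_vector_derivative A \<tau> *v k \<tau> + (B \<tau> (v1 \<tau>) (v2 \<tau>) - h 2 0 \<tau>)) (at \<tau> within {0..T})"
        "k T - k 0 = 0" "integral {0..T} (\<lambda>\<tau>. \<phi>s \<tau> \<bullet> k \<tau>) = 1/2 * integral {0..T} (\<lambda>\<tau>. \<phi>s \<tau> \<bullet> B \<tau> (v2 \<tau>) (v2 \<tau>))" "\<tau> \<in> {0..T}" for k \<tau>
      by (rule unique[OF that(1)[rule_format] ode(2)]) (use that h_shift(2) h11_norm in simp_all)
  qed (use ode(2) h11_norm in auto)
  show ?thesis
    using \<alpha>_eq h20 h11 a_eq b_eq unfolding Z_def X_def by blast
qed

end
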